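(* Let $d\ge 1$ be an integer and let $L(s)=\sum_{k\ge1}a_k k^{-s}$ be a Dirichlet series of period $d$ which is not identically zero (i.e. not all $a_k$ vanish). Let $C$ be a constant with $C>d+\log 2$. Then \[ \delta(a;L)\ \ge\ \frac{\log a}{C} \] for all sufficiently large integers $a$. In particular, $\dim_{\mathbb Q}\bigl(\mathbb Q\text{-span}\{L(2),L(4),L(6),\dots\}\bigr)=\infty$ and $\dim_{\mathbb Q}\bigl(\mathbb Q\text{-span}\{L(3),L(5),L(7),\dots\}\bigr)=\infty$.
   Context: A Dirichlet series $L(s)=\sum_{k=1}^\infty a_k k^{-s}$ with $a_k\in\mathbb C$ is called a Dirichlet series of period $d$ if $a_{k+d}=a_k$ for all $k\ge1$ (it converges for $\mathrm{Re}(s)>1$). For an integer $a\ge2$ define \[ \delta(a;L)=\dim_{\mathbb Q}\Bigl(\mathbb Q\text{-span}\bigl\{a_m,\ L(j)\ \bigm|\ 1\le m\le d,\ 2\le j\le a,\ j\equiv a \pmod 2\bigr\}\Bigr), \] the dimension of the $\mathbb Q$-vector subspace of $\mathbb C$ spanned by these numbers. *)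

theory Defs
  imports "HOL-Analysis.Analysis"
begin

definition qscale :: "rat \<Rightarrow> complex \<Rightarrow> complex" where
  "qscale r z = of_rat r * z"

definition qdim :: "complex set \<Rightarrow> nat" where
  "qdim S = vector_space.dim qscale S"

definition q_infinite_dim :: "complex set \<Rightarrow> bool" where
  "q_infinite_dim S \<longleftrightarrow> (\<forall>B. finite B \<longrightarrow> \<not> S \<subseteq> module.span qscale B)"

definition dir_L :: "(nat \<Rightarrow> complex) \<Rightarrow> nat \<Rightarrow> complex" where
  "dir_L c j = (\<Sum>k. c (Suc k) / of_nat (Suc k) ^ j)"

definition delta :: "nat \<Rightarrow> (nat \<Rightarrow> complex) \<Rightarrow> nat \<Rightarrow> nat" where
  "delta d c a = qdim ({c m | m. 1 \<le> m \<and> m \<le> d} \<union>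
                       {dir_L c j | j. 2 \<le> j \<and> j \<le> a \<and> j mod 2 = a mod 2})"

end

theory Submission
  imports Defs "HOL-Real_Asymp.Real_Asymp"
begin

text \<open>
  After dividing by some $c_m \neq 0$ and taking real parts, which can only decrease the dimension,
  all numbers are real and $c_m = 1$. For even $n$ one takes a rational function $R_n$ with poles of
  order at most $a$ at $0, -d, \dots, -nd$ such that $R_n(-dn-t) = (-1)^a R_n(t)$ and $R_n(k) = 0$ for all
  $1 \le k \le rdn + O(1)$ except for a single $k_0 \equiv m$ modulo $d$ in the middle of this range.
  Partial fractions turn $\sum_k c_k R_n(k)$ into a rational linear combination of the $c_i$ and of the $L(j)$
  with $j \equiv a$ modulo 2. The series is dominated by its term at $k_0$, so
  it is bounded below although the $c_k$ may oscillate.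
  Nesterenko's criterion, with $r$ about $a / \log^2 a$, then gives the dimension bound.

  The criterion, proved with Dirichlet's simultaneous approximation theorem, needs the upper bounds
  only along an infinite set of $n$. Hence the prime number theorem is not required: it is enough
  that $\log \mathrm{lcm}(1,\dots,n) \le (1+\varepsilon) n$ for infinitely many $n$, and this
  follows from $\prod_m \mathrm{lcm}(1,\dots,\lfloor n/m\rfloor) \mid n!$.
\<close>

section \<open>Partial fractions with integrality and size control\<close>

text \<open>The constant d + log 2 is a cost per unit of pole order. With n = 2v the coefficients of
  the linear form grow like exp(2av(d + log 2)): d comes from the a-th power of lcm(1,...,2dv), log
  2 from binomial coefficients in the residues. Before multiplication by that power the form has
  size at most about (4/r)^(2av). The polynomials forcing the zeros cost a further (12dr)^(4drv), so
  r log r must be o(a) while log r stays asymptotic to log a; r about a/log^2 a achieves both. The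
  obstacle is the lower bound, since cancellation among arbitrary periodic coefficients cannot be
  excluded by positivity. At k_0 the zero-forcing polynomials take nonzero integer values, and
  beyond the last zero the terms are smaller by a factor exponentially small in v. The resulting
  two-sided estimate also compares consecutive forms, which is how the criterion passes through
  indices where no upper bound for the lcm is available. Evenness of n makes the number of poles
  odd, so each of the a factors changes sign under t -> -dn - t; the total sign (-1)^a selects the
  L(j) with j congruent to a modulo 2.\<close>

text \<open>Coefficients are only asserted to exist, so sums and products can be formed without
  uniqueness of the expansion. The exponent \<open>a - j\<close> is the usual one: a coefficient of
  order j comes from a - j differentiations at the pole, each costing one factor \<open>D\<close>.
  The identity is restricted to points off the poles because division by zero returns 0.\<close>

definition pfrac :: "nat \<Rightarrow> nat \<Rightarrow> nat \<Rightarrow> nat \<Rightarrow> real \<Rightarrow> (real \<Rightarrow> real) \<Rightarrow> bool" where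
  "pfrac d n D a B h \<longleftrightarrow> (\<exists>A. (\<forall>i\<le>n. \<forall>j\<in>{1..a}. real D ^ (a - j) * A i j \<in> \<int>) \<and>
     (\<Sum>i\<le>n. \<Sum>j=1..a. \<bar>A i j\<bar>) \<le> B \<and>
     (\<forall>t. (\<forall>i\<le>n. t + real (d * i) \<noteq> 0) \<longrightarrow>
        h t = (\<Sum>i\<le>n. \<Sum>j=1..a. A i j / (t + real (d * i)) ^ j)))"

lemma pfrac_cong:
  assumes "pfrac d n D a B h" "B = B'"
    and "\<And>t. (\<And>i. i \<le> n \<Longrightarrow> t + real (d * i) \<noteq> 0) \<Longrightarrow> h t = h' t"
  shows "pfrac d n D a B' h'"
proof -
  obtain A where A: "\<forall>i\<le>n. \<forall>j\<in>{1..a}. real D ^ (a - j) * A i j \<in> \<int>"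
     "(\<Sum>i\<le>n. \<Sum>j=1..a. \<bar>A i j\<bar>) \<le> B"
     "\<And>t. (\<forall>i\<le>n. t + real (d * i) \<noteq> 0) \<longrightarrow>
        h t = (\<Sum>i\<le>n. \<Sum>j=1..a. A i j / (t + real (d * i)) ^ j)"
    using assms(1) unfolding pfrac_def by blast
  then show ?thesis
    unfolding pfrac_def using assms(2,3) by (intro exI[of _ A]) auto
qed

lemma pfrac_mono: "pfrac d n D a B h \<Longrightarrow> B \<le> B' \<Longrightarrow> pfrac d n D a B' h"
  unfolding pfrac_def by (elim exE conjE, intro exI conjI, assumption, erule order_trans) auto

lemma pfrac_0: "pfrac d n D a 0 (\<lambda>_. 0)"
  unfolding pfrac_def by (rule exI[of _ "\<lambda>_ _. 0"]) auto

lemma sum_sum_mult_sum: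
  fixes f :: "'a \<Rightarrow> 'b \<Rightarrow> real"
  shows "(\<Sum>i\<in>I. \<Sum>j\<in>J. f i j) * (\<Sum>k\<in>K. g k) = (\<Sum>i\<in>I. \<Sum>j\<in>J. \<Sum>k\<in>K. f i j * g k)"
  by (simp only: sum_distrib_right) (simp only: sum_distrib_left)

lemma pfrac_pole:
  assumes "i \<le> n" "j \<in> {1..a}" "real D ^ (a - j) * w \<in> \<int>"
  shows "pfrac d n D a \<bar>w\<bar> (\<lambda>t. w / (t + real (d * i)) ^ j)"
proof -
  define A where "A i' j' = (if i' = i then if j' = j then w else 0 else 0)" for i' j'
  have *: "(\<Sum>i'\<le>n. \<Sum>j'=1..a. g i' j' (A i' j')) = g i j w"
    if "\<And>i' j'. g i' j' 0 = 0" for g :: "nat \<Rightarrow> nat \<Rightarrow> real \<Rightarrow> real"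
  proof -
    have "(\<Sum>i'\<le>n. \<Sum>j'=1..a. g i' j' (A i' j'))
        = (\<Sum>i'\<le>n. if i' = i then \<Sum>j'=1..a. if j' = j then g i j w else 0 else 0)"
      unfolding A_def by (intro sum.cong refl) (simp add: that if_distrib[of "g i _"] cong: if_cong)
    also have "\<dots> = g i j w"
      using assms by simp
    finally show ?thesis .
  qed
  show ?thesis unfolding pfrac_def
  proof (rule exI[of _ A], intro conjI allI impI ballI)
    show "(\<Sum>i\<le>n. \<Sum>j = 1..a. \<bar>A i j\<bar>) \<le> \<bar>w\<bar>" using *[of "\<lambda>_ _ x. \<bar>x\<bar>"] by simp
    show "w / (t + real (d * i)) ^ j = (\<Sum>i\<le>n. \<Sum>j = 1..a. A i j / (t + real (d * i)) ^ j)" for t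
      using *[of "\<lambda>i j x. x / (t + real (d * i)) ^ j"] by simp
  qed (use assms in \<open>auto simp: A_def\<close>)
qed

lemma pfrac_add:
  assumes "pfrac d n D a B h" "pfrac d n D a B' h'"
  shows "pfrac d n D a (B + B') (\<lambda>t. h t + h' t)"
proof -
  obtain A where A: "\<forall>i\<le>n. \<forall>j\<in>{1..a}. real D ^ (a - j) * A i j \<in> \<int>"
     "(\<Sum>i\<le>n. \<Sum>j=1..a. \<bar>A i j\<bar>) \<le> B"
     "\<And>t. (\<forall>i\<le>n. t + real (d * i) \<noteq> 0) \<longrightarrow>
        h t = (\<Sum>i\<le>n. \<Sum>j=1..a. A i j / (t + real (d * i)) ^ j)"
    using assms(1) unfolding pfrac_def by blast
  obtain A' where A': "\<forall>i\<le>n. \<forall>j\<in>{1..a}. real D ^ (a - j) * A' i j \<in> \<int>"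
     "(\<Sum>i\<le>n. \<Sum>j=1..a. \<bar>A' i j\<bar>) \<le> B'"
     "\<And>t. (\<forall>i\<le>n. t + real (d * i) \<noteq> 0) \<longrightarrow>
        h' t = (\<Sum>i\<le>n. \<Sum>j=1..a. A' i j / (t + real (d * i)) ^ j)"
    using assms(2) unfolding pfrac_def by blast
  have "(\<Sum>i\<le>n. \<Sum>j=1..a. \<bar>A i j + A' i j\<bar>) \<le> (\<Sum>i\<le>n. \<Sum>j=1..a. \<bar>A i j\<bar> + \<bar>A' i j\<bar>)"
    by (intro sum_mono abs_triangle_ineq)
  also have "\<dots> \<le> B + B'" using A(2) A'(2) by (simp add: sum.distrib)
  finally show ?thesis unfolding pfrac_def
    using A(1,3) A'(1,3)
    by (intro exI[of _ "\<lambda>i j. A i j + A' i j"])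
       (auto simp: sum.distrib add_divide_distrib distrib_left)
qed

lemma pfrac_sum:
  assumes "finite I" "\<And>i. i \<in> I \<Longrightarrow> pfrac d n D a (B i) (h i)"
  shows "pfrac d n D a (\<Sum>i\<in>I. B i) (\<lambda>t. \<Sum>i\<in>I. h i t)"
  using assms by (induction I rule: finite_induct) (simp_all add: pfrac_0 pfrac_add)

text \<open>Repeated use of 1/(x^(j+1) (x+e)) = (1/e)/x^(j+1) - (1/e)/(x^j (x+e)), where e is the
  signed distance between the two poles. Each round divides by e, which divides \<open>D\<close> and
  has modulus at least 1, and lowers the order by one, which frees one factor \<open>D\<close>. At
  most j + 1 coefficients result, each of modulus at most that of \<open>w\<close>.\<close>

lemma pfrac_pole_mult:
  assumes D: "\<And>e. e \<in> {1..n} \<Longrightarrow> d * e dvd D" and d: "d \<ge> 1"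
    and "i \<le> n" "k \<le> n" "j \<le> a" "real D ^ (a - j) * w \<in> \<int>"
  shows "pfrac d n D (Suc a) ((real j + 1) * \<bar>w\<bar>)
    (\<lambda>t. w / ((t + real (d * i)) ^ j * (t + real (d * k))))"
proof (cases "i = k")
  case True
  have "pfrac d n D (Suc a) \<bar>w\<bar> (\<lambda>t. w / (t + real (d * i)) ^ Suc j)"
    by (rule pfrac_pole) (use assms in auto)
  then have "pfrac d n D (Suc a) \<bar>w\<bar> (\<lambda>t. w / ((t + real (d * i)) ^ j * (t + real (d * k))))"
    using True by (simp add: mult.commute)
  then show ?thesis by (rule pfrac_mono) (simp add: algebra_simps)
next
  case False
  define e where "e = real d * (real k - real i)"
  have e0: "e \<noteq> 0" using False d by (simp add: e_def)
  have "\<bar>real k - real i\<bar> = real (if i \<le> k then k - i else i - k)" by auto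
  then have eabs: "\<bar>e\<bar> = real (d * (if i \<le> k then k - i else i - k))"
    by (simp add: e_def abs_mult)
  have "d * (if i \<le> k then k - i else i - k) dvd D"
    by (rule D) (use assms False in auto)
  then obtain D' where "D = d * (if i \<le> k then k - i else i - k) * D'" by (auto elim: dvdE)
  then have "real D = \<bar>e\<bar> * real D'" unfolding eabs of_nat_mult[symmetric] by simp
  then have "real D / \<bar>e\<bar> \<in> \<int>" using e0 by simp
  then have De: "real D / e \<in> \<int>"
    by (cases "e > 0") (auto simp: abs_if split: if_splits dest: Ints_minus)
  have e1: "\<bar>e\<bar> \<ge> 1"
  proof -
    have "1 \<le> d * (if i \<le> k then k - i else i - k)"
      using False d by (auto simp: Suc_le_eq)
    then show ?thesis unfolding eabs by linarith
  qed
  from assms(5,6) show ?thesis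
  proof (induction j arbitrary: w)
    case 0
    have "pfrac d n D (Suc a) \<bar>w\<bar> (\<lambda>t. w / (t + real (d * k)) ^ 1)"
      by (rule pfrac_pole) (use assms 0 in auto)
    then show ?case by simp
  next
    case (Suc j)
    have *: "real D ^ (a - j) * (w / e) = (real D ^ (a - Suc j) * w) * (real D / e)"
      using Suc.prems(1) by (simp add: Suc_diff_Suc[symmetric] Suc_le_eq)
    have int: "real D ^ (a - j) * (w / e) \<in> \<int>"
      unfolding * using Suc.prems De by (intro Ints_mult[of "_ * _"])
    have 1: "pfrac d n D (Suc a) \<bar>w / e\<bar> (\<lambda>t. (w / e) / (t + real (d * i)) ^ Suc j)"
      by (rule pfrac_pole) (use int assms Suc.prems in auto)
    have 2: "pfrac d n D (Suc a) ((real j + 1) * \<bar>- w / e\<bar>)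
      (\<lambda>t. (- w / e) / ((t + real (d * i)) ^ j * (t + real (d * k))))"
    proof (rule Suc.IH)
      show "real D ^ (a - j) * (- w / e) \<in> \<int>" using Ints_minus[OF int] by simp
    qed (use Suc.prems in simp)
    have we: "\<bar>w / e\<bar> \<le> \<bar>w\<bar>" using e1 by (simp add: divide_le_eq mult_le_cancel_left1)
    have "pfrac d n D (Suc a) (\<bar>w / e\<bar> + (real j + 1) * \<bar>- w / e\<bar>)
       (\<lambda>t. w / ((t + real (d * i)) ^ Suc j * (t + real (d * k))))"
    proof (rule pfrac_cong[OF pfrac_add[OF 1 2]])
      fix t assume t: "\<And>i. i \<le> n \<Longrightarrow> t + real (d * i) \<noteq> 0"
      define x where "x = t + real (d * i)"
      have y: "t + real (d * k) = x + e" by (simp add: x_def e_def algebra_simps)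
      have "x \<noteq> 0" "x + e \<noteq> 0" using t[of i] t[of k] assms y by (auto simp: x_def)
      then show "w / e / (t + real (d * i)) ^ Suc j +
          - w / e / ((t + real (d * i)) ^ j * (t + real (d * k))) =
         w / ((t + real (d * i)) ^ Suc j * (t + real (d * k)))"
        unfolding y x_def[symmetric] using e0 by (simp add: divide_simps) (simp add: algebra_simps)
    qed simp
    moreover have "\<bar>w / e\<bar> + (real j + 1) * \<bar>- w / e\<bar> \<le> (real (Suc j) + 1) * \<bar>w\<bar>"
      using mult_left_mono[OF we, of "real j + 2"] by (simp add: algebra_simps add_divide_distrib)
    ultimately show ?case using pfrac_mono by blast
  qed
qed

text \<open>The second factor has only simple poles, so its coefficients are integers (the exponent
  1 - 1 is 0) and the product splits into pairs of poles. Raising the order costs the factor a + 1;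
  iteration produces the a! of \<open>pfrac_prod\<close>, which does not depend on n and is harmless
  asymptotically.\<close>

lemma pfrac_mult:
  assumes D: "\<And>e. e \<in> {1..n} \<Longrightarrow> d * e dvd D" and d: "d \<ge> 1"
    and h: "pfrac d n D a B h" and g: "pfrac d n D 1 B' g" and B: "B \<ge> 0"
  shows "pfrac d n D (Suc a) ((real a + 1) * (B * B')) (\<lambda>t. h t * g t)"
proof -
  obtain A where A: "\<forall>i\<le>n. \<forall>j\<in>{1..a}. real D ^ (a - j) * A i j \<in> \<int>"
     "(\<Sum>i\<le>n. \<Sum>j=1..a. \<bar>A i j\<bar>) \<le> B"
     "\<And>t. (\<forall>i\<le>n. t + real (d * i) \<noteq> 0) \<longrightarrow>
        h t = (\<Sum>i\<le>n. \<Sum>j=1..a. A i j / (t + real (d * i)) ^ j)"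
    using h unfolding pfrac_def by blast
  obtain A' where A': "\<forall>i\<le>n. \<forall>j\<in>{1..1}. real D ^ (1 - j) * A' i j \<in> \<int>"
     "(\<Sum>i\<le>n. \<Sum>j=1..(1::nat). \<bar>A' i j\<bar>) \<le> B'"
     "\<And>t. (\<forall>i\<le>n. t + real (d * i) \<noteq> 0) \<longrightarrow>
        g t = (\<Sum>i\<le>n. \<Sum>j=1..(1::nat). A' i j / (t + real (d * i)) ^ j)"
    using g unfolding pfrac_def by blast
  define \<beta> where "\<beta> k = A' k 1" for k
  have \<beta>: "\<beta> k \<in> \<int>" if "k \<le> n" for k using A'(1) that by (auto simp: \<beta>_def)
  have "pfrac d n D (Suc a) (\<Sum>i\<le>n. \<Sum>j=1..a. \<Sum>k\<le>n. (real a + 1) * \<bar>A i j * \<beta> k\<bar>)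
     (\<lambda>t. \<Sum>i\<le>n. \<Sum>j=1..a. \<Sum>k\<le>n. A i j * \<beta> k / ((t + real (d * i)) ^ j * (t + real (d * k))))"
  proof (intro pfrac_sum finite_atMost finite_atLeastAtMost)
    fix i j k assume "i \<in> {..n}" "j \<in> {1..a}" "k \<in> {..n}"
    then have "pfrac d n D (Suc a) ((real j + 1) * \<bar>A i j * \<beta> k\<bar>)
      (\<lambda>t. A i j * \<beta> k / ((t + real (d * i)) ^ j * (t + real (d * k))))"
      using A(1) \<beta>[of k]
      by (intro pfrac_pole_mult[OF D d]) (auto simp: mult.assoc[symmetric] intro!: Ints_mult)
    then show "pfrac d n D (Suc a) ((real a + 1) * \<bar>A i j * \<beta> k\<bar>)
      (\<lambda>t. A i j * \<beta> k / ((t + real (d * i)) ^ j * (t + real (d * k))))"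
      by (rule pfrac_mono) (use \<open>j \<in> {1..a}\<close> in \<open>auto intro!: mult_right_mono\<close>)
  qed
  then have 1: "pfrac d n D (Suc a) (\<Sum>i\<le>n. \<Sum>j=1..a. \<Sum>k\<le>n. (real a + 1) * \<bar>A i j * \<beta> k\<bar>)
     (\<lambda>t. h t * g t)"
  proof (rule pfrac_cong)
    fix t assume "\<And>i. i \<le> n \<Longrightarrow> t + real (d * i) \<noteq> 0"
    then have "h t = (\<Sum>i\<le>n. \<Sum>j=1..a. A i j / (t + real (d * i)) ^ j)"
      "g t = (\<Sum>k\<le>n. \<beta> k / (t + real (d * k)))"
      using A(3) A'(3) by (simp_all add: \<beta>_def)
    then show "(\<Sum>i\<le>n. \<Sum>j=1..a. \<Sum>k\<le>n. A i j * \<beta> k / ((t + real (d * i)) ^ j * (t + real (d * k)))) = h t * g t"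
      by (simp only: sum_sum_mult_sum times_divide_times_eq)
  qed simp
  have "(\<Sum>i\<le>n. \<Sum>j=1..a. \<Sum>k\<le>n. (real a + 1) * \<bar>A i j * \<beta> k\<bar>) =
     (real a + 1) * ((\<Sum>i\<le>n. \<Sum>j=1..a. \<bar>A i j\<bar>) * (\<Sum>k\<le>n. \<bar>\<beta> k\<bar>))"
    unfolding sum_sum_mult_sum by (simp only: abs_mult sum_distrib_left)
  also have "\<dots> \<le> (real a + 1) * (B * B')"
    using A(2) A'(2) B by (intro mult_left_mono mult_mono) (auto simp: \<beta>_def intro!: sum_nonneg)
  finally show ?thesis using 1 pfrac_mono by blast
qed

lemma pfrac_prod:
  assumes D: "\<And>e. e \<in> {1..n} \<Longrightarrow> d * e dvd D" and d: "d \<ge> 1"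
    and h: "\<And>v. v < a \<Longrightarrow> pfrac d n D 1 (B v) (h v)" and B: "\<And>v. B v \<ge> 0" and "a \<ge> 1"
  shows "pfrac d n D a (fact a * (\<Prod>v<a. B v)) (\<lambda>t. \<Prod>v<a. h v t)"
  using \<open>a \<ge> 1\<close> h
proof (induction a rule: nat_induct_at_least)
  case base
  then show ?case by simp
next
  case (Suc a)
  have "pfrac d n D (Suc a) ((real a + 1) * ((fact a * (\<Prod>v<a. B v)) * B a)) (\<lambda>t. (\<Prod>v<a. h v t) * h a t)"
    using Suc by (intro pfrac_mult[OF D d]) (auto intro!: mult_nonneg_nonneg prod_nonneg B)
  then show ?case by (simp add: algebra_simps)
qed

text \<open>\<open>p\<close> equals its Lagrange interpolant \<open>q\<close> at the n + 1 nodes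
  because both degrees are at most n; dividing \<open>q\<close> by the full product cancels all
  linear factors but one.\<close>

lemma lagrange_partial_fractions:
  fixes p :: "real poly" and z :: "nat \<Rightarrow> real"
  assumes deg: "degree p \<le> n" and inj: "inj_on z {..n}" and t: "\<And>i. i \<le> n \<Longrightarrow> t \<noteq> z i"
  shows "poly p t / (\<Prod>i\<le>n. t - z i) = (\<Sum>i\<le>n. poly p (z i) / (\<Prod>k\<in>{..n}-{i}. z i - z k) / (t - z i))"
proof -
  define q where "q = (\<Sum>i\<le>n. smult (poly p (z i) / (\<Prod>k\<in>{..n}-{i}. z i - z k)) (\<Prod>k\<in>{..n}-{i}. [:- z k, 1:]))"
  have "degree q \<le> n" unfolding q_def
  proof (intro degree_sum_le)
    fix i assume "i \<in> {..n}"
    have "degree (\<Prod>k\<in>{..n}-{i}. [:- z k, 1:]) \<le> (\<Sum>k\<in>{..n}-{i}. degree [:- z k, 1:])"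
      using degree_prod_sum_le[of "{..n}-{i}" "\<lambda>k. [:- z k, 1:]"] by (simp add: o_def)
    also have "\<dots> = n" using \<open>i \<in> {..n}\<close> by simp
    finally show "degree (smult (poly p (z i) / (\<Prod>k\<in>{..n}-{i}. z i - z k)) (\<Prod>k\<in>{..n}-{i}. [:- z k, 1:])) \<le> n"
      using degree_smult_le le_trans by blast
  qed auto
  have "p = q"
  proof (rule poly_eqI_degree)
    show "card (z ` {..n}) > degree p" "card (z ` {..n}) > degree q"
      using deg \<open>degree q \<le> n\<close> by (simp_all add: card_image[OF inj])
    fix x assume "x \<in> z ` {..n}"
    then obtain j where j: "j \<le> n" "x = z j" by auto
    have "poly q x = (\<Sum>i\<le>n. poly p (z i) / (\<Prod>k\<in>{..n}-{i}. z i - z k) * (\<Prod>k\<in>{..n}-{i}. x - z k))"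
      by (simp add: q_def poly_sum poly_prod)
    also have "\<dots> = (\<Sum>i\<le>n. if i = j then poly p (z j) else 0)"
    proof (intro sum.cong refl)
      fix i assume i: "i \<in> {..n}"
      show "poly p (z i) / (\<Prod>k\<in>{..n}-{i}. z i - z k) * (\<Prod>k\<in>{..n}-{i}. x - z k) = (if i = j then poly p (z j) else 0)"
      proof (cases "i = j")
        case True
        have "(\<Prod>k\<in>{..n}-{j}. z j - z k) \<noteq> 0" using inj j by (auto simp: inj_on_def)
        then show ?thesis using True j by simp
      next
        case False
        then have "(\<Prod>k\<in>{..n}-{i}. x - z k) = 0" using j by (intro prod_zero) auto
        then show ?thesis using False by simp
      qed
    qed
    also have "\<dots> = poly p x" using j by simp
    finally show "poly p x = poly q x" by simp
  qed
  have "poly p t / (\<Prod>i\<le>n. t - z i) = (\<Sum>i\<le>n. poly p (z i) / (\<Prod>k\<in>{..n}-{i}. z i - z k) * (\<Prod>k\<in>{..n}-{i}. t - z k) / (\<Prod>i\<le>n. t - z i))"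
    by (subst \<open>p = q\<close>) (simp add: q_def poly_sum poly_prod sum_divide_distrib)
  also have "\<dots> = (\<Sum>i\<le>n. poly p (z i) / (\<Prod>k\<in>{..n}-{i}. z i - z k) / (t - z i))"
  proof (intro sum.cong refl)
    fix i assume i: "i \<in> {..n}"
    have "(\<Prod>i\<le>n. t - z i) = (t - z i) * (\<Prod>k\<in>{..n}-{i}. t - z k)"
      using i by (simp add: prod.remove)
    moreover have "(\<Prod>k\<in>{..n}-{i}. t - z k) \<noteq> 0" using t by auto
    ultimately show "poly p (z i) / (\<Prod>k\<in>{..n}-{i}. z i - z k) * (\<Prod>k\<in>{..n}-{i}. t - z k) / (\<Prod>i\<le>n. t - z i) = poly p (z i) / (\<Prod>k\<in>{..n}-{i}. z i - z k) / (t - z i)"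
      by simp
  qed
  finally show ?thesis .
qed

lemma prod_differences:
  assumes "i \<le> n"
  shows "(\<Prod>k\<in>{..n}-{i}. real k - real i) = (-1) ^ i * fact i * fact (n - i)"
proof -
  have "{..n}-{i} = {..<i} \<union> {i<..n}" using assms by auto
  then have "(\<Prod>k\<in>{..n}-{i}. real k - real i) = (\<Prod>k<i. real k - real i) * (\<Prod>k\<in>{i<..n}. real k - real i)"
    by (simp add: prod.union_disjoint Int_def)
  moreover have "(\<Prod>k<i. real k - real i) = (\<Prod>k<i. (-1) * real (Suc k))"
    by (rule prod.reindex_bij_witness[of _ "\<lambda>k. i - Suc k" "\<lambda>k. i - Suc k"]) (auto simp: of_nat_diff)
  moreover have "(\<Prod>k\<in>{i<..n}. real k - real i) = (\<Prod>k<n - i. real (Suc k))"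
    by (rule prod.reindex_bij_witness[of _ "\<lambda>k. i + Suc k" "\<lambda>k. k - Suc i"]) (auto simp: of_nat_diff)
  moreover have "(\<Prod>k<m. real (Suc k)) = fact m" for m
    by (induction m) (simp_all add: algebra_simps)
  ultimately show ?thesis by (simp only: prod.distrib prod_constant card_lessThan)
qed

text \<open>The residue at -di is d (-1)^i binom(n,i) p(-di): n! against i! (n-i)! gives the
  binomial coefficient, and the form t/d + i of the denominator contributes d^(n+1) against the d^n
  from the differences of the poles. Summing the binomial coefficients yields the 2^n that becomes
  log 2 in the final constant.\<close>

lemma pfrac_simple:
  fixes p :: "real poly"
  assumes "d \<ge> 1" "degree p \<le> n" and int: "\<And>i. i \<le> n \<Longrightarrow> poly p (- real (d * i)) \<in> \<int>"
    and bd: "\<And>i. i \<le> n \<Longrightarrow> \<bar>poly p (- real (d * i))\<bar> \<le> M"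
  shows "pfrac d n D 1 (real d * 2 ^ n * M) (\<lambda>t. fact n * poly p t / (\<Prod>i\<le>n. t / real d + real i))"
proof -
  define \<beta> where "\<beta> i = real d * ((-1) ^ i * real (n choose i) * poly p (- real (d * i)))" for i
  have "pfrac d n D 1 (\<Sum>i\<le>n. \<bar>\<beta> i\<bar>) (\<lambda>t. \<Sum>i\<le>n. \<beta> i / (t + real (d * i)) ^ 1)"
    using int by (intro pfrac_sum pfrac_pole) (auto simp: \<beta>_def intro!: Ints_mult)
  then have "pfrac d n D 1 (\<Sum>i\<le>n. \<bar>\<beta> i\<bar>) (\<lambda>t. fact n * poly p t / (\<Prod>i\<le>n. t / real d + real i))"
  proof (rule pfrac_cong)
    fix t assume t: "\<And>i. i \<le> n \<Longrightarrow> t + real (d * i) \<noteq> 0"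
    have "(\<Prod>i\<le>n. t / real d + real i) = (\<Prod>i\<le>n. (t - (- real (d * i))) * (1 / real d))"
      using assms(1) by (intro prod.cong) (auto simp: field_simps)
    also have "\<dots> = (\<Prod>i\<le>n. (t - (- real (d * i)))) / real d ^ Suc n"
      by (simp only: prod.distrib prod_constant) (simp add: power_one_over power_inverse divide_inverse)
    finally have "fact n * poly p t / (\<Prod>i\<le>n. t / real d + real i) = fact n * real d ^ Suc n * (poly p t / (\<Prod>i\<le>n. t - (- real (d * i))))"
      by simp
    also have "poly p t / (\<Prod>i\<le>n. t - (- real (d * i))) = (\<Sum>i\<le>n. poly p (- real (d * i)) / (\<Prod>k\<in>{..n}-{i}. (- real (d * i)) - (- real (d * k))) / (t - (- real (d * i))))"
    proof (rule lagrange_partial_fractions[OF assms(2)])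
      show "inj_on (\<lambda>i. - real (d * i)) {..n}" using assms(1) by (auto simp: inj_on_def)
      show "t \<noteq> - real (d * i)" if "i \<le> n" for i using t[OF that] by linarith
    qed
    also have "fact n * real d ^ Suc n * \<dots> = (\<Sum>i\<le>n. \<beta> i / (t + real (d * i)) ^ 1)"
      unfolding sum_distrib_left
    proof (intro sum.cong refl)
      fix i assume i: "i \<in> {..n}"
      have "(\<Prod>k\<in>{..n}-{i}. (- real (d * i)) - (- real (d * k))) = (\<Prod>k\<in>{..n}-{i}. real d * (real k - real i))"
        by (simp add: algebra_simps)
      also have "\<dots> = real d ^ n * ((-1) ^ i * fact i * fact (n - i))"
        using i by (simp add: prod.distrib prod_differences card_Diff_singleton)
      finally have 1: "(\<Prod>k\<in>{..n}-{i}. (- real (d * i)) - (- real (d * k))) = real d ^ n * ((-1) ^ i * fact i * fact (n - i))" .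
      have 2: "real (n choose i) = fact n / (fact i * fact (n - i))" using i by (simp add: binomial_fact)
      have 3: "t + real (d * i) \<noteq> 0" using t i by auto
      have 4: "((-1::real) ^ i) * (-1) ^ i = 1" by (simp add: power_mult_distrib[symmetric])
      have 5: "1 / (-1::real) ^ i = (-1) ^ i" using 4 by (simp add: field_simps)
      have "fact n * real d ^ Suc n * (P / (real d ^ n * ((-1) ^ i * fact i * fact (n - i))) / y)
        = real d * ((1 / (-1) ^ i) * (fact n / (fact i * fact (n - i))) * P) / y" for P y
        using assms(1) by (simp add: field_simps)
      then show "fact n * real d ^ Suc n * (poly p (- real (d * i)) / (\<Prod>k\<in>{..n}-{i}. (- real (d * i)) - (- real (d * k))) / (t - (- real (d * i)))) = \<beta> i / (t + real (d * i)) ^ 1"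
        unfolding 1 \<beta>_def 2 5 by simp
    qed
    finally show "(\<Sum>i\<le>n. \<beta> i / (t + real (d * i)) ^ 1) = fact n * poly p t / (\<Prod>i\<le>n. t / real d + real i)" by simp
  qed simp
  moreover have "(\<Sum>i\<le>n. \<bar>\<beta> i\<bar>) \<le> real d * 2 ^ n * M"
  proof -
    have "(\<Sum>i\<le>n. \<bar>\<beta> i\<bar>) \<le> (\<Sum>i\<le>n. real d * M * real (n choose i))"
    proof (intro sum_mono)
      fix i assume "i \<in> {..n}"
      then show "\<bar>\<beta> i\<bar> \<le> real d * M * real (n choose i)"
        using mult_left_mono[OF bd[of i], of "real d * real (n choose i)"]
        by (simp add: \<beta>_def abs_mult mult_ac)
    qed
    also have "\<dots> = real d * M * real (\<Sum>i\<le>n. n choose i)" by (simp add: sum_distrib_left)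
    also have "\<dots> = real d * 2 ^ n * M" by (simp only: choose_row_sum) simp
    finally show ?thesis .
  qed
  ultimately show ?thesis by (rule pfrac_mono)
qed

section \<open>A linear independence criterion\<close>

text \<open>Approximate the ratios \<theta>_l/\<theta>_m simultaneously with a common denominator q
  \<le> H^m. Then q T(v)/\<theta>_m is close to the integer obtained by replacing each q
  \<theta>_l/\<theta>_m by its numerator. At the first v with q |T(v)| < |\<theta>_m|/2 this integer
  must be 0, which makes T(v) very small, whereas \<open>ratio\<close> and the minimality of v keep
  it from being that small.\<close>

lemma criterion_last_nonzero:
  fixes \<theta> :: "nat \<Rightarrow> real" and X :: "nat \<Rightarrow> nat \<Rightarrow> int" and T :: "nat \<Rightarrow> real" and \<eta> A B :: real
  assumes T: "\<And>v. T v = (\<Sum>l\<le>m. of_int (X v l) * \<theta> l)" and "\<theta> m \<noteq> 0"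
    and T0: "\<And>v. v \<ge> v0 \<Longrightarrow> T v \<noteq> 0"
    and ratio: "\<And>v. v \<ge> v0 \<Longrightarrow> exp (- \<eta> * Suc v) * \<bar>T v\<bar> \<le> \<bar>T (Suc v)\<bar>"
    and "\<eta> > 0" "B \<ge> 0"
    and good: "\<And>N. \<exists>w\<ge>N. \<bar>T w\<bar> \<le> exp (- A * real w) \<and>
        (\<forall>v. v0 \<le> v \<and> v \<le> w \<longrightarrow> (\<Sum>l\<le>m. \<bar>X v l\<bar>) \<le> exp (B * real w))"
  shows "A \<le> real m * (B + 2 * \<eta>)"
proof (rule ccontr)
  assume "\<not> A \<le> real m * (B + 2 * \<eta>)"
  then have gap: "A - real m * (B + 2 * \<eta>) > 0" by simp
  \<comment> \<open>The surplus under the contrary assumption: q |T(w)| will be at most 2^m exp(-L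
    w).\<close>
  define L where "L = A - real m * (B + 2 * \<eta>)"
  define K where "K = \<bar>T v0\<bar> / \<bar>\<theta> m\<bar>"
  have K: "K > 0" using T0[of v0] assms(2) by (simp add: K_def)
  have lim: "((\<lambda>w. exp (- c * real w)) \<longlongrightarrow> 0) sequentially" if "c > 0" for c
  proof -
    have "((\<lambda>w. exp (- c) ^ w) \<longlongrightarrow> 0) sequentially"
      by (rule LIMSEQ_power_zero) (use that in simp)
    then show ?thesis by (simp add: exp_of_nat_mult[symmetric] mult.commute)
  qed
  have "eventually (\<lambda>w. exp (- L * real w) < \<bar>\<theta> m\<bar> / (2 * 2 ^ m)) sequentially"
    by (rule order_tendstoD(2)[OF lim]) (use gap assms(2) in \<open>auto simp: L_def\<close>)
  moreover have "eventually (\<lambda>w. exp (- (2 * \<eta>) * real w) < K) sequentially"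
    by (rule order_tendstoD(2)[OF lim]) (use \<open>\<eta> > 0\<close> K in auto)
  moreover have "eventually (\<lambda>w. exp (- \<eta> * real w) < 1 / 2) sequentially"
    by (rule order_tendstoD(2)[OF lim]) (use \<open>\<eta> > 0\<close> in auto)
  ultimately have "eventually (\<lambda>w. exp (- L * real w) < \<bar>\<theta> m\<bar> / (2 * 2 ^ m) \<and>
      exp (- (2 * \<eta>) * real w) < K \<and> exp (- \<eta> * real w) < 1 / 2) sequentially"
    by eventually_elim auto
  then obtain N where N: "\<And>w. w \<ge> N \<Longrightarrow> exp (- L * real w) < \<bar>\<theta> m\<bar> / (2 * 2 ^ m) \<and>
      exp (- (2 * \<eta>) * real w) < K \<and> exp (- \<eta> * real w) < 1 / 2"
    unfolding eventually_sequentially by blast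
  obtain w where w: "w \<ge> max N v0" "\<bar>T w\<bar> \<le> exp (- A * real w)"
     "\<And>v. v0 \<le> v \<Longrightarrow> v \<le> w \<Longrightarrow> (\<Sum>l\<le>m. \<bar>X v l\<bar>) \<le> exp (B * real w)"
    using good[of "max N v0"] by blast
  \<comment> \<open>Chosen so that the total approximation error exp(B w)/H is at most exp(-2 \<eta>
    w). Rounding up costs at most a factor 2, hence 2^m in the bound for q.\<close>
  define H where "H = nat \<lceil>exp ((B + 2 * \<eta>) * real w)\<rceil>"
  have H1: "real H \<ge> exp ((B + 2 * \<eta>) * real w)" unfolding H_def by (rule of_nat_ceiling)
  have "exp ((B + 2 * \<eta>) * real w) \<ge> 1" using \<open>B \<ge> 0\<close> \<open>\<eta> > 0\<close> by simp
  then have H2: "real H \<le> 2 * exp ((B + 2 * \<eta>) * real w)" and "H > 0"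
    unfolding H_def by linarith+
  obtain q p where q: "0 < q" "q \<le> int (H ^ m)"
    and p: "\<And>i. i < m \<Longrightarrow> \<bar>of_int q * (\<theta> i / \<theta> m) - of_int (p i)\<bar> < 1 / H"
    using Dirichlet_approx_simult[OF \<open>H > 0\<close>, of m "\<lambda>i. \<theta> i / \<theta> m"] by blast
  define P where "P v \<longleftrightarrow> v \<ge> v0 \<and> of_int q * \<bar>T v\<bar> < \<bar>\<theta> m\<bar> / 2" for v
  have "of_int q * \<bar>T w\<bar> < \<bar>\<theta> m\<bar> / 2"
  proof -
    have "of_int q * \<bar>T w\<bar> \<le> real (H ^ m) * exp (- A * real w)"
      using q w(2) by (intro mult_mono) (auto simp flip: of_int_le_iff[where 'a = real])
    also have "\<dots> \<le> (2 * exp ((B + 2 * \<eta>) * real w)) ^ m * exp (- A * real w)"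
      unfolding of_nat_power using H2 by (intro mult_right_mono power_mono) auto
    also have "\<dots> = 2 ^ m * exp (- L * real w)"
      by (simp add: power_mult_distrib exp_of_nat_mult[symmetric] mult_exp_exp L_def algebra_simps)
    also have "\<dots> < 2 ^ m * (\<bar>\<theta> m\<bar> / (2 * 2 ^ m))"
      using N[of w] w(1) by (intro mult_strict_left_mono) auto
    finally show ?thesis by simp
  qed
  then have "P w" using w(1) by (simp add: P_def)
  \<comment> \<open>The index w itself qualifies, so the least v exists and satisfies v \<le> w, the
    range in which the coefficients are bounded.\<close>
  define v where "v = (LEAST v. P v)"
  have "P v" "v \<le> w" unfolding v_def using \<open>P w\<close> by (auto intro: LeastI Least_le)
  have minimal: "\<not> P u" if "u < v" for u using that not_less_Least unfolding v_def by blast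
  \<comment> \<open>At \<open>v0\<close> the fixed quantity \<open>K\<close> is a lower bound, since
    q is at least 1. Otherwise the predecessor of v fails \<open>P\<close>, so its normalised value
    is at least 1/2, and one step loses at most a factor exp(-\<eta> w); the second factor
    exp(-\<eta> w) makes up for the 1/2.\<close>
  have lower: "exp (- (2 * \<eta>) * real w) < of_int q * \<bar>T v\<bar> / \<bar>\<theta> m\<bar>"
  proof (cases "v = v0")
    case True
    have "1 * K \<le> of_int q * K" using q(1) K by (intro mult_right_mono) auto
    then have "1 * K \<le> of_int q * \<bar>T v\<bar> / \<bar>\<theta> m\<bar>"
      unfolding True K_def by simp
    then show ?thesis using N[of w] w(1) by simp
  next
    case False
    then obtain u where u: "v = Suc u" "v0 \<le> u" using \<open>P v\<close> by (cases v) (auto simp: P_def)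
    have "1 / 2 \<le> of_int q * \<bar>T u\<bar> / \<bar>\<theta> m\<bar>"
      using minimal[of u] u assms(2) by (auto simp: P_def field_simps)
    have "exp (- (2 * \<eta>) * real w) = exp (- \<eta> * real w) * exp (- \<eta> * real w)"
      by (simp add: mult_exp_exp)
    also have "\<dots> < exp (- \<eta> * real w) * (1 / 2)"
      using N[of w] w(1) by (intro mult_strict_left_mono) auto
    also have "\<dots> \<le> exp (- \<eta> * real (Suc u)) * (of_int q * \<bar>T u\<bar> / \<bar>\<theta> m\<bar>)"
      using \<open>v \<le> w\<close> u \<open>\<eta> > 0\<close> \<open>1 / 2 \<le> of_int q * \<bar>T u\<bar> / \<bar>\<theta> m\<bar>\<close>
      by (intro mult_mono) (auto simp: mult_left_mono)
    also have "\<dots> = of_int q * (exp (- \<eta> * real (Suc u)) * \<bar>T u\<bar>) / \<bar>\<theta> m\<bar>" by simp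
    also have "\<dots> \<le> of_int q * \<bar>T v\<bar> / \<bar>\<theta> m\<bar>"
      using ratio[OF u(2)] q(1) unfolding u(1) by (intro divide_right_mono mult_left_mono) auto
    finally show ?thesis .
  qed
  \<comment> \<open>Index m is approximated exactly, by q itself. Dirichlet's theorem thus deals
    with only m ratios, which gives the exponent m rather than m + 1.\<close>
  define p' where "p' i = (if i = m then q else p i)" for i
  have p': "\<bar>of_int q * (\<theta> i / \<theta> m) - of_int (p' i)\<bar> \<le> 1 / H" if "i \<le> m" for i
    using p[of i] that assms(2) by (cases "i = m") (auto simp: p'_def)
  define Z where "Z = (\<Sum>l\<le>m. X v l * p' l)"
  have "\<bar>of_int q * T v / \<theta> m - of_int Z\<bar> = \<bar>\<Sum>l\<le>m. of_int (X v l) * (of_int q * (\<theta> l / \<theta> m) - of_int (p' l))\<bar>"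
    unfolding T Z_def
    by (simp add: sum_subtractf right_diff_distrib sum_distrib_left sum_divide_distrib mult_ac)
  also have "\<dots> \<le> (\<Sum>l\<le>m. \<bar>of_int (X v l)\<bar> * (1 / H))"
    by (rule order_trans[OF sum_abs]) (auto simp only: abs_mult intro!: sum_mono mult_left_mono p' abs_ge_zero)
  also have "\<dots> = of_int (\<Sum>l\<le>m. \<bar>X v l\<bar>) / H" by (simp add: sum_divide_distrib)
  also have "\<dots> \<le> exp (B * real w) / exp ((B + 2 * \<eta>) * real w)"
    using w(3)[of v] \<open>P v\<close> \<open>v \<le> w\<close> H1 by (intro frac_le) (auto simp: P_def)
  also have "\<dots> = exp (- (2 * \<eta>) * real w)" by (simp add: exp_diff[symmetric] algebra_simps)
  finally have err: "\<bar>of_int q * T v / \<theta> m - of_int Z\<bar> \<le> exp (- (2 * \<eta>) * real w)" .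
  have abs: "\<bar>of_int q * T v / \<theta> m\<bar> = of_int q * \<bar>T v\<bar> / \<bar>\<theta> m\<bar>"
    using q(1) by (simp add: abs_mult abs_divide)
  have "\<bar>of_int q * T v / \<theta> m\<bar> < 1 / 2"
    unfolding abs using \<open>P v\<close> assms(2) by (simp add: P_def field_simps)
  moreover have "exp (- (2 * \<eta>) * real w) < 1 / 2"
  proof -
    have "exp (- (2 * \<eta>) * real w) \<le> exp (- \<eta> * real w)" using \<open>\<eta> > 0\<close> by simp
    moreover have "exp (- \<eta> * real w) < 1 / 2" using N[of w] w(1) by simp
    ultimately show ?thesis by linarith
  qed
  ultimately have "\<bar>real_of_int Z\<bar> < 1" using err by linarith
  then have "Z = 0" by linarith
  then have "\<bar>of_int q * T v / \<theta> m\<bar> \<le> exp (- (2 * \<eta>) * real w)" using err by simp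
  then show False using lower unfolding abs by linarith
qed

text \<open>As T(v0) is nonzero, some \<theta> is nonzero; a transposition moves it to the last
  place, where \<open>criterion_last_nonzero\<close> uses it as the normalising denominator.\<close>

lemma linear_independence_criterion:
  fixes \<theta> :: "nat \<Rightarrow> real" and X :: "nat \<Rightarrow> nat \<Rightarrow> int" and T :: "nat \<Rightarrow> real" and \<eta> A B :: real
  assumes T: "\<And>v. T v = (\<Sum>l<\<delta>. of_int (X v l) * \<theta> l)"
    and T0: "\<And>v. v \<ge> v0 \<Longrightarrow> T v \<noteq> 0"
    and ratio: "\<And>v. v \<ge> v0 \<Longrightarrow> exp (- \<eta> * Suc v) * \<bar>T v\<bar> \<le> \<bar>T (Suc v)\<bar>"
    and "\<eta> > 0" "B \<ge> 0"
    and good: "\<And>N. \<exists>w\<ge>N. \<bar>T w\<bar> \<le> exp (- A * real w) \<and>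
        (\<forall>v. v0 \<le> v \<and> v \<le> w \<longrightarrow> (\<Sum>l<\<delta>. \<bar>X v l\<bar>) \<le> exp (B * real w))"
  shows "A \<le> (real \<delta> - 1) * (B + 2 * \<eta>)"
proof -
  have "\<exists>l0<\<delta>. \<theta> l0 \<noteq> 0"
  proof (rule ccontr)
    assume "\<not> ?thesis"
    then have "T v0 = 0" by (simp add: T)
    then show False using T0[of v0] by simp
  qed
  then obtain l0 where l0: "l0 < \<delta>" "\<theta> l0 \<noteq> 0" by blast
  then obtain m where m: "\<delta> = Suc m" by (cases \<delta>) auto
  define \<sigma> where "\<sigma> l = (if l = l0 then m else if l = m then l0 else l)" for l
  have \<sigma>: "(\<Sum>l<\<delta>. f l) = (\<Sum>l\<le>m. f (\<sigma> l))" for f :: "nat \<Rightarrow> 'a::comm_monoid_add"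
    by (rule sum.reindex_bij_witness[of _ \<sigma> \<sigma>]) (use l0 m in \<open>auto simp: \<sigma>_def split: if_splits\<close>)
  have "A \<le> real m * (B + 2 * \<eta>)"
  proof (rule criterion_last_nonzero)
    show "T v = (\<Sum>l\<le>m. of_int (X v (\<sigma> l)) * \<theta> (\<sigma> l))" for v unfolding T \<sigma> ..
    show "\<theta> (\<sigma> m) \<noteq> 0" using l0 by (simp add: \<sigma>_def)
    show "\<exists>w\<ge>N. \<bar>T w\<bar> \<le> exp (- A * real w) \<and> (\<forall>v. v0 \<le> v \<and> v \<le> w \<longrightarrow>
        (\<Sum>l\<le>m. \<bar>X v (\<sigma> l)\<bar>) \<le> exp (B * real w))" for N
      using good[of N] unfolding \<sigma> .
  qed (use T0 ratio \<open>\<eta> > 0\<close> \<open>B \<ge> 0\<close> in auto)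
  then show ?thesis by (simp add: m)
qed

section \<open>The least common multiple of the first integers\<close>

definition lcm_upto :: "nat \<Rightarrow> nat" where "lcm_upto n = Lcm {1..n}"

lemma lcm_upto_Suc: "lcm_upto (Suc n) = lcm (Suc n) (lcm_upto n)"
  unfolding lcm_upto_def by (simp add: atLeastAtMostSuc_conv)

lemma lcm_upto_pos: "lcm_upto n > 0"
  by (induction n) (simp_all add: lcm_upto_def[of 0] lcm_upto_Suc lcm_pos_nat)

lemma dvd_lcm_upto: "k \<ge> 1 \<Longrightarrow> k \<le> n \<Longrightarrow> k dvd lcm_upto n"
  unfolding lcm_upto_def by (rule dvd_Lcm) simp

lemma lcm_upto_mono: "m \<le> n \<Longrightarrow> lcm_upto m \<le> lcm_upto n"
  by (rule dvd_imp_le[OF _ lcm_upto_pos]) (auto simp: lcm_upto_def intro: Lcm_subset)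

lemma prime_power_multiplicity_lcm_upto:
  assumes "prime p" "n \<ge> 1"
  shows "p ^ multiplicity p (lcm_upto n) \<le> n"
  using assms(2)
proof (induction n rule: nat_induct_at_least)
  case base
  then show ?case by (simp add: lcm_upto_def)
next
  case (Suc n)
  have "p ^ multiplicity p (Suc n) \<le> Suc n" by (intro dvd_imp_le multiplicity_dvd) auto
  moreover have "multiplicity p (lcm_upto (Suc n)) = max (multiplicity p (Suc n)) (multiplicity p (lcm_upto n))"
    unfolding lcm_upto_Suc using lcm_upto_pos[of n] by (intro multiplicity_lcm) (use assms in auto)
  ultimately show ?case using Suc.IH by (auto simp: max_def)
qed

lemma multiplicity_eq_card:
  fixes p k :: nat
  assumes "prime p" "k \<ge> 1" "k \<le> N"
  shows "multiplicity p k = (\<Sum>e=1..N. if p ^ e dvd k then 1 else 0)"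
proof -
  have "e \<le> N" if "p ^ e dvd k" for e
  proof -
    have "e < p ^ e" using prime_gt_1_nat[OF assms(1)] by (intro power_gt_expt) simp
    also have "p ^ e \<le> k" using that assms by (intro dvd_imp_le) auto
    finally show ?thesis using assms by simp
  qed
  moreover have "p ^ e dvd k \<longleftrightarrow> e \<le> multiplicity p k" for e
    using assms by (intro power_dvd_iff_le_multiplicity) auto
  ultimately have "e \<in> {1..N} \<inter> {e. p ^ e dvd k} \<longleftrightarrow> e \<in> {1..multiplicity p k}" for e
    unfolding Int_iff mem_Collect_eq atLeastAtMost_iff by blast
  then have "{1..N} \<inter> {e. p ^ e dvd k} = {1..multiplicity p k}" by blast
  then show ?thesis by (simp add: sum.If_cases del: One_nat_def)
qed

text \<open>Divisibility form of Chebyshev's identity log N! = sum of psi(N/m). The valuation of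
  lcm(1,...,x) at p counts at most the e with p^e \<le> x, so the product is controlled by the pairs
  (m, e) with m p^e \<le> N. Counted by e, these are the multiples of p^e up to N, which is
  Legendre's formula for N!.\<close>

lemma prod_lcm_upto_dvd_fact: "(\<Prod>m=1..N. lcm_upto (N div m)) dvd fact N"
proof (rule multiplicity_le_imp_dvd)
  show "(\<Prod>m=1..N. lcm_upto (N div m)) \<noteq> 0" using lcm_upto_pos by (simp add: less_imp_neq[symmetric])
  fix p :: nat assume p: "prime p"
  then have pe: "prime_elem p" by simp
  have "multiplicity p (\<Prod>m=1..N. lcm_upto (N div m)) = (\<Sum>m=1..N. multiplicity p (lcm_upto (N div m)))"
    using pe lcm_upto_pos by (intro prime_elem_multiplicity_prod_distrib) (auto simp: less_imp_neq[symmetric])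
  also have "\<dots> \<le> (\<Sum>m=1..N. \<Sum>e=1..N. if m * p ^ e \<le> N then 1 else 0)"
  proof (intro sum_mono)
    fix m assume m: "m \<in> {1..N}"
    let ?M = "multiplicity p (lcm_upto (N div m))"
    have "N div m \<ge> 1" using m by (simp add: div_greater_zero_iff Suc_le_eq)
    then have *: "p ^ ?M \<le> N div m" by (rule prime_power_multiplicity_lcm_upto[OF p])
    have "m * p ^ e \<le> N" if "e \<le> ?M" for e
    proof -
      have "p ^ e \<le> p ^ ?M" using that prime_gt_0_nat[OF p] by (intro power_increasing) auto
      then have "m * p ^ e \<le> m * (N div m)" using * by (intro mult_left_mono) auto
      also have "\<dots> \<le> N" by simp
      finally show ?thesis .
    qed
    moreover have "?M \<le> N"
    proof -
      have "?M < p ^ ?M" using prime_gt_1_nat[OF p] by (intro power_gt_expt) simp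
      also have "\<dots> \<le> N div m" by (rule *)
      also have "\<dots> \<le> N" by simp
      finally show ?thesis by simp
    qed
    ultimately have "{1..?M} \<subseteq> {e \<in> {1..N}. m * p ^ e \<le> N}" by auto
    then have "card {1..?M} \<le> card {e \<in> {1..N}. m * p ^ e \<le> N}" by (intro card_mono) auto
    then show "?M \<le> (\<Sum>e=1..N. if m * p ^ e \<le> N then 1 else 0)" by (simp add: sum.If_cases Int_def)
  qed
  also have "\<dots> = (\<Sum>e=1..N. \<Sum>m=1..N. if m * p ^ e \<le> N then 1 else 0)" by (rule sum.swap)
  also have "\<dots> = (\<Sum>e=1..N. \<Sum>k=1..N. if p ^ e dvd k then 1 else 0)"
  proof (rule sum.cong[OF refl])
    fix e
    have p0: "p ^ e > 0" using prime_gt_0_nat[OF p] by simp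
    have "card {m \<in> {1..N}. m * p ^ e \<le> N} = card {k \<in> {1..N}. p ^ e dvd k}"
    proof (rule bij_betw_same_card)
      show "bij_betw (\<lambda>m. m * p ^ e) {m \<in> {1..N}. m * p ^ e \<le> N} {k \<in> {1..N}. p ^ e dvd k}"
      proof (rule bij_betwI[where g = "\<lambda>k. k div p ^ e"])
        show "(\<lambda>k. k div p ^ e) \<in> {k \<in> {1..N}. p ^ e dvd k} \<rightarrow> {m \<in> {1..N}. m * p ^ e \<le> N}"
          using p0 by (auto simp: Suc_le_eq div_greater_zero_iff intro: dvd_imp_le order_trans[OF div_le_dividend])
        show "(\<lambda>m. m * p ^ e) \<in> {m \<in> {1..N}. m * p ^ e \<le> N} \<rightarrow> {k \<in> {1..N}. p ^ e dvd k}"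
          using p0 by (auto simp: Suc_le_eq)
      qed (use p0 in auto)
    qed
    then show "(\<Sum>m=1..N. if m * p ^ e \<le> N then 1 else 0) = (\<Sum>k=1..N. if p ^ e dvd k then 1 else (0::nat))"
      by (simp add: sum.If_cases Int_def)
  qed
  also have "\<dots> = (\<Sum>k=1..N. \<Sum>e=1..N. if p ^ e dvd k then 1 else 0)" by (rule sum.swap)
  also have "\<dots> = (\<Sum>k=1..N. multiplicity p k)"
    by (intro sum.cong refl multiplicity_eq_card[symmetric] p) auto
  also have "\<dots> = multiplicity p (\<Prod>k=1..N. k)"
    using pe by (intro prime_elem_multiplicity_prod_distrib[symmetric]) auto
  also have "(\<Prod>k=1..N. k) = fact N" by (simp add: fact_prod)
  finally show "multiplicity p (\<Prod>m=1..N. lcm_upto (N div m)) \<le> multiplicity p (fact N)" .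
qed

lemma sum_ln_lcm_upto_le:
  assumes "N \<ge> 1"
  shows "(\<Sum>m=1..N. ln (real (lcm_upto (N div m)))) \<le> real N * ln (real N)"
proof -
  have "(\<Sum>m=1..N. ln (real (lcm_upto (N div m)))) = ln (\<Prod>m=1..N. real (lcm_upto (N div m)))"
    using lcm_upto_pos by (intro ln_prod[symmetric]) auto
  also have "(\<Prod>m=1..N. real (lcm_upto (N div m))) = real (\<Prod>m=1..N. lcm_upto (N div m))" by simp
  also have "ln \<dots> \<le> ln (real (N ^ N))"
  proof -
    have "(\<Prod>m=1..N. lcm_upto (N div m)) \<le> fact N"
      by (rule dvd_imp_le[OF prod_lcm_upto_dvd_fact]) simp
    also have "\<dots> \<le> N ^ N" using fact_le_power[of N, where 'a = nat] by simp
    finally have "(\<Prod>m=1..N. lcm_upto (N div m)) \<le> N ^ N" .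
    moreover have "(\<Prod>m=1..N. lcm_upto (N div m)) > 0" using lcm_upto_pos by (intro prod_pos) auto
    ultimately show ?thesis using of_nat_mono by (subst ln_le_cancel_iff) (force simp del: of_nat_prod of_nat_power)+
  qed
  also have "\<dots> = real N * ln (real N)" using assms by (simp add: ln_realpow)
  finally show ?thesis .
qed

text \<open>If the bound failed for all large v, monotonicity would give ln lcm(1,...,n) \<ge> (1 +
  \<epsilon>)(n - g) for all large n. Inserting n = N div m into \<open>sum_ln_lcm_upto_le\<close>
  and comparing with the harmonic sum yields (1 + \<epsilon>)(ln N - c) \<le> ln N, which is false
  for large N.\<close>

lemma lcm_upto_infinitely_often_small:
  fixes g N0 :: nat and \<epsilon> :: real
  assumes "g \<ge> 1" "\<epsilon> > 0"
  shows "\<exists>v\<ge>N0. ln (real (lcm_upto (g * v))) \<le> (1 + \<epsilon>) * real (g * v)"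
proof (rule ccontr)
  assume "\<not> ?thesis"
  then have big: "ln (real (lcm_upto (g * v))) > (1 + \<epsilon>) * real (g * v)" if "v \<ge> N0" for v
    using that by (metis not_le)
  define M where "M = g * Suc N0"
  have M: "M \<ge> 1" using assms by (simp add: M_def)
  have low: "ln (real (lcm_upto n)) \<ge> (1 + \<epsilon>) * (real n - real g)" if "n \<ge> M" for n
  proof -
    have "n div g \<ge> N0" using that assms by (simp add: M_def less_eq_div_iff_mult_less_eq algebra_simps)
    then have "(1 + \<epsilon>) * real (g * (n div g)) < ln (real (lcm_upto (g * (n div g))))" by (rule big)
    also have "\<dots> \<le> ln (real (lcm_upto n))"
      using lcm_upto_mono[of "g * (n div g)" n] lcm_upto_pos by (subst ln_le_cancel_iff) auto
    finally have 1: "(1 + \<epsilon>) * real (g * (n div g)) < ln (real (lcm_upto n))" .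
    have "real n - real g \<le> real (g * (n div g))"
    proof -
      have "n = g * (n div g) + n mod g" by simp
      moreover have "n mod g < g" using assms by simp
      ultimately show ?thesis by linarith
    qed
    then have "(1 + \<epsilon>) * (real n - real g) \<le> (1 + \<epsilon>) * real (g * (n div g))"
      using assms by (intro mult_left_mono) auto
    then show ?thesis using 1 by linarith
  qed
  \<comment> \<open>The three terms come from the cut m \<le> N div M, from the rounding in N div m,
    and from passing down to a multiple of g.\<close>
  define c where "c = ln (real M) + 1 + real g"
  have upper: "(1 + \<epsilon>) * (ln (real N) - c) \<le> ln (real N)" if "N \<ge> M" for N
  proof -
    define k where "k = N div M"
    have k: "k \<le> N" "k \<ge> 1" using that M by (auto simp: k_def Suc_le_eq div_greater_zero_iff)
    have N: "N \<ge> 1" using that M by simp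
    have "(\<Sum>m=1..k. (1 + \<epsilon>) * (real N * (1 / real m) - (1 + real g))) \<le> (\<Sum>m=1..k. ln (real (lcm_upto (N div m))))"
    proof (intro sum_mono)
      fix m assume m: "m \<in> {1..k}"
      then have "m * M \<le> N" unfolding k_def using M by (simp add: less_eq_div_iff_mult_less_eq)
      then have "N div m \<ge> M" using m by (simp add: less_eq_div_iff_mult_less_eq mult.commute)
      then have 1: "ln (real (lcm_upto (N div m))) \<ge> (1 + \<epsilon>) * (real (N div m) - real g)" by (rule low)
      have "real N * (1 / real m) - 1 \<le> real (N div m)"
      proof -
        have "N < m + (N div m) * m" using m by (intro dividend_less_div_times) auto
        then have "real N < real (m + (N div m) * m)" by (simp only: of_nat_less_iff)
        then show ?thesis using m by (simp add: field_simps)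
      qed
      then have "(1 + \<epsilon>) * (real N * (1 / real m) - (1 + real g)) \<le> (1 + \<epsilon>) * (real (N div m) - real g)"
        using assms by (intro mult_left_mono) auto
      then show "(1 + \<epsilon>) * (real N * (1 / real m) - (1 + real g)) \<le> ln (real (lcm_upto (N div m)))"
        using 1 by linarith
    qed
    also have "\<dots> \<le> (\<Sum>m=1..N. ln (real (lcm_upto (N div m))))"
    proof (rule sum_mono2)
      show "0 \<le> ln (real (lcm_upto (N div b)))" for b
        using lcm_upto_pos[of "N div b"] by (simp add: Suc_le_eq)
    qed (use k in auto)
    also have "\<dots> \<le> real N * ln (real N)" by (rule sum_ln_lcm_upto_le[OF N])
    finally have 2: "(\<Sum>m=1..k. (1 + \<epsilon>) * (real N * (1 / real m) - (1 + real g))) \<le> real N * ln (real N)" .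
    have "(\<Sum>m=1..k. (1 + \<epsilon>) * (real N * (1 / real m) - (1 + real g))) = (1 + \<epsilon>) * (real N * harm k - real k * (1 + real g))"
      by (simp add: harm_def sum_distrib_left[symmetric] sum_subtractf divide_inverse)
    moreover have "real N * harm k - real k * (1 + real g) \<ge> real N * (ln (real N) - ln (real M)) - real N * (1 + real g)"
    proof -
      have "real N < (real k + 1) * real M"
      proof -
        have "N < Suc k * M" unfolding k_def using M by (simp add: dividend_less_div_times)
        then have "real N < real (Suc k * M)" by (simp only: of_nat_less_iff)
        then show ?thesis by (simp add: algebra_simps)
      qed
      then have "real N / real M \<le> real k + 1" using M by (simp add: field_simps)
      then have "ln (real N / real M) \<le> ln (real k + 1)" using M N by (subst ln_le_cancel_iff) auto
      also have "\<dots> \<le> harm k" by (rule ln_le_harm)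
      finally have "ln (real N) - ln (real M) \<le> harm k" using M N by (simp add: ln_div)
      then have "real N * (ln (real N) - ln (real M)) \<le> real N * harm k" by (rule mult_left_mono) simp
      moreover have "real k * (1 + real g) \<le> real N * (1 + real g)" using k by (intro mult_right_mono) auto
      ultimately show ?thesis by linarith
    qed
    moreover from this have "(1 + \<epsilon>) * (real N * (ln (real N) - ln (real M)) - real N * (1 + real g)) \<le> (1 + \<epsilon>) * (real N * harm k - real k * (1 + real g))"
      using assms by (intro mult_left_mono) auto
    ultimately have "(1 + \<epsilon>) * (real N * (ln (real N) - ln (real M)) - real N * (1 + real g)) \<le> real N * ln (real N)"
      using 2 by linarith
    then have "real N * ((1 + \<epsilon>) * (ln (real N) - c)) \<le> real N * ln (real N)"
      by (simp add: c_def algebra_simps)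
    then show ?thesis using N by (simp del: of_nat_Suc)
  qed
  have "eventually (\<lambda>N. ln (real N) > (1 + \<epsilon>) * c / \<epsilon>) sequentially"
    by (rule filterlim_at_top_dense[THEN iffD1, rule_format])
       (rule filterlim_compose[OF ln_at_top filterlim_real_sequentially])
  then have "eventually (\<lambda>N. ln (real N) > (1 + \<epsilon>) * c / \<epsilon> \<and> N \<ge> M) sequentially"
    by (intro eventually_conj eventually_ge_at_top)
  then obtain N where "ln (real N) > (1 + \<epsilon>) * c / \<epsilon>" "N \<ge> M"
    using eventually_happens'[OF sequentially_bot] by blast
  then have "(1 + \<epsilon>) * c < \<epsilon> * ln (real N)" by (simp only: pos_divide_less_eq[OF assms(2)] mult.commute[of \<epsilon>])
  moreover have "(1 + \<epsilon>) * (ln (real N) - c) = ln (real N) + \<epsilon> * ln (real N) - (1 + \<epsilon>) * c"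
    by (simp add: algebra_simps)
  ultimately show False using upper[OF \<open>N \<ge> M\<close>] by linarith
qed

section \<open>Linear forms from symmetric rational functions\<close>

text \<open>For order 1 the series may diverge. Only differences of its partial sums over windows of
  bounded length will remain, and these tend to 0.\<close>

lemma sum_tail_tendsto_0:
  fixes b :: "nat \<Rightarrow> real"
  assumes "\<And>k. k \<ge> 1 \<Longrightarrow> \<bar>b k\<bar> \<le> M" "j \<ge> 1"
  shows "(\<lambda>N. \<Sum>k\<in>{N<..N+m}. b k / real k ^ j) \<longlonglongrightarrow> 0"
proof -
  have lim: "(\<lambda>N. real m * (M / real (Suc N))) \<longlonglongrightarrow> 0" by real_asymp
  show ?thesis
  proof (rule Lim_null_comparison[OF always_eventually lim], intro allI)
    fix N
    have "norm (\<Sum>k\<in>{N<..N+m}. b k / real k ^ j) \<le> real (card {N<..N+m}) * (M / real (Suc N))"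
    proof (intro sum_norm_bound)
      fix k assume k: "k \<in> {N<..N+m}"
      have "real (Suc N) \<le> real k" using k by simp
      also have "real k = real k ^ 1" by simp
      also have "\<dots> \<le> real k ^ j" using k assms(2) by (intro power_increasing) auto
      finally show "norm (b k / real k ^ j) \<le> M / real (Suc N)"
        using assms(1)[of k] k by (auto simp: abs_divide intro!: frac_le)
    qed
    then show "norm (\<Sum>k\<in>{N<..N+m}. b k / real k ^ j) \<le> real m * (M / real (Suc N))" by simp
  qed
qed

text \<open>Multiplying an expansion by t and letting t grow isolates the sum of its coefficients of
  order 1.\<close>

lemma tendsto_power_quotient:
  fixes c :: real
  assumes "j \<ge> 1"
  shows "((\<lambda>t. t / (t + c) ^ j) \<longlongrightarrow> (if j = 1 then 1 else 0)) at_top"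
proof -
  have 1: "((\<lambda>t. t / (t + c)) \<longlongrightarrow> 1) at_top" by real_asymp
  have 2: "((\<lambda>t. 1 / (t + c)) \<longlongrightarrow> 0) at_top" by real_asymp
  have "((\<lambda>t. (t / (t + c)) * (1 / (t + c)) ^ (j - 1)) \<longlongrightarrow> 1 * 0 ^ (j - 1)) at_top"
    by (intro tendsto_mult 1 tendsto_power 2)
  moreover have "(t / (t + c)) * (1 / (t + c)) ^ (j - 1) = t / (t + c) ^ j" for t
    using assms by (cases j) (simp_all add: power_one_over divide_inverse power_inverse)
  ultimately show ?thesis using assms by (auto simp: power_0_left)
qed

text \<open>Periodicity turns the sum of b_k/(k + di)^j into a partial sum of b_k/k^j without its
  first di terms, so order j contributes L(j) with coefficient \<open>c j\<close> together with
  finite sums. The latter have denominators k^j with k \<le> dn, hence k dividing \<open>D\<close>: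
  \<open>D^j\<close> clears them and \<open>D^(a - j)\<close> clears the coefficients. The factor 2
  comes from adding \<open>R\<close> to its mirror image.\<close>

lemma linear_form:
  fixes b :: "nat \<Rightarrow> real" and \<theta> :: "nat \<Rightarrow> real" and U W :: "nat \<Rightarrow> nat \<Rightarrow> int" and L :: "nat \<Rightarrow> real"
  assumes R: "pfrac d n D a B R" and d: "d \<ge> 1"
    and parity: "\<And>t. (\<And>i. i \<le> n \<Longrightarrow> t + real (d * i) \<noteq> 0) \<Longrightarrow> R (- real (d * n) - t) = (-1) ^ a * R t"
    and decay: "((\<lambda>t. t * R t) \<longlongrightarrow> 0) at_top"
    and D: "\<And>k. k \<in> {1..d * n} \<Longrightarrow> k dvd D"
    and per: "\<And>k. k \<ge> 1 \<Longrightarrow> b (k + d) = b k" and bnd: "\<And>k. k \<ge> 1 \<Longrightarrow> \<bar>b k\<bar> \<le> M"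
    and L: "\<And>j. j \<in> {2..a} \<Longrightarrow> even (a + j) \<Longrightarrow> (\<lambda>N. \<Sum>k=1..N. b k / real k ^ j) \<longlonglongrightarrow> L j"
    and U: "\<And>k. k \<ge> 1 \<Longrightarrow> b k = (\<Sum>l<\<delta>. of_int (U k l) * \<theta> l)"
    and W: "\<And>j. j \<in> {2..a} \<Longrightarrow> even (a + j) \<Longrightarrow> L j = (\<Sum>l<\<delta>. of_int (W j l) * \<theta> l)"
    and U_le: "\<And>k. k \<ge> 1 \<Longrightarrow> (\<Sum>l<\<delta>. \<bar>U k l\<bar>) \<le> K"
    and W_le: "\<And>j. j \<in> {2..a} \<Longrightarrow> even (a + j) \<Longrightarrow> (\<Sum>l<\<delta>. \<bar>W j l\<bar>) \<le> K" and K: "K \<ge> 0"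
  obtains X :: "nat \<Rightarrow> int" and V where "(\<lambda>N. \<Sum>k=1..N. b k * R (real k)) \<longlonglongrightarrow> V"
    "2 * real D ^ a * V = (\<Sum>l<\<delta>. of_int (X l) * \<theta> l)"
    "(\<Sum>l<\<delta>. \<bar>X l\<bar>) \<le> 2 * real D ^ a * B * of_int K * (real (d * n) + 1)"
proof -
  obtain A where A: "\<forall>i\<le>n. \<forall>j\<in>{1..a}. real D ^ (a - j) * A i j \<in> \<int>"
     "(\<Sum>i\<le>n. \<Sum>j=1..a. \<bar>A i j\<bar>) \<le> B"
     "\<And>t. (\<forall>i\<le>n. t + real (d * i) \<noteq> 0) \<longrightarrow>
        R t = (\<Sum>i\<le>n. \<Sum>j=1..a. A i j / (t + real (d * i)) ^ j)"
    using R unfolding pfrac_def by blast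
  \<comment> \<open>Symmetrising makes the coefficients of the wrong parity cancel without
     appealing to uniqueness of partial fractions.\<close>
  define A' where "A' i j = A i j + (-1) ^ (a + j) * A (n - i) j" for i j
  define H where "H j N = (\<Sum>k=1..N. b k / real k ^ j)" for j N :: nat
  define J where "J = {j \<in> {2..a}. even (a + j)}"
  have reflect: "(\<Sum>i\<le>n. f (n - i)) = (\<Sum>i\<le>n. f i)" for f :: "nat \<Rightarrow> real"
    by (rule sum.reindex_bij_witness[of _ "\<lambda>i. n - i" "\<lambda>i. n - i"]) auto
  have A'_int: "real D ^ (a - j) * A' i j \<in> \<int>" if "i \<le> n" "j \<in> {1..a}" for i j
  proof -
    have "real D ^ (a - j) * A' i j = real D ^ (a - j) * A i j + (-1) ^ (a + j) * (real D ^ (a - j) * A (n - i) j)"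
      by (simp add: A'_def algebra_simps)
    also have "\<dots> \<in> \<int>"
    proof (rule Ints_add)
      show "real D ^ (a - j) * A i j \<in> \<int>" using A(1) that by blast
      have "real D ^ (a - j) * A (n - i) j \<in> \<int>" using A(1) that by (meson diff_le_self)
      then show "(-1) ^ (a + j) * (real D ^ (a - j) * A (n - i) j) \<in> \<int>"
        by (rule Ints_mult[rotated]) (intro Ints_power, simp)
    qed
    finally show ?thesis .
  qed
  have A'_le: "(\<Sum>i\<le>n. \<Sum>j=1..a. \<bar>A' i j\<bar>) \<le> 2 * B"
  proof -
    have "(\<Sum>i\<le>n. \<Sum>j=1..a. \<bar>A' i j\<bar>) \<le> (\<Sum>i\<le>n. \<Sum>j=1..a. \<bar>A i j\<bar> + \<bar>A (n - i) j\<bar>)"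
    proof (intro sum_mono)
      fix i j
      have "\<bar>A' i j\<bar> \<le> \<bar>A i j\<bar> + \<bar>(-1) ^ (a + j) * A (n - i) j\<bar>" unfolding A'_def by (rule abs_triangle_ineq)
      then show "\<bar>A' i j\<bar> \<le> \<bar>A i j\<bar> + \<bar>A (n - i) j\<bar>" by (simp add: abs_mult power_abs)
    qed
    also have "\<dots> = 2 * (\<Sum>i\<le>n. \<Sum>j=1..a. \<bar>A i j\<bar>)"
      using reflect[of "\<lambda>i. \<Sum>j=1..a. \<bar>A i j\<bar>"] by (simp add: sum.distrib)
    finally show ?thesis using A(2) by simp
  qed
  have R2: "2 * R t = (\<Sum>i\<le>n. \<Sum>j=1..a. A' i j / (t + real (d * i)) ^ j)"
    if t: "\<And>i. i \<le> n \<Longrightarrow> t + real (d * i) \<noteq> 0" for t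
  proof -
    have neg: "- real (d * n) - t + real (d * i) = - (t + real (d * (n - i)))" if "i \<le> n" for i
      using that by (simp add: of_nat_diff algebra_simps)
    have "R (- real (d * n) - t) = (\<Sum>i\<le>n. \<Sum>j=1..a. A i j / (- real (d * n) - t + real (d * i)) ^ j)"
    proof (rule A(3)[rule_format])
      fix i assume "i \<le> n"
      show "- real (d * n) - t + real (d * i) \<noteq> 0"
        unfolding neg[OF \<open>i \<le> n\<close>] using t[of "n - i"] by simp
    qed
    also have "\<dots> = (\<Sum>i\<le>n. \<Sum>j=1..a. (-1) ^ j * A i j / (t + real (d * (n - i))) ^ j)"
    proof (intro sum.cong refl)
      fix i j assume "i \<in> {..n}"
      have "A i j / (- y) ^ j = (-1) ^ j * A i j / y ^ j" for y
        by (cases "even j") simp_all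
      then show "A i j / (- real (d * n) - t + real (d * i)) ^ j = (-1) ^ j * A i j / (t + real (d * (n - i))) ^ j"
        using neg[of i] \<open>i \<in> {..n}\<close> by (simp only: atMost_iff)
    qed
    also have "\<dots> = (\<Sum>i\<le>n. \<Sum>j=1..a. (-1) ^ j * A (n - i) j / (t + real (d * i)) ^ j)"
      using reflect[of "\<lambda>i. \<Sum>j=1..a. (-1) ^ j * A (n - i) j / (t + real (d * i)) ^ j"] by simp
    finally have "R t = (-1) ^ a * (\<Sum>i\<le>n. \<Sum>j=1..a. (-1) ^ j * A (n - i) j / (t + real (d * i)) ^ j)"
      using parity[OF t] by (simp add: left_minus_one_mult_self)
    moreover have "R t = (\<Sum>i\<le>n. \<Sum>j=1..a. A i j / (t + real (d * i)) ^ j)" using A(3) t by blast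
    ultimately have "2 * R t = (\<Sum>i\<le>n. \<Sum>j=1..a. A i j / (t + real (d * i)) ^ j) +
        (-1) ^ a * (\<Sum>i\<le>n. \<Sum>j=1..a. (-1) ^ j * A (n - i) j / (t + real (d * i)) ^ j)"
      by linarith
    then show ?thesis
      by (simp add: A'_def sum_distrib_left sum.distrib[symmetric] add_divide_distrib power_add mult.assoc)
  qed
  define c where "c j = (\<Sum>i\<le>n. A' i j)" for j
  have c_odd: "c j = 0" if "odd (a + j)" for j
    using that reflect[of "\<lambda>i. A i j"] by (simp add: c_def A'_def sum_subtractf)
  \<comment> \<open>\<open>c 1\<close> is the sum of the residues of \<open>2 * R\<close>, which
    \<open>decay\<close> forces to vanish; so order 1, where convergence may fail, leaves no L-value
    behind.\<close>
  have c_1: "c 1 = 0" if "a \<ge> 1"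
  proof -
    have "((\<lambda>t. \<Sum>i\<le>n. \<Sum>j=1..a. A' i j * (t / (t + real (d * i)) ^ j)) \<longlongrightarrow>
       (\<Sum>i\<le>n. \<Sum>j=1..a. A' i j * (if j = 1 then 1 else 0))) at_top"
      by (intro tendsto_sum tendsto_mult tendsto_const tendsto_power_quotient) auto
    also have "(\<Sum>i\<le>n. \<Sum>j=1..a. A' i j * (if j = 1 then 1 else 0)) = c 1"
      using that by (simp add: c_def if_distrib cong: if_cong)
    finally have "((\<lambda>t. \<Sum>i\<le>n. \<Sum>j=1..a. A' i j * (t / (t + real (d * i)) ^ j)) \<longlongrightarrow> c 1) at_top" .
    moreover have "eventually (\<lambda>t. (\<Sum>i\<le>n. \<Sum>j=1..a. A' i j * (t / (t + real (d * i)) ^ j)) = 2 * (t * R t)) at_top"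
      using eventually_gt_at_top[of 0]
    proof eventually_elim
      case (elim t)
      have "2 * R t = (\<Sum>i\<le>n. \<Sum>j=1..a. A' i j / (t + real (d * i)) ^ j)"
        by (rule R2) (use elim in \<open>auto simp: add_pos_nonneg less_imp_neq[symmetric]\<close>)
      then have "t * (2 * R t) = (\<Sum>i\<le>n. \<Sum>j=1..a. A' i j * (t / (t + real (d * i)) ^ j))"
        by (simp add: sum_distrib_left mult_ac)
      then show ?case by (simp add: mult_ac)
    qed
    ultimately have "((\<lambda>t. 2 * (t * R t)) \<longlongrightarrow> c 1) at_top" by (rule Lim_transform_eventually)
    moreover have "((\<lambda>t. 2 * (t * R t)) \<longlongrightarrow> 2 * 0) at_top" by (intro tendsto_mult tendsto_const decay)
    ultimately show ?thesis using tendsto_unique[OF trivial_limit_at_top_linorder] by force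
  qed
  have per': "b (k + d * i) = b k" if "k \<ge> 1" for k i
  proof (induction i)
    case (Suc i)
    have "b (k + d * Suc i) = b ((k + d * i) + d)" by (simp add: algebra_simps)
    then show ?case using per[of "k + d * i"] Suc that by simp
  qed simp
  have shift: "(\<Sum>k=1..N. b k / (real k + real (d * i)) ^ j) = H j (N + d * i) - H j (d * i)" for N i j
  proof -
    have "(\<Sum>k=1..N. b k / (real k + real (d * i)) ^ j) = (\<Sum>k=1..N. b (k + d * i) / real (k + d * i) ^ j)"
      by (intro sum.cong) (auto simp: per')
    also have "\<dots> = (\<Sum>k\<in>{d*i<..N + d*i}. b k / real k ^ j)"
      by (rule sum.reindex_bij_witness[of _ "\<lambda>k. k - d * i" "\<lambda>k. k + d * i"]) auto
    also have "\<dots> = H j (N + d * i) - H j (d * i)"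
    proof -
      have "{1..N + d*i} = {1..d*i} \<union> {d*i<..N + d*i}" by auto
      then have "H j (N + d * i) = H j (d * i) + (\<Sum>k\<in>{d*i<..N + d*i}. b k / real k ^ j)"
        unfolding H_def by (subst sum.union_disjoint[symmetric]) auto
      then show ?thesis by simp
    qed
    finally show ?thesis .
  qed
  \<comment> \<open>This is twice the sum of the series; the value finally returned is
    \<open>V / 2\<close>.\<close>
  define V where "V = (\<Sum>j\<in>J. c j * L j) - (\<Sum>i\<le>n. \<Sum>j=1..a. A' i j * H j (d * i))"
  have partial: "2 * (\<Sum>k=1..N. b k * R (real k)) =
     (\<Sum>j=1..a. \<Sum>i\<le>n. A' i j * H j (N + d * i)) - (\<Sum>i\<le>n. \<Sum>j=1..a. A' i j * H j (d * i))" for N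
  proof -
    have "2 * (\<Sum>k=1..N. b k * R (real k)) = (\<Sum>k=1..N. b k * (2 * R (real k)))"
      by (simp add: sum_distrib_left mult_ac)
    also have "\<dots> = (\<Sum>k=1..N. b k * (\<Sum>i\<le>n. \<Sum>j=1..a. A' i j / (real k + real (d * i)) ^ j))"
      by (intro sum.cong arg_cong2[of _ _ _ _ "(*)"] R2 refl) (auto simp: add_nonneg_eq_0_iff)
    also have "\<dots> = (\<Sum>k=1..N. \<Sum>i\<le>n. \<Sum>j=1..a. A' i j * (b k / (real k + real (d * i)) ^ j))"
      by (simp add: sum_distrib_left mult_ac)
    also have "\<dots> = (\<Sum>i\<le>n. \<Sum>k=1..N. \<Sum>j=1..a. A' i j * (b k / (real k + real (d * i)) ^ j))"
      by (rule sum.swap)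
    also have "\<dots> = (\<Sum>i\<le>n. \<Sum>j=1..a. \<Sum>k=1..N. A' i j * (b k / (real k + real (d * i)) ^ j))"
      by (intro sum.cong refl sum.swap)
    also have "\<dots> = (\<Sum>i\<le>n. \<Sum>j=1..a. A' i j * (H j (N + d * i) - H j (d * i)))"
      by (simp only: sum_distrib_left[symmetric] shift)
    also have "\<dots> = (\<Sum>i\<le>n. \<Sum>j=1..a. A' i j * H j (N + d * i)) - (\<Sum>i\<le>n. \<Sum>j=1..a. A' i j * H j (d * i))"
      by (simp add: right_diff_distrib sum_subtractf)
    also have "(\<Sum>i\<le>n. \<Sum>j=1..a. A' i j * H j (N + d * i)) = (\<Sum>j=1..a. \<Sum>i\<le>n. A' i j * H j (N + d * i))"
      by (rule sum.swap)
    finally show ?thesis .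
  qed
  have lim: "(\<lambda>N. \<Sum>i\<le>n. A' i j * H j (N + d * i)) \<longlonglongrightarrow> (if j \<in> J then c j * L j else 0)" if j: "j \<in> {1..a}" for j
  proof (cases "j \<in> J")
    case True
    have "(\<lambda>N. H j N) \<longlonglongrightarrow> L j" unfolding H_def using True L by (auto simp: J_def)
    then have "(\<lambda>N. \<Sum>i\<le>n. A' i j * H j (N + d * i)) \<longlonglongrightarrow> (\<Sum>i\<le>n. A' i j * L j)"
      by (intro tendsto_sum tendsto_mult tendsto_const LIMSEQ_ignore_initial_segment)
    then show ?thesis using True by (simp add: c_def sum_distrib_right)
  next
    case False
    then have "odd (a + j) \<or> j = 1" using j by (auto simp: J_def)
    then have c0: "c j = 0" using c_odd c_1 j by auto
    \<comment> \<open>\<open>H j N\<close> itself may diverge, but its total coefficient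
      \<open>c j\<close> is 0, so only the windows from N to N + di have to be treated.\<close>
    have "(\<lambda>N. \<Sum>i\<le>n. A' i j * (\<Sum>k\<in>{N<..N + d * i}. b k / real k ^ j)) \<longlonglongrightarrow> (\<Sum>i\<le>n. A' i j * 0)"
      by (intro tendsto_sum tendsto_mult tendsto_const sum_tail_tendsto_0[OF bnd]) (use j in auto)
    moreover have "(\<Sum>i\<le>n. A' i j * (\<Sum>k\<in>{N<..N + d * i}. b k / real k ^ j)) = (\<Sum>i\<le>n. A' i j * H j (N + d * i))" for N
    proof -
      have "H j (N + d * i) = H j N + (\<Sum>k\<in>{N<..N + d * i}. b k / real k ^ j)" for i
      proof -
        have "{1..N + d*i} = {1..N} \<union> {N<..N + d*i}" by auto
        then show ?thesis unfolding H_def by (subst sum.union_disjoint[symmetric]) auto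
      qed
      then have "(\<Sum>i\<le>n. A' i j * H j (N + d * i)) = c j * H j N + (\<Sum>i\<le>n. A' i j * (\<Sum>k\<in>{N<..N + d * i}. b k / real k ^ j))"
        by (simp add: c_def sum_distrib_right distrib_left sum.distrib)
      then show ?thesis using c0 by simp
    qed
    ultimately show ?thesis using False by simp
  qed
  have "(\<lambda>N. 2 * (\<Sum>k=1..N. b k * R (real k))) \<longlonglongrightarrow>
     (\<Sum>j=1..a. if j \<in> J then c j * L j else 0) - (\<Sum>i\<le>n. \<Sum>j=1..a. A' i j * H j (d * i))"
    unfolding partial by (intro tendsto_diff tendsto_const tendsto_sum lim)
  also have "(\<Sum>j=1..a. if j \<in> J then c j * L j else 0) = (\<Sum>j\<in>J. c j * L j)"
    by (subst sum.inter_restrict[symmetric]) (auto simp: J_def intro!: sum.cong)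
  finally have limV: "(\<lambda>N. 2 * (\<Sum>k=1..N. b k * R (real k))) \<longlonglongrightarrow> V" by (simp add: V_def)
  \<comment> \<open>The coordinate along \<open>\<theta> l\<close> of L(j) minus its first di terms;
    L(j) is left out for j outside \<open>J\<close>, where no L-value occurs.\<close>
  define G where "G i j l = (if j \<in> J then of_int (W j l) else 0) - (\<Sum>k=1..d*i. of_int (U k l) / real k ^ j)" for i j l
  define Y where "Y l = (\<Sum>i\<le>n. \<Sum>j=1..a. real D ^ a * A' i j * G i j l)" for l
  have Y_int: "Y l \<in> \<int>" for l
    unfolding Y_def
  proof (intro Ints_sum)
    fix i j assume ij: "i \<in> {..n}" "j \<in> {1..a}"
    have Da: "real D ^ a = real D ^ (a - j) * real D ^ j" using ij by (simp flip: power_add)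
    have A1: "real D ^ a * A' i j \<in> \<int>"
      unfolding Da using A'_int[of i j] ij by (metis Ints_mult Ints_of_nat Ints_power atMost_iff mult.assoc mult.commute)
    have A2: "real D ^ a * A' i j * (of_int u / real k ^ j) \<in> \<int>" if k: "k \<in> {1..d*i}" for k u
    proof -
      have "k \<ge> 1" "k \<le> d * i" using k by auto
      moreover have "d * i \<le> d * n" using ij by simp
      ultimately have "k \<in> {1..d * n}" unfolding atLeastAtMost_iff by linarith
      then have "k dvd D" by (rule D)
      then have "real D / real k \<in> \<int>" using k by (auto elim!: dvdE)
      then have "(real D ^ (a - j) * A' i j) * ((real D / real k) ^ j * of_int u) \<in> \<int>"
        using A'_int[of i j] ij
        by (intro Ints_mult[of "real D ^ (a - j) * A' i j"] Ints_mult[of "_ ^ j"] Ints_power) auto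
      then show ?thesis unfolding Da by (simp add: power_divide mult_ac)
    qed
    have "real D ^ a * A' i j * G i j l = real D ^ a * A' i j * (if j \<in> J then of_int (W j l) else 0)
        - (\<Sum>k=1..d*i. real D ^ a * A' i j * (of_int (U k l) / real k ^ j))"
      by (simp add: G_def right_diff_distrib sum_distrib_left)
    also have "\<dots> \<in> \<int>" by (rule Ints_diff[OF Ints_mult[OF A1] Ints_sum[OF A2]]) auto
    finally show "real D ^ a * A' i j * G i j l \<in> \<int>" .
  qed
  define X where "X l = \<lfloor>Y l\<rfloor>" for l
  have X: "of_int (X l) = Y l" for l using Y_int by (simp add: X_def)
  have DV: "real D ^ a * V = (\<Sum>l<\<delta>. of_int (X l) * \<theta> l)"
  proof -
    have G\<theta>: "(\<Sum>l<\<delta>. G i j l * \<theta> l) = (if j \<in> J then L j else 0) - H j (d * i)" for i j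
    proof -
      have "(\<Sum>l<\<delta>. (\<Sum>k=1..d*i. of_int (U k l) / real k ^ j) * \<theta> l) = (\<Sum>k=1..d*i. (\<Sum>l<\<delta>. of_int (U k l) * \<theta> l) / real k ^ j)"
        unfolding sum_distrib_right sum_divide_distrib by (subst sum.swap) (simp add: mult_ac)
      also have "\<dots> = H j (d * i)" unfolding H_def by (intro sum.cong) (auto simp: U)
      finally show ?thesis
        using W[of j] by (auto simp: G_def left_diff_distrib sum_subtractf J_def)
    qed
    have "(\<Sum>l<\<delta>. of_int (X l) * \<theta> l) = (\<Sum>l<\<delta>. \<Sum>i\<le>n. \<Sum>j=1..a. real D ^ a * A' i j * (G i j l * \<theta> l))"
      by (simp only: X Y_def sum_distrib_right mult.assoc)
    also have "\<dots> = (\<Sum>i\<le>n. \<Sum>l<\<delta>. \<Sum>j=1..a. real D ^ a * A' i j * (G i j l * \<theta> l))" by (rule sum.swap)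
    also have "\<dots> = (\<Sum>i\<le>n. \<Sum>j=1..a. \<Sum>l<\<delta>. real D ^ a * A' i j * (G i j l * \<theta> l))"
      by (intro sum.cong refl sum.swap)
    also have "\<dots> = (\<Sum>i\<le>n. \<Sum>j=1..a. real D ^ a * A' i j * ((if j \<in> J then L j else 0) - H j (d * i)))"
      by (simp only: sum_distrib_left[symmetric] G\<theta>)
    also have "\<dots> = real D ^ a * ((\<Sum>i\<le>n. \<Sum>j=1..a. A' i j * (if j \<in> J then L j else 0)) - (\<Sum>i\<le>n. \<Sum>j=1..a. A' i j * H j (d * i)))"
      by (simp add: right_diff_distrib sum_subtractf sum_distrib_left mult.assoc)
    also have "(\<Sum>i\<le>n. \<Sum>j=1..a. A' i j * (if j \<in> J then L j else 0)) = (\<Sum>j=1..a. \<Sum>i\<le>n. A' i j * (if j \<in> J then L j else 0))"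
      by (rule sum.swap)
    also have "\<dots> = (\<Sum>j=1..a. if j \<in> J then c j * L j else 0)"
      by (intro sum.cong refl) (simp add: c_def sum_distrib_right)
    also have "\<dots> = (\<Sum>j\<in>J. c j * L j)"
      by (subst sum.inter_restrict[symmetric]) (auto simp: J_def intro!: sum.cong)
    finally show ?thesis by (simp add: V_def)
  qed
  have "(\<Sum>l<\<delta>. \<bar>Y l\<bar>) \<le> (\<Sum>l<\<delta>. \<Sum>i\<le>n. \<Sum>j=1..a. real D ^ a * \<bar>A' i j\<bar> * \<bar>G i j l\<bar>)"
  proof (rule sum_mono)
    fix l
    have "\<bar>Y l\<bar> \<le> (\<Sum>i\<le>n. \<bar>\<Sum>j=1..a. real D ^ a * A' i j * G i j l\<bar>)" unfolding Y_def by (rule sum_abs)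
    also have "\<dots> \<le> (\<Sum>i\<le>n. \<Sum>j=1..a. \<bar>real D ^ a * A' i j * G i j l\<bar>)" by (intro sum_mono sum_abs)
    finally show "\<bar>Y l\<bar> \<le> (\<Sum>i\<le>n. \<Sum>j=1..a. real D ^ a * \<bar>A' i j\<bar> * \<bar>G i j l\<bar>)" by (simp add: abs_mult)
  qed
  also have "\<dots> = (\<Sum>i\<le>n. \<Sum>l<\<delta>. \<Sum>j=1..a. real D ^ a * \<bar>A' i j\<bar> * \<bar>G i j l\<bar>)" by (rule sum.swap)
  also have "\<dots> = (\<Sum>i\<le>n. \<Sum>j=1..a. \<Sum>l<\<delta>. real D ^ a * \<bar>A' i j\<bar> * \<bar>G i j l\<bar>)"
    by (intro sum.cong refl sum.swap)
  also have "\<dots> = (\<Sum>i\<le>n. \<Sum>j=1..a. real D ^ a * \<bar>A' i j\<bar> * (\<Sum>l<\<delta>. \<bar>G i j l\<bar>))"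
    by (simp only: sum_distrib_left)
  also have "\<dots> \<le> (\<Sum>i\<le>n. \<Sum>j=1..a. real D ^ a * \<bar>A' i j\<bar> * (of_int K * (real (d * n) + 1)))"
  proof (intro sum_mono mult_left_mono)
    fix i j assume ij: "i \<in> {..n}" "j \<in> {1..a}"
    have "(\<Sum>l<\<delta>. \<bar>G i j l\<bar>) \<le> (\<Sum>l<\<delta>. (if j \<in> J then of_int \<bar>W j l\<bar> else 0) + (\<Sum>k=1..d*i. of_int \<bar>U k l\<bar>))"
    proof (rule sum_mono)
      fix l
      have "\<bar>G i j l\<bar> \<le> \<bar>if j \<in> J then of_int (W j l) else 0\<bar> + \<bar>\<Sum>k=1..d*i. of_int (U k l) / real k ^ j\<bar>"
        unfolding G_def by (rule abs_triangle_ineq4)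
      also have "\<bar>\<Sum>k=1..d*i. of_int (U k l) / real k ^ j\<bar> \<le> (\<Sum>k=1..d*i. of_int \<bar>U k l\<bar>)"
      proof (rule order_trans[OF sum_abs], rule sum_mono)
        fix k assume "k \<in> {1..d*i}"
        then have "real k ^ j \<ge> 1" by (intro one_le_power) auto
        then have "real_of_int \<bar>U k l\<bar> / real k ^ j \<le> real_of_int \<bar>U k l\<bar> / 1"
          by (intro divide_left_mono) linarith+
        then show "\<bar>of_int (U k l) / real k ^ j\<bar> \<le> of_int \<bar>U k l\<bar>" by (simp add: abs_divide)
      qed
      finally show "\<bar>G i j l\<bar> \<le> (if j \<in> J then of_int \<bar>W j l\<bar> else 0) + (\<Sum>k=1..d*i. of_int \<bar>U k l\<bar>)"
        by (simp split: if_splits)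
    qed
    also have "\<dots> = (if j \<in> J then of_int (\<Sum>l<\<delta>. \<bar>W j l\<bar>) else 0) + (\<Sum>k=1..d*i. of_int (\<Sum>l<\<delta>. \<bar>U k l\<bar>))"
      unfolding sum.distrib of_int_sum by (subst (2) sum.swap) auto
    also have "\<dots> \<le> of_int K + (\<Sum>k=1..d*i. of_int K)"
      using W_le U_le K by (intro add_mono sum_mono) (auto simp: J_def simp del: of_int_sum)
    also have "\<dots> = of_int K * (real (d * i) + 1)" by (simp add: algebra_simps)
    also have "\<dots> \<le> of_int K * (real (d * n) + 1)"
      using ij K by (intro mult_left_mono) (auto intro: mult_left_mono)
    finally show "(\<Sum>l<\<delta>. \<bar>G i j l\<bar>) \<le> of_int K * (real (d * n) + 1)" .
  qed auto
  also have "\<dots> = real D ^ a * (of_int K * (real (d * n) + 1)) * (\<Sum>i\<le>n. \<Sum>j=1..a. \<bar>A' i j\<bar>)"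
    by (simp add: sum_distrib_left mult_ac)
  also have "\<dots> \<le> real D ^ a * (of_int K * (real (d * n) + 1)) * (2 * B)"
    using K by (intro mult_left_mono A'_le) auto
  also have "\<dots> = 2 * real D ^ a * B * of_int K * (real (d * n) + 1)" by (simp only: mult_ac)
  finally have "(\<Sum>l<\<delta>. \<bar>Y l\<bar>) \<le> 2 * real D ^ a * B * of_int K * (real (d * n) + 1)" .
  moreover have "(\<Sum>l<\<delta>. \<bar>Y l\<bar>) = of_int (\<Sum>l<\<delta>. \<bar>X l\<bar>)" by (simp add: X)
  moreover have "(\<lambda>N. \<Sum>k=1..N. b k * R (real k)) \<longlonglongrightarrow> V / 2"
    using tendsto_divide[OF limV tendsto_const[of 2]] by simp
  ultimately show ?thesis using that[of "V / 2" X] DV by simp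
qed

section \<open>The rational function\<close>

lemma power_over_fact_le: "(real v / 3) ^ v \<le> fact v"
proof -
  have "(\<lambda>n. real v ^ n /\<^sub>R fact n) sums exp (real v)" by (rule exp_converges)
  \<comment> \<open>A single term of the exponential series bounds v^v/v! by e^v; the 3 replacing e
    later enters the constant 12.\<close>
  then have "(\<Sum>n\<in>{v}. real v ^ n /\<^sub>R fact n) \<le> exp (real v)"
    by (intro sum_le_suminf[of _ "{v}", THEN order_trans] ) (auto simp: sums_iff)
  also have "exp (real v) = exp 1 ^ v" by (simp add: exp_of_nat_mult[symmetric])
  also have "\<dots> \<le> 3 ^ v" by (intro power_mono exp_le) simp
  finally show ?thesis by (simp add: field_simps power_divide)
qed

lemma abs_pochhammer_over_fact_le:
  fixes y :: real
  assumes "\<And>l. l < v \<Longrightarrow> \<bar>y + real l\<bar> \<le> M" "v \<ge> 1"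
  shows "\<bar>pochhammer y v / fact v\<bar> \<le> (3 * M / real v) ^ v"
proof -
  have M: "M \<ge> 0" using assms(1)[of 0] assms(2) by simp
  have "\<bar>pochhammer y v\<bar> = (\<Prod>l<v. \<bar>y + real l\<bar>)"
    by (simp add: pochhammer_prod abs_prod atLeast0LessThan)
  also have "\<dots> \<le> (\<Prod>l<v. M)" using assms(1) by (intro prod_mono) auto
  finally have "\<bar>pochhammer y v\<bar> \<le> M ^ v" by simp
  then have "\<bar>pochhammer y v / fact v\<bar> \<le> M ^ v / (real v / 3) ^ v"
    unfolding abs_divide using power_over_fact_le[of v] M assms(2) by (intro frac_le) auto
  also have "\<dots> = (3 * M / real v) ^ v" by (simp add: power_divide power_mult_distrib)
  finally show ?thesis .
qed

lemma sum_inverse_squares_le_2: "(\<Sum>k=1..N. 1 / (real k)\<^sup>2) \<le> 2"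
proof -
  have "(\<Sum>k=1..N. 1 / (real k)\<^sup>2) \<le> 2 - 1 / real N" if "N \<ge> 1"
    using that
  proof (induction N rule: nat_induct_at_least)
    case (Suc N)
    have "1 / (real (Suc N))\<^sup>2 \<le> 1 / (real N * real (Suc N))"
      using Suc.hyps by (intro divide_left_mono) (auto simp: power2_eq_square)
    also have "\<dots> = 1 / real N - 1 / real (Suc N)"
      using Suc.hyps by (simp add: field_simps)
    finally have "1 / (real (Suc N))\<^sup>2 \<le> 1 / real N - 1 / real (Suc N)" .
    then show ?case using Suc.IH by simp
  qed simp
  then show ?thesis by (cases "N \<ge> 1") (force intro: order_trans)+
qed

lemma poly_pochhammer_linear: "poly (pochhammer [:c, 1:] v) t = pochhammer (t + c) v"
  for t c :: "'a::comm_ring_1"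
  by (simp add: pochhammer_prod poly_prod add_ac)

lemma degree_pochhammer_linear: "degree (pochhammer [:c, 1:] v) \<le> v" for c :: real
proof -
  have "degree (\<Prod>i\<in>{0..<v}. [:c, 1:] + of_nat i) \<le> (\<Sum>i\<in>{0..<v}. degree ([:c, 1:] + of_nat i :: real poly))"
    using degree_prod_sum_le[of "{0..<v}" "\<lambda>i. [:c, 1:] + of_nat i"] by (simp add: o_def)
  also have "\<dots> \<le> (\<Sum>i\<in>{0..<v}. 1)" by (intro sum_mono) (simp add: of_nat_poly)
  finally show ?thesis by (simp add: pochhammer_prod)
qed

lemma pfrac_1_tendsto:
  assumes "pfrac d n D 1 B h"
  shows "\<exists>c. ((\<lambda>t. t * h t) \<longlongrightarrow> c) at_top" "(h \<longlongrightarrow> 0) at_top"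
proof -
  obtain A where A: "\<And>t. (\<forall>i\<le>n. t + real (d * i) \<noteq> 0) \<longrightarrow>
        h t = (\<Sum>i\<le>n. \<Sum>j=1..(1::nat). A i j / (t + real (d * i)) ^ j)"
    using assms unfolding pfrac_def by blast
  have ev: "eventually (\<lambda>t. (\<Sum>i\<le>n. A i 1 * (1 / (t + real (d * i)))) = h t) at_top"
    using eventually_gt_at_top[of 0]
  proof eventually_elim
    case (elim t)
    then have "\<forall>i\<le>n. t + real (d * i) \<noteq> 0" by (auto simp: add_pos_nonneg less_imp_neq[symmetric])
    then show ?case using A by simp
  qed
  have "((\<lambda>t. \<Sum>i\<le>n. A i 1 * (t * (1 / (t + real (d * i))))) \<longlongrightarrow> (\<Sum>i\<le>n. A i 1 * 1)) at_top"
    by (intro tendsto_sum tendsto_mult tendsto_const) real_asymp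
  moreover have "eventually (\<lambda>t. (\<Sum>i\<le>n. A i 1 * (t * (1 / (t + real (d * i))))) = t * h t) at_top"
    using ev
  proof eventually_elim
    case (elim t)
    show ?case unfolding elim[symmetric] by (simp only: sum_distrib_left mult.left_commute)
  qed
  ultimately have "((\<lambda>t. t * h t) \<longlongrightarrow> (\<Sum>i\<le>n. A i 1 * 1)) at_top" by (rule Lim_transform_eventually)
  then show "\<exists>c. ((\<lambda>t. t * h t) \<longlongrightarrow> c) at_top" by blast
  have "((\<lambda>t. \<Sum>i\<le>n. A i 1 * (1 / (t + real (d * i)))) \<longlongrightarrow> (\<Sum>i\<le>n. A i 1 * 0)) at_top"
    by (intro tendsto_sum tendsto_mult tendsto_const) real_asymp
  then have "((\<lambda>t. \<Sum>i\<le>n. A i 1 * (1 / (t + real (d * i)))) \<longlongrightarrow> 0) at_top" by simp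
  then show "(h \<longlongrightarrow> 0) at_top" using ev by (rule Lim_transform_eventually)
qed

lemma power_block_exponent: "((c ^ v) ^ 2) ^ (2 * d * r) = (c ^ (4 * d * r)) ^ v" for c :: real
  by (simp only: power_mult[symmetric]) (rule arg_cong[where f = "power c"], simp)

text \<open>
  There are $n + 1 = 2v + 1$ poles. The block with index $w$ vanishes at $x_w + 1, \dots, x_w + v$ and at the mirror
  images of these points. The blocks with $w < dr$ cover the positive integers below $k_0$ and those with
  $dr \le w < 2dr$ cover $k_0 + 1, \dots, k_0 + vdr$.
\<close>

locale rational_function =
  fixes d m r v :: nat
  assumes m: "1 \<le> m" "m \<le> d" and r: "r \<ge> 4" and v: "v \<ge> 1"
begin

text \<open>Congruent to m modulo d, so the coefficient at \<open>k0\<close> is the normalised one.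
  The natural subtraction does not truncate, by \<open>k0_eq\<close>.\<close>

definition k0 :: nat where "k0 = v * d * r + m - d"

text \<open>Integer valued because the first zero is placed at m - d \<le> 0: from there dr blocks
  of length v end exactly at \<open>k0 - 1\<close>.\<close>

definition x :: "nat \<Rightarrow> int" where
  "x w = (if w < d * r then int m - int d - 1 + int (v * w) else int k0 + int (v * (w - d * r)))"

text \<open>Division by v!^2 makes the block integer valued at integers, and degree 2v is the
  largest that fits the 2v + 1 simple poles of one factor of \<open>R\<close>.\<close>

definition blk :: "nat \<Rightarrow> real poly" where
  "blk w = (if w < 2 * d * r then
     smult (1 / fact v ^ 2) (pochhammer [:- of_int (x w) - real v, 1:] v *
       pochhammer [:real (d * (2 * v)) + of_int (x w) + 1, 1:] v) else 1)"

definition Q :: "real \<Rightarrow> real" where "Q t = (\<Prod>i\<in>{..2 * v}. t / real d + real i)"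

text \<open>Arranged as a product of a factors with simple poles, to which \<open>pfrac_prod\<close>
  applies; only the first 2dr factors carry a block.\<close>

definition R :: "nat \<Rightarrow> real \<Rightarrow> real" where
  "R a t = (\<Prod>w<a. fact (2 * v) * poly (blk w) t / Q t)"

section \<open>Position of \<open>k0\<close> and of the zeros\<close>

lemma d: "d \<ge> 1" using m by simp

lemma k0_eq: "k0 + d = v * d * r + m"
proof -
  have "v * r \<ge> 1" using v r by simp
  then have "d * 1 \<le> d * (v * r)" by (intro mult_left_mono) auto
  also have "d * (v * r) = v * d * r" by simp
  finally have "d \<le> v * d * r + m" by linarith
  then show ?thesis unfolding k0_def by (rule le_add_diff_inverse2)
qed

lemma int_k0: "int k0 = int (v * d * r) + int m - int d"
  using arg_cong[OF k0_eq, of int] by (simp only: of_nat_add)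

lemma k0_le: "k0 \<le> v * d * r" using k0_eq m by linarith

lemma dv_le: "4 * (d * v) \<le> v * d * r" "d \<le> d * v" "1 \<le> d * v"
proof -
  have "(d * v) * 4 \<le> (d * v) * r" using r by (intro mult_left_mono) auto
  then show "4 * (d * v) \<le> v * d * r" by (simp add: mult_ac)
  show "d \<le> d * v" "1 \<le> d * v" using v d by (simp_all add: Suc_le_eq)
qed

lemma real_dv_le: "4 * real (d * v) \<le> real (v * d * r)" "real d \<le> real (d * v)"
proof -
  have "real (4 * (d * v)) \<le> real (v * d * r)" using dv_le(1) by (simp only: of_nat_le_iff)
  then show "4 * real (d * v) \<le> real (v * d * r)" by simp
  show "real d \<le> real (d * v)" using dv_le(2) by (simp only: of_nat_le_iff)
qed

lemma k0_ge: "2 * (d * v) \<le> k0" "1 \<le> k0" "v * d * r \<le> k0 + k0"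
  using k0_eq dv_le m by linarith+

lemma x_bounds:
  assumes "w < 2 * d * r"
  shows "- int d \<le> x w" "x w + int v \<le> 2 * int (v * d * r)"
    "x w + int v < int k0 \<or> int k0 \<le> x w"
proof -
  have "x w + int v < int k0 \<or> int k0 \<le> x w \<and> x w + int v \<le> 2 * int (v * d * r)"
  proof (cases "w < d * r")
    case True
    then have "v * (w + 1) \<le> v * (d * r)" by (intro mult_left_mono) auto
    then have "v * w + v \<le> v * d * r" by (simp add: algebra_simps)
    then have "int (v * w) + int v \<le> int (v * d * r)" by (simp only: of_nat_add[symmetric] of_nat_le_iff)
    moreover have "x w = int m - int d - 1 + int (v * w)" using True by (simp only: x_def if_True)
    ultimately show ?thesis using int_k0 by linarith
  next
    case False
    then have "v * ((w - d * r) + 1) \<le> v * (d * r)" using assms by (intro mult_left_mono) auto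
    then have "v * (w - d * r) + v \<le> v * d * r" by (simp add: algebra_simps)
    then have "int (v * (w - d * r)) + int v \<le> int (v * d * r)" by (simp only: of_nat_add[symmetric] of_nat_le_iff)
    moreover have "x w = int k0 + int (v * (w - d * r))" using False by (simp only: x_def if_False)
    ultimately show ?thesis using k0_le by linarith
  qed
  then show "x w + int v \<le> 2 * int (v * d * r)" "x w + int v < int k0 \<or> int k0 \<le> x w" using k0_le by linarith+
  have "- int d \<le> int m - int d - 1 + int (v * w)" "- int d \<le> int k0 + int (v * (w - d * r))" using m by linarith+
  then show "- int d \<le> x w" unfolding x_def by (simp only: if_split) blast
qed

section \<open>Integrality, size and symmetry of the blocks\<close>

lemma poly_blk:
  "w < 2 * d * r \<Longrightarrow> poly (blk w) t =
     (pochhammer (t - of_int (x w) - real v) v / fact v) *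
     (pochhammer (t + real (d * (2 * v)) + of_int (x w) + 1) v / fact v)"
proof -
  assume "w < 2 * d * r"
  then have "poly (blk w) t = 1 / fact v ^ 2 * (pochhammer (t + (- of_int (x w) - real v)) v *
     pochhammer (t + (real (d * (2 * v)) + of_int (x w) + 1)) v)"
    by (simp only: blk_def if_True poly_smult poly_mult poly_pochhammer_linear)
  also have "t + (- of_int (x w) - real v) = t - of_int (x w) - real v" by simp
  also have "t + (real (d * (2 * v)) + of_int (x w) + 1) = t + real (d * (2 * v)) + of_int (x w) + 1" by simp
  finally have "poly (blk w) t = 1 / fact v ^ 2 * (pochhammer (t - of_int (x w) - real v) v *
     pochhammer (t + real (d * (2 * v)) + of_int (x w) + 1) v)" .
  moreover have "1 / f ^ 2 * (p * q) = p / f * (q / f)" for f p q :: real by (simp add: power2_eq_square)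
  ultimately show ?thesis by (simp only:)
qed

lemma degree_blk: "degree (blk w) \<le> 2 * v"
proof -
  have "degree (pochhammer [:c, 1:] v * pochhammer [:c', 1:] v) \<le> v + v" for c c' :: real
    by (rule order_trans[OF degree_mult_le]) (intro add_mono degree_pochhammer_linear)
  note deg = this
  show ?thesis
  proof (cases "w < 2 * d * r")
    case True
    show ?thesis unfolding blk_def mult_2[of v] using True
      by (simp only: if_True) (rule order_trans[OF degree_smult_le deg])
  qed (simp add: blk_def)
qed

lemma poly_blk_Ints: "poly (blk w) (of_int z) \<in> \<int>"
proof (cases "w < 2 * d * r")
  case True
  have *: "pochhammer (of_int y) v / fact v \<in> (\<int> :: real set)" for y
  proof -
    obtain q where "pochhammer y v = fact v * q" using fact_dvd_pochhammer[of v y] by (elim dvdE)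
    then have "pochhammer (of_int y) v / fact v = (of_int q :: real)" by (simp add: pochhammer_of_int)
    then show ?thesis by simp
  qed
  have "of_int z - of_int (x w) - real v = of_int (z - x w - int v)"
    "of_int z + real (d * (2 * v)) + of_int (x w) + 1 = of_int (z + int (d * (2 * v)) + x w + 1)" by simp_all
  then show ?thesis unfolding poly_blk[OF True] by (metis Ints_mult *)
qed (simp add: blk_def)

text \<open>All linear factors have modulus at most 4 \<kappa>; with the 3 from v! \<ge> (v/3)^v
  this gives 12. The free bound \<kappa> lets the estimate serve at the poles, at \<open>k0\<close>
  and far beyond the zeros.\<close>

lemma abs_poly_blk_le:
  assumes "\<bar>t\<bar> \<le> \<kappa>" "\<kappa> \<ge> real (v * d * r)"
  shows "\<bar>poly (blk w) t\<bar> \<le> ((12 * \<kappa> / real v) ^ v) ^ 2"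
proof (cases "w < 2 * d * r")
  case True
  have b: "- real d \<le> of_int (x w)" "of_int (x w) + real v \<le> 2 * real (v * d * r)"
    using x_bounds(1,2)[OF True] by linarith+
  note 4 = real_dv_le
  have "0 \<le> 12 * \<kappa> / real v" using assms(1) by simp
  have "\<bar>pochhammer (t - of_int (x w) - real v) v / fact v\<bar> \<le> (3 * (4 * \<kappa>) / real v) ^ v"
  proof (rule abs_pochhammer_over_fact_le[OF _ v])
    fix l assume "l < v"
    then have "0 \<le> real l" "real l + 1 \<le> real v" by auto
    then show "\<bar>t - of_int (x w) - real v + real l\<bar> \<le> 4 * \<kappa>"
      using assms b 4 by linarith
  qed
  moreover have "\<bar>pochhammer (t + real (d * (2 * v)) + of_int (x w) + 1) v / fact v\<bar> \<le> (3 * (4 * \<kappa>) / real v) ^ v"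
  proof (rule abs_pochhammer_over_fact_le[OF _ v])
    fix l assume "l < v"
    then have "0 \<le> real l" "real l + 1 \<le> real v" by auto
    moreover have "real (d * (2 * v)) = 2 * real (d * v)" by simp
    ultimately show "\<bar>t + real (d * (2 * v)) + of_int (x w) + 1 + real l\<bar> \<le> 4 * \<kappa>"
      using assms b 4 by linarith
  qed
  ultimately show ?thesis
    unfolding poly_blk[OF True] abs_mult power2_eq_square
    using \<open>0 \<le> 12 * \<kappa> / real v\<close> by (intro mult_mono zero_le_power) auto
next
  case False
  have "real v * 1 \<le> real v * real (d * r)" using d r by (intro mult_left_mono) (auto simp: Suc_le_eq simp flip: of_nat_mult)
  then have "real v \<le> \<kappa>" using assms(2) by (simp add: mult_ac)
  then have "12 * \<kappa> / real v \<ge> 1" using v by (simp add: le_divide_eq)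
  then have "((12 * \<kappa> / real v) ^ v) ^ 2 \<ge> 1" by (intro one_le_power)
  then show ?thesis using False by (simp add: blk_def)
qed

lemma pfrac_factor:
  "pfrac d (2 * v) D 1 (real d * 2 ^ (2 * v) * (if w < 2 * d * r then ((12 * real (d * r)) ^ v) ^ 2 else 1))
     (\<lambda>t. fact (2 * v) * poly (blk w) t / Q t)"
  unfolding Q_def
proof (rule pfrac_simple[OF d degree_blk])
  fix i assume i: "i \<le> 2 * v"
  show "poly (blk w) (- real (d * i)) \<in> \<int>" using poly_blk_Ints[of w "- int (d * i)"] by simp
  show "\<bar>poly (blk w) (- real (d * i))\<bar> \<le> (if w < 2 * d * r then ((12 * real (d * r)) ^ v) ^ 2 else 1)"
  proof (cases "w < 2 * d * r")
    case True
    have "d * i \<le> d * (2 * v)" using i by (intro mult_left_mono) auto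
    then have "d * i \<le> v * d * r" using k0_ge(1) k0_le by linarith
    then have "\<bar>poly (blk w) (- real (d * i))\<bar> \<le> ((12 * real (v * d * r) / real v) ^ v) ^ 2"
      by (intro abs_poly_blk_le) (auto simp del: of_nat_mult)
    also have "12 * real (v * d * r) / real v = 12 * real (d * r)" using v by simp
    finally show ?thesis using True by simp
  qed (simp add: blk_def)
qed

text \<open>To first order only \<open>2 ^ (2 * v * a)\<close> matters: a! d^a does not depend on v,
  and the block factor becomes exp(o(a) v) for the later choice of r.\<close>

lemma pfrac_R:
  assumes D: "\<And>k. k \<in> {1..d * (2 * v)} \<Longrightarrow> k dvd D" and a: "a \<ge> 1" "2 * d * r \<le> a"
  shows "pfrac d (2 * v) D a (fact a * real d ^ a * 2 ^ (2 * v * a) * ((12 * real (d * r)) ^ (4 * d * r)) ^ v) (R a)"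
proof -
  let ?B = "\<lambda>w. real d * 2 ^ (2 * v) * (if w < 2 * d * r then ((12 * real (d * r)) ^ v) ^ 2 else 1)"
  have "pfrac d (2 * v) D a (fact a * (\<Prod>w<a. ?B w)) (\<lambda>t. \<Prod>w<a. fact (2 * v) * poly (blk w) t / Q t)"
  proof (rule pfrac_prod[OF _ d pfrac_factor _ a(1)])
    fix e assume e: "e \<in> {1..2 * v}"
    then have "d * e \<le> d * (2 * v)" by (intro mult_left_mono) auto
    then show "d * e dvd D" using d e by (intro D) (auto simp: Suc_le_eq)
  qed auto
  moreover have "(\<Prod>w<a. ?B w) = real d ^ a * 2 ^ (2 * v * a) * ((12 * real (d * r)) ^ (4 * d * r)) ^ v"
  proof -
    have "{w. w < a \<and> w < 2 * d * r} = {..<2*d*r}" using a by auto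
    then have "(\<Prod>w<a. if w < 2 * d * r then ((12 * real (d * r)) ^ v) ^ 2 else 1) = (((12 * real (d * r)) ^ v) ^ 2) ^ (2 * d * r)"
      by (simp add: prod.If_cases Int_def)
    also have "\<dots> = ((12 * real (d * r)) ^ (4 * d * r)) ^ v" by (rule power_block_exponent)
    finally show ?thesis by (simp add: prod.distrib power_mult_distrib power_mult)
  qed
  ultimately show ?thesis by (simp add: R_def[abs_def] mult.assoc)
qed

text \<open>The reflection exchanges the two Pochhammer symbols of a block and fixes the block,
  while \<open>Q\<close>, a product of 2v + 1 factors, changes sign. Each of the a factors of
  \<open>R\<close> thus contributes -1.\<close>

lemma R_parity: "R a (- real (d * (2 * v)) - t) = (-1) ^ a * R a t"
proof -
  let ?s = "real (d * (2 * v))"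
  have sym: "poly (blk w) (- ?s - t) = poly (blk w) t" for w
  proof (cases "w < 2 * d * r")
    case True
    have e: "- ?s - t - of_int (x w) - real v = - (?s + t + of_int (x w) + real v)"
      "?s + t + of_int (x w) + real v - real v + 1 = t + ?s + of_int (x w) + 1"
      "- ?s - t + ?s + of_int (x w) + 1 = - (t - of_int (x w) - 1)"
      "t - of_int (x w) - 1 - real v + 1 = t - of_int (x w) - real v" by simp_all
    have "pochhammer (- ?s - t - of_int (x w) - real v) v = (-1) ^ v * pochhammer (t + ?s + of_int (x w) + 1) v"
      by (subst e(1), subst pochhammer_minus, subst e(2)) (rule refl)
    moreover have "pochhammer (- ?s - t + ?s + of_int (x w) + 1) v = (-1) ^ v * pochhammer (t - of_int (x w) - real v) v"
      by (subst e(3), subst pochhammer_minus, subst e(4)) (rule refl)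
    moreover have "(-1::real) ^ v * (-1) ^ v = 1" by (simp flip: power_mult_distrib)
    ultimately show ?thesis unfolding poly_blk[OF True] by (simp add: mult_ac)
  qed (simp add: blk_def)
  have Q: "Q (- ?s - t) = - Q t"
  proof -
    have "Q (- ?s - t) = (\<Prod>i\<in>{..2 * v}. (-1) * (t / real d + real (2 * v - i)))"
      unfolding Q_def using d by (intro prod.cong) (auto simp: field_simps of_nat_diff)
    also have "\<dots> = (-1) ^ (2 * v + 1) * (\<Prod>i\<in>{..2 * v}. t / real d + real (2 * v - i))"
      by (simp only: prod.distrib prod_constant) simp
    also have "(\<Prod>i\<in>{..2 * v}. t / real d + real (2 * v - i)) = Q t"
      unfolding Q_def by (rule prod.reindex_bij_witness[of _ "\<lambda>i. 2 * v - i" "\<lambda>i. 2 * v - i"]) auto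
    finally show ?thesis by simp
  qed
  have "R a (- ?s - t) = (\<Prod>w<a. (-1) * (fact (2 * v) * poly (blk w) t / Q t))"
    unfolding R_def sym Q by simp
  also have "\<dots> = (-1) ^ a * R a t" unfolding R_def by (simp only: prod.distrib prod_constant card_lessThan)
  finally show ?thesis .
qed

lemma R_decay:
  assumes "a \<ge> 2"
  shows "((\<lambda>t. t * R a t) \<longlongrightarrow> 0) at_top"
proof -
  let ?h = "\<lambda>w t. fact (2 * v) * poly (blk w) t / Q t"
  obtain c where c: "((\<lambda>t. t * ?h 0 t) \<longlongrightarrow> c) at_top" using pfrac_1_tendsto(1)[OF pfrac_factor] by blast
  have "((\<lambda>t. (t * ?h 0 t) * (\<Prod>w\<in>{1..<a}. ?h w t)) \<longlongrightarrow> c * (\<Prod>w\<in>{1..<a}. 0)) at_top"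
    by (intro tendsto_mult c tendsto_prod pfrac_1_tendsto(2)[OF pfrac_factor])
  moreover have "(\<Prod>w\<in>{1..<a}. 0::real) = 0" using assms by simp
  moreover have "t * R a t = (t * ?h 0 t) * (\<Prod>w\<in>{1..<a}. ?h w t)" for t
  proof -
    have "{..<a} = insert 0 {1..<a}" using assms by auto
    then show ?thesis unfolding R_def by simp
  qed
  ultimately show ?thesis by (simp only: mult_zero_right)
qed

section \<open>Zeros and size of \<open>R\<close> at positive integers\<close>

lemma R_eq:
  assumes "2 * d * r \<le> a"
  shows "R a t = (fact (2 * v) / Q t) ^ a * (\<Prod>w<2*d*r. poly (blk w) t)"
proof -
  have "R a t = (\<Prod>w<a. (fact (2 * v) / Q t) * poly (blk w) t)" unfolding R_def by simp
  also have "\<dots> = (fact (2 * v) / Q t) ^ a * (\<Prod>w<a. poly (blk w) t)"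
    by (simp only: prod.distrib prod_constant card_lessThan)
  also have "(\<Prod>w<a. poly (blk w) t) = (\<Prod>w<2*d*r. poly (blk w) t)"
    using assms by (intro prod.mono_neutral_right) (auto simp: blk_def)
  finally show ?thesis .
qed

lemma R_eq_0:
  assumes "2 * d * r \<le> a" "1 \<le> k" "k \<le> k0 + v * d * r" "k \<noteq> k0"
  shows "R a (real k) = 0"
proof -
  have "\<exists>w<2*d*r. \<exists>j<v. int k = x w + int v - int j"
  proof -
    \<comment> \<open>Offset of k from the first zero of its half, which is m - d below
      \<open>k0\<close> and \<open>k0 + 1\<close> above it. Quotient and remainder by v give the
      block and the position inside it.\<close>
    define e where "e = (if k < k0 then k + d - m else k - k0 - 1)"
    have "e < v * d * r"
    proof (cases "k < k0")
      case True
      then have "e = k + d - m" by (simp only: e_def if_True)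
      then show ?thesis using True k0_eq m by linarith
    next
      case False
      then have "e = k - k0 - 1" by (simp only: e_def if_False)
      then show ?thesis using False assms by linarith
    qed
    then have e: "e < v * (d * r)" by (simp add: mult.assoc)
    define w where "w = e div v + (if k < k0 then 0 else d * r)"
    have q: "e div v < d * r" using e v by (simp add: less_mult_imp_div_less mult.commute)
    have "int e = int (v * (e div v) + e mod v)" by simp
    then have em: "int e = int (v * (e div v)) + int (e mod v)" by (simp only: of_nat_add)
    have "e mod v < v" using v by simp
    then have j: "int (v - 1 - e mod v) = int v - 1 - int (e mod v)" by (simp add: of_nat_diff)
    have "int k = x w + int v - int (v - 1 - e mod v)"
    proof (cases "k < k0")
      case True
      then have "int e = int k + int d - int m" using assms m by (simp add: e_def)
      moreover have "x w = int m - int d - 1 + int (v * (e div v))" using True q by (simp add: w_def x_def)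
      ultimately show ?thesis using em j by linarith
    next
      case False
      then have "int e = int k - int k0 - 1" using assms by (simp add: e_def)
      moreover have "x w = int k0 + int (v * (e div v))" using False by (simp add: w_def x_def)
      ultimately show ?thesis using em j by linarith
    qed
    moreover have "w < 2 * d * r" using q by (simp add: w_def)
    moreover have "v - 1 - e mod v < v" using v by simp
    ultimately show ?thesis by blast
  qed
  then obtain w j where w: "w < 2 * d * r" "j < v" "int k = x w + int v - int j" by blast
  have "real k = of_int (x w) + real v - real j" using w(3) by linarith
  then have "pochhammer (real k - of_int (x w) - real v) v = 0"
    using w(2) by (auto simp: pochhammer_eq_0_iff)
  then have "poly (blk w) (real k) = 0" unfolding poly_blk[OF w(1)] by simp
  then have "(\<Prod>w<2*d*r. poly (blk w) (real k)) = 0" using w(1) by (intro prod_zero) auto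
  then show ?thesis unfolding R_eq[OF assms(1)] by (simp only: mult_zero_right)
qed

lemma Q_pos: "t > 0 \<Longrightarrow> Q t > 0"
  unfolding Q_def using d by (intro prod_pos) (auto intro!: add_pos_nonneg)

text \<open>The size of \<open>R a\<close> at \<open>k0\<close> with the blocks removed; it is the
  unit in which the series is measured.\<close>

definition E :: "nat \<Rightarrow> real" where "E a = (fact (2 * v) / Q (real k0)) ^ a"

lemma E_pos: "E a > 0"
  unfolding E_def using Q_pos[of "real k0"] k0_ge by simp

text \<open>The lower bound loses nothing to the blocks: their values at \<open>k0\<close> are
  integers, and nonzero since \<open>k0\<close> avoids the zeros and their mirror images.\<close>

lemma abs_R_k0:
  assumes "2 * d * r \<le> a"
  shows "E a \<le> \<bar>R a (real k0)\<bar>" "\<bar>R a (real k0)\<bar> \<le> E a * ((12 * real (d * r)) ^ (4 * d * r)) ^ v"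
proof -
  have F1: "\<bar>poly (blk w) (real k0)\<bar> \<ge> 1" if w: "w < 2 * d * r" for w
  proof -
    have "pochhammer (real k0 - of_int (x w) - real v) v \<noteq> 0"
    proof
      assume "pochhammer (real k0 - of_int (x w) - real v) v = 0"
      then obtain j where "j < v" "real k0 - of_int (x w) - real v = - real j"
        by (auto simp: pochhammer_eq_0_iff)
      then have "int k0 - x w - int v = - int j" by linarith
      then show False using x_bounds(3)[OF w] \<open>j < v\<close> by linarith
    qed
    moreover have "pochhammer (real k0 + real (d * (2 * v)) + of_int (x w) + 1) v > 0"
    proof (rule pochhammer_pos)
      have "real d \<le> real (d * (2 * v))" using dv_le(2) by (simp only: of_nat_le_iff)
      moreover have "- real d \<le> of_int (x w)" using x_bounds(1)[OF w] by linarith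
      ultimately show "real k0 + real (d * (2 * v)) + of_int (x w) + 1 > 0" by linarith
    qed
    ultimately have "poly (blk w) (real k0) \<noteq> 0" unfolding poly_blk[OF w] by simp
    moreover have "poly (blk w) (real k0) \<in> \<int>" using poly_blk_Ints[of w "int k0"] by simp
    ultimately show ?thesis by (simp add: Ints_nonzero_abs_ge1)
  qed
  have eq: "\<bar>R a (real k0)\<bar> = E a * (\<Prod>w<2*d*r. \<bar>poly (blk w) (real k0)\<bar>)"
    unfolding R_eq[OF assms] abs_mult abs_prod using E_pos[of a] by (simp add: E_def)
  have "(\<Prod>w<2*d*r. \<bar>poly (blk w) (real k0)\<bar>) \<ge> 1" using F1 by (intro prod_ge_1) auto
  then show "E a \<le> \<bar>R a (real k0)\<bar>" unfolding eq using E_pos[of a] by simp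
  have "(\<Prod>w<2*d*r. \<bar>poly (blk w) (real k0)\<bar>) \<le> (\<Prod>w<2*d*r. ((12 * real (v * d * r) / real v) ^ v) ^ 2)"
    using k0_le by (intro prod_mono conjI abs_poly_blk_le abs_ge_zero) (auto simp del: of_nat_mult)
  also have "12 * real (v * d * r) / real v = 12 * real (d * r)" using v by simp
  also have "(\<Prod>w<2*d*r. ((12 * real (d * r)) ^ v) ^ 2) = ((12 * real (d * r)) ^ (4 * d * r)) ^ v"
    by (simp only: prod_constant card_lessThan power_block_exponent)
  finally show "\<bar>R a (real k0)\<bar> \<le> E a * ((12 * real (d * r)) ^ (4 * d * r)) ^ v"
    unfolding eq using E_pos[of a] by (intro mult_left_mono) auto
qed

text \<open>For 0 \<le> i \<le> y \<le> z one has i^2 \<le> yz, whence ((y+i)/(z+i))^2 \<le> y/z.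
  The condition i \<le> y with y = k0/d comes from 2dv \<le> k0, which rests on r \<ge> 4.\<close>

lemma Q_ratio:
  assumes "k0 \<le> k"
  shows "Q (real k0) / Q (real k) \<le> sqrt (real k0 / real k) ^ (2 * v + 1)"
proof -
  have "Q (real k0) / Q (real k) = (\<Prod>i\<in>{..2 * v}. (real k0 / real d + real i) / (real k / real d + real i))"
    unfolding Q_def by (rule prod_dividef[symmetric])
  also have "\<dots> \<le> (\<Prod>i\<in>{..2 * v}. sqrt (real k0 / real k))"
  proof (intro prod_mono conjI)
    fix i assume i: "i \<in> {..2 * v}"
    define y z where "y = real k0 / real d" and "z = real k / real d"
    have yz: "0 < y" "y \<le> z" using assms k0_ge(2) d by (auto simp: y_def z_def divide_right_mono)
    have "d * i \<le> d * (2 * v)" using i by (intro mult_left_mono) auto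
    also have "\<dots> = 2 * (d * v)" by simp
    also have "\<dots> \<le> k0" by (rule k0_ge)
    finally have "d * i \<le> k0" .
    then have "real (d * i) \<le> real k0" by (simp only: of_nat_le_iff)
    then have "real i \<le> y" using d by (simp add: y_def field_simps)
    then have "real i * real i \<le> y * z" using yz by (intro mult_mono) auto
    then have "real i * real i * (z - y) \<le> y * z * (z - y)" using yz by (intro mult_right_mono) auto
    then have "(y + real i)\<^sup>2 * z \<le> y * (z + real i)\<^sup>2" by (simp add: power2_eq_square algebra_simps)
    then have "((y + real i) / (z + real i))\<^sup>2 \<le> y / z" using yz by (simp add: power_divide field_simps)
    then have "(y + real i) / (z + real i) \<le> sqrt (y / z)" by (rule real_le_rsqrt)
    also have "y / z = real k0 / real k" using d by (simp add: y_def z_def)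
    finally show "(real k0 / real d + real i) / (real k / real d + real i) \<le> sqrt (real k0 / real k)"
      by (simp add: y_def z_def)
  qed auto
  finally show ?thesis by simp
qed

text \<open>Put \<sigma> = sqrt(k0/k), so \<sigma>^2 \<le> 1/2 beyond the zeros. The blocks are at
  most (12dr)^(4drv) \<sigma>^(-8drv), and their constant is at most 2^(bv) \<le> \<sigma>^(-2bv).
  \<open>Q\<close> gains \<sigma>^((2v+1)a), of which the blocks consume at most the part
  \<sigma>^(va) because 2b + 8dr \<le> a.\<close>

lemma abs_R_tail:
  assumes a: "2 * b + 8 * d * r \<le> a" and b: "(12 * real (d * r)) ^ (4 * d * r) \<le> 2 ^ b"
    and k: "k > k0 + v * d * r"
  shows "\<bar>R a (real k)\<bar> \<le> E a * sqrt (real k0 / real k) ^ (v * a)"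
proof -
  define \<sigma> where "\<sigma> = sqrt (real k0 / real k)"
  have kpos: "k > 0" "k0 > 0" using k k0_ge by auto
  have \<sigma>2: "\<sigma> ^ 2 = real k0 / real k" by (simp add: \<sigma>_def)
  have \<sigma>: "0 < \<sigma>" "\<sigma> \<le> 1" using kpos k by (auto simp: \<sigma>_def)
  have two: "2 * \<sigma> ^ 2 \<le> 1" using k k0_le kpos by (simp add: \<sigma>2 field_simps)
  have "(\<Prod>w<2*d*r. \<bar>poly (blk w) (real k)\<bar>) \<le> (\<Prod>w<2*d*r. ((12 * real k / real v) ^ v) ^ 2)"
    using k by (intro prod_mono conjI abs_poly_blk_le abs_ge_zero) (auto simp del: of_nat_mult)
  also have "\<dots> = (12 * real k / real v) ^ (4 * d * r * v)"
    by (simp only: prod_constant card_lessThan power_block_exponent power_mult[of _ "4 * d * r" v])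
  also have "\<dots> \<le> (12 * real (d * r) / \<sigma> ^ 2) ^ (4 * d * r * v)"
  proof (rule power_mono)
    have "real k0 \<le> real (v * d * r)" using k0_le by (simp only: of_nat_le_iff)
    then have "real k * real k0 \<le> real k * real (v * d * r)" by (rule mult_left_mono) simp
    then show "12 * real k / real v \<le> 12 * real (d * r) / \<sigma> ^ 2"
      unfolding \<sigma>2 using kpos v by (simp add: field_simps)
  qed simp
  also have "\<dots> = ((12 * real (d * r)) ^ (4 * d * r)) ^ v / \<sigma> ^ (8 * d * r * v)"
  proof -
    have "(\<sigma> ^ 2) ^ (4 * d * r * v) = \<sigma> ^ (8 * d * r * v)"
      by (simp only: power_mult[symmetric]) (rule arg_cong[where f = "power \<sigma>"], simp)
    then show ?thesis by (simp only: power_divide power_mult)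
  qed
  also have "\<dots> \<le> (2 ^ b) ^ v / \<sigma> ^ (8 * d * r * v)"
    using b \<sigma> by (intro divide_right_mono power_mono) auto
  also have "\<dots> \<le> (1 / \<sigma> ^ (2 * b * v)) / \<sigma> ^ (8 * d * r * v)"
  proof -
    have "(2 * \<sigma> ^ 2) ^ (b * v) \<le> 1" using two by (intro power_le_one) auto
    then have "(2 ^ b) ^ v * \<sigma> ^ (2 * b * v) \<le> 1" by (simp add: power_mult_distrib mult_ac flip: power_mult)
    then have "(2 ^ b) ^ v \<le> 1 / \<sigma> ^ (2 * b * v)" using \<sigma> by (simp add: field_simps)
    then show ?thesis using \<sigma> by (intro divide_right_mono) auto
  qed
  also have "\<dots> = 1 / \<sigma> ^ ((2 * b + 8 * d * r) * v)"
    by (simp add: power_add[symmetric] algebra_simps)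
  finally have F: "(\<Prod>w<2*d*r. \<bar>poly (blk w) (real k)\<bar>) \<le> 1 / \<sigma> ^ ((2 * b + 8 * d * r) * v)" .
  have Qk: "Q (real k) > 0" "Q (real k0) > 0" using Q_pos kpos by auto
  have "fact (2 * v) / Q (real k) = (fact (2 * v) / Q (real k0)) * (Q (real k0) / Q (real k))" using Qk by simp
  then have "\<bar>R a (real k)\<bar> = E a * (Q (real k0) / Q (real k)) ^ a * (\<Prod>w<2*d*r. \<bar>poly (blk w) (real k)\<bar>)"
    using a Qk by (subst R_eq) (simp_all only: abs_mult abs_prod power_abs power_mult_distrib E_def abs_of_nonneg, simp_all add: power_mult_distrib)
  also have "\<dots> \<le> E a * (\<sigma> ^ (2 * v + 1)) ^ a * (1 / \<sigma> ^ ((2 * b + 8 * d * r) * v))"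
    using E_pos[of a] Q_ratio[of k] k Qk \<sigma> F
    by (intro mult_mono power_mono order.refl) (auto simp: \<sigma>_def intro!: prod_nonneg)
  also have "\<dots> = E a * (\<sigma> ^ ((2 * v + 1) * a) / \<sigma> ^ ((2 * b + 8 * d * r) * v))"
    by (simp only: power_mult mult.assoc times_divide_eq_right mult_1_right)
  also have "\<dots> \<le> E a * \<sigma> ^ (v * a)"
  proof -
    have "(2 * b + 8 * d * r) * v \<le> a * v" using a by (rule mult_right_mono) simp
    then have "v * a + (2 * b + 8 * d * r) * v \<le> (2 * v + 1) * a" by (simp add: algebra_simps)
    then have "\<sigma> ^ ((2 * v + 1) * a) \<le> \<sigma> ^ (v * a + (2 * b + 8 * d * r) * v)"
      using \<sigma> by (intro power_decreasing) auto
    then have "\<sigma> ^ ((2 * v + 1) * a) / \<sigma> ^ ((2 * b + 8 * d * r) * v) \<le> \<sigma> ^ (v * a)"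
      using \<sigma> by (simp add: power_add field_simps)
    then show ?thesis using E_pos[of a] by (intro mult_left_mono) auto
  qed
  finally show ?thesis by (simp add: \<sigma>_def)
qed

lemma abs_R_tail_summable:
  assumes a: "2 * b + 8 * d * r \<le> a" "a \<ge> 6" and b: "(12 * real (d * r)) ^ (4 * d * r) \<le> 2 ^ b"
    and k: "k > k0 + v * d * r"
  shows "\<bar>R a (real k)\<bar> \<le> E a * (1 / 2) ^ v * (real k0)\<^sup>2 * (1 / (real k)\<^sup>2)"
proof -
  define \<rho> where "\<rho> = real k0 / real k"
  have kpos: "k > 0" "k0 > 0" using k k0_ge by auto
  have \<rho>: "0 \<le> \<rho>" "\<rho> \<le> 1 / 2" using k k0_le kpos by (auto simp: \<rho>_def field_simps)
  \<comment> \<open>Since a \<ge> 6, two powers of \<rho> are left besides \<rho>^v: they make the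
    sum over k bounded, while \<rho>^v \<le> 2^(-v) makes it small.\<close>
  have "2 * (v + 2) \<le> v * 6" using v by simp
  also have "\<dots> \<le> v * a" using a(2) by (rule mult_left_mono) simp
  finally have "2 * (v + 2) \<le> v * a" .
  then have "sqrt \<rho> ^ (v * a) \<le> sqrt \<rho> ^ (2 * (v + 2))" using \<rho> by (intro power_decreasing) auto
  also have "\<dots> = (sqrt \<rho> ^ 2) ^ (v + 2)" by (rule power_mult)
  also have "\<dots> = \<rho> ^ v * \<rho>\<^sup>2" using \<rho> by (simp add: power_add power2_eq_square)
  also have "\<dots> \<le> (1 / 2) ^ v * \<rho>\<^sup>2" using \<rho> by (intro mult_right_mono power_mono) auto
  finally have "E a * sqrt \<rho> ^ (v * a) \<le> E a * ((1 / 2) ^ v * \<rho>\<^sup>2)" using E_pos[of a] by (intro mult_left_mono) auto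
  moreover have "\<bar>R a (real k)\<bar> \<le> E a * sqrt \<rho> ^ (v * a)"
    unfolding \<rho>_def by (rule abs_R_tail[OF a(1) b k])
  ultimately have "\<bar>R a (real k)\<bar> \<le> E a * ((1 / 2) ^ v * \<rho>\<^sup>2)" by linarith
  then show ?thesis by (simp add: \<rho>_def power_divide mult_ac)
qed

text \<open>All terms before the tail vanish except the one at \<open>k0\<close>. The bound is
  uniform in N and so passes to the limit of the partial sums.\<close>

lemma partial_sum_close:
  fixes f :: "nat \<Rightarrow> real"
  assumes a: "2 * b + 8 * d * r \<le> a" "a \<ge> 6" and b: "(12 * real (d * r)) ^ (4 * d * r) \<le> 2 ^ b"
    and f: "f k0 = 1" "\<And>k. k \<ge> 1 \<Longrightarrow> \<bar>f k\<bar> \<le> M" and N: "N \<ge> k0"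
  shows "\<bar>(\<Sum>k=1..N. f k * R a (real k)) - R a (real k0)\<bar> \<le> E a * (M * (1 / 2) ^ v * (2 * (real (v * d * r))\<^sup>2))"
proof -
  have a': "2 * d * r \<le> a" using a by linarith
  have M: "M \<ge> 0" using f(2)[of 1] by simp
  define e where "e = M * (E a * (1 / 2) ^ v * (real k0)\<^sup>2)"
  have e: "e \<ge> 0" using M E_pos[of a] by (simp add: e_def)
  have "(\<Sum>k=1..N. f k * R a (real k)) = f k0 * R a (real k0) + (\<Sum>k\<in>{1..N} - {k0}. f k * R a (real k))"
    using N k0_ge(2) by (intro sum.remove) auto
  then have "\<bar>(\<Sum>k=1..N. f k * R a (real k)) - R a (real k0)\<bar> = \<bar>\<Sum>k\<in>{1..N} - {k0}. f k * R a (real k)\<bar>"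
    using f(1) by simp
  also have "\<dots> \<le> (\<Sum>k\<in>{1..N} - {k0}. \<bar>f k * R a (real k)\<bar>)" by (rule sum_abs)
  also have "\<dots> \<le> (\<Sum>k\<in>{1..N} - {k0}. e * (1 / (real k)\<^sup>2))"
  proof (rule sum_mono)
    fix k assume k: "k \<in> {1..N} - {k0}"
    show "\<bar>f k * R a (real k)\<bar> \<le> e * (1 / (real k)\<^sup>2)"
    proof (cases "k \<le> k0 + v * d * r")
      case True
      then have "R a (real k) = 0" using k by (intro R_eq_0[OF a']) auto
      then show ?thesis using e by simp
    next
      case False
      then have "\<bar>R a (real k)\<bar> \<le> E a * (1 / 2) ^ v * (real k0)\<^sup>2 * (1 / (real k)\<^sup>2)"
        by (intro abs_R_tail_summable[OF a b]) simp
      then have "\<bar>f k\<bar> * \<bar>R a (real k)\<bar> \<le> M * (E a * (1 / 2) ^ v * (real k0)\<^sup>2 * (1 / (real k)\<^sup>2))"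
        using f(2)[of k] k M by (intro mult_mono) auto
      then show ?thesis by (simp only: e_def abs_mult mult.assoc)
    qed
  qed
  also have "\<dots> \<le> (\<Sum>k=1..N. e * (1 / (real k)\<^sup>2))" using e by (intro sum_mono2) auto
  also have "\<dots> = e * (\<Sum>k=1..N. 1 / (real k)\<^sup>2)" by (simp add: sum_distrib_left)
  also have "\<dots> \<le> e * 2" using e by (intro mult_left_mono sum_inverse_squares_le_2)
  also have "\<dots> = E a * (M * (1 / 2) ^ v * (2 * (real k0)\<^sup>2))" by (simp add: e_def)
  also have "\<dots> \<le> E a * (M * (1 / 2) ^ v * (2 * (real (v * d * r))\<^sup>2))"
    using k0_le M E_pos[of a] by (intro mult_left_mono power_mono) (auto simp del: of_nat_mult)
  finally show ?thesis .
qed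

text \<open>Use (2v)! \<le> (2v)^(2v), and note that every factor of \<open>Q\<close> at
  \<open>k0\<close> is at least vr/2, which exceeds 1, since 2 k0 \<ge> vdr. The quotient of the two
  bases is 4/r.\<close>

lemma E_le: "E a \<le> (4 / real r) ^ (2 * v * a)"
proof -
  have "v * d * r \<le> 2 * k0" using k0_ge(3) by simp
  then have "real (v * d * r) \<le> real (2 * k0)" by (simp only: of_nat_le_iff)
  then have y: "real v * real r / 2 \<le> real k0 / real d" using d by (simp add: field_simps)
  have "1 * 4 \<le> real v * real r" using v r by (intro mult_mono) auto
  then have c1: "real v * real r / 2 \<ge> 1" by simp
  have "(real v * real r / 2) ^ (2 * v) \<le> (real v * real r / 2) ^ (2 * v + 1)" using c1 by (intro power_increasing) auto
  also have "\<dots> = (\<Prod>i\<in>{..2 * v}. real v * real r / 2)" by simp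
  also have "\<dots> \<le> Q (real k0)" unfolding Q_def using y c1 by (intro prod_mono) (auto intro: order_trans)
  finally have Q: "(real v * real r / 2) ^ (2 * v) \<le> Q (real k0)" .
  have "fact (2 * v) \<le> (real ((2 * v) ^ (2 * v)))" by (rule fact_le_power)
  then have "fact (2 * v) / Q (real k0) \<le> (2 * real v) ^ (2 * v) / (real v * real r / 2) ^ (2 * v)"
    using Q c1 by (intro frac_le) auto
  also have "\<dots> = (4 / real r) ^ (2 * v)"
  proof -
    have "2 * real v / (real v * real r / 2) = 4 / real r" using v r by (simp add: field_simps)
    then show ?thesis by (simp only: power_divide[symmetric])
  qed
  finally have "fact (2 * v) / Q (real k0) \<le> (4 / real r) ^ (2 * v)" .
  then have "E a \<le> ((4 / real r) ^ (2 * v)) ^ a"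
    unfolding E_def using Q_pos[of "real k0"] k0_ge(2) by (intro power_mono) auto
  then show ?thesis by (simp only: power_mult)
qed

end

text \<open>Prepares the comparison of consecutive forms. Passing to v + 1 raises k0/d by r, which
  is at most 2/v times k0/d, so the old factors of \<open>Q\<close> grow together by at most (1 +
  2/v)^(2v+1) \<le> exp 6, and each of the two new factors is at most (v+1)(r+2). The loss is
  polynomial in v.\<close>

lemma E_le_E_Suc:
  assumes "1 \<le> m" "m \<le> d" "r \<ge> 4" "v \<ge> 1"
  shows "rational_function.E d m r v a
    \<le> (exp 6 * ((real v + 1) * (real r + 2))\<^sup>2) ^ a * rational_function.E d m r (Suc v) a"
proof -
  interpret v: rational_function d m r v using assms by unfold_locales
  interpret w: rational_function d m r "Suc v" using assms by unfold_locales auto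
  define y where "y = real (rational_function.k0 d m r v) / real d"
  have "rational_function.k0 d m r (Suc v) = rational_function.k0 d m r v + d * r" using v.k0_eq w.k0_eq by (simp add: algebra_simps)
  then have y': "real (rational_function.k0 d m r (Suc v)) / real d = y + real r" using v.d by (simp add: y_def field_simps)
  have "v * d * r \<le> 2 * rational_function.k0 d m r v" using v.k0_ge(3) by simp
  then have "real (v * d * r) \<le> real (2 * rational_function.k0 d m r v)" by (simp only: of_nat_le_iff)
  then have y: "real v * real r \<le> 2 * y" using v.d by (simp add: y_def field_simps)
  moreover have "real v * real r > 0" using assms by simp
  ultimately have ypos: "y > 0" by linarith
  have "real (rational_function.k0 d m r (Suc v)) \<le> real (Suc v * d * r)" using w.k0_le by (simp only: of_nat_le_iff)
  then have yr: "y + real r \<le> (real v + 1) * real r" unfolding y'[symmetric] using v.d by (simp add: field_simps)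
  have "rational_function.Q d (Suc v) (real (rational_function.k0 d m r (Suc v))) = (\<Prod>i\<in>{..2 * v}. y + real r + real i) * ((y + real r + real (2 * v + 1)) * (y + real r + real (2 * v + 2)))"
    by (simp add: w.Q_def y' mult.assoc)
  also have "\<dots> \<le> (\<Prod>i\<in>{..2 * v}. (1 + 2 / real v) * (y + real i)) * (((real v + 1) * (real r + 2)) * ((real v + 1) * (real r + 2)))"
  proof (intro mult_mono prod_mono conjI)
    fix i
    have "real r \<le> 2 / real v * y" using y assms by (simp add: field_simps)
    also have "\<dots> \<le> 2 / real v * (y + real i)" by (intro mult_left_mono) auto
    finally show "y + real r + real i \<le> (1 + 2 / real v) * (y + real i)" by (simp add: algebra_simps)
  next
    show "y + real r + real (2 * v + 1) \<le> (real v + 1) * (real r + 2)"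
      "y + real r + real (2 * v + 2) \<le> (real v + 1) * (real r + 2)"
      using yr by (simp_all add: algebra_simps)
  qed (use ypos in \<open>auto intro!: prod_nonneg mult_nonneg_nonneg\<close>)
  also have "\<dots> = (1 + 2 / real v) ^ (2 * v + 1) * rational_function.Q d v (real (rational_function.k0 d m r v)) * ((real v + 1) * (real r + 2))\<^sup>2"
    by (simp add: prod.distrib v.Q_def y_def power2_eq_square)
  also have "\<dots> \<le> exp 6 * rational_function.Q d v (real (rational_function.k0 d m r v)) * ((real v + 1) * (real r + 2))\<^sup>2"
  proof (intro mult_right_mono)
    have "(1 + 2 / real v) ^ (2 * v + 1) \<le> exp (2 / real v) ^ (2 * v + 1)"
      by (intro power_mono exp_ge_add_one_self) auto
    also have "\<dots> = exp (real (2 * v + 1) * (2 / real v))" by (rule exp_of_nat_mult[symmetric])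
    also have "\<dots> \<le> exp 6" using assms by (simp add: field_simps)
    finally show "(1 + 2 / real v) ^ (2 * v + 1) \<le> exp 6" .
  qed (use v.Q_pos[of "real (rational_function.k0 d m r v)"] v.k0_ge(2) in auto)
  finally have Q: "rational_function.Q d (Suc v) (real (rational_function.k0 d m r (Suc v))) \<le> exp 6 * rational_function.Q d v (real (rational_function.k0 d m r v)) * ((real v + 1) * (real r + 2))\<^sup>2" .
  have pos: "rational_function.Q d (Suc v) (real (rational_function.k0 d m r (Suc v))) > 0" "rational_function.Q d v (real (rational_function.k0 d m r v)) > 0"
    using v.Q_pos[of "real (rational_function.k0 d m r v)"] v.k0_ge(2) w.Q_pos[of "real (rational_function.k0 d m r (Suc v))"] w.k0_ge(2) by auto
  have "fact (2 * v) \<le> (fact (2 * Suc v) :: real)" by (intro fact_mono) simp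
  then have "fact (2 * v) * rational_function.Q d (Suc v) (real (rational_function.k0 d m r (Suc v))) \<le> fact (2 * Suc v) * (exp 6 * rational_function.Q d v (real (rational_function.k0 d m r v)) * ((real v + 1) * (real r + 2))\<^sup>2)"
    using Q pos by (intro mult_mono) auto
  then have "fact (2 * v) / rational_function.Q d v (real (rational_function.k0 d m r v)) \<le> (exp 6 * ((real v + 1) * (real r + 2))\<^sup>2) * (fact (2 * Suc v) / rational_function.Q d (Suc v) (real (rational_function.k0 d m r (Suc v))))"
    using pos by (simp add: divide_simps) (simp add: mult_ac)
  then have "(fact (2 * v) / rational_function.Q d v (real (rational_function.k0 d m r v))) ^ a \<le> ((exp 6 * ((real v + 1) * (real r + 2))\<^sup>2) * (fact (2 * Suc v) / rational_function.Q d (Suc v) (real (rational_function.k0 d m r (Suc v))))) ^ a"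
    using pos by (intro power_mono) auto
  then show ?thesis unfolding v.E_def w.E_def by (simp only: power_mult_distrib)
qed

section \<open>Asymptotics of the linear forms\<close>

lemma eventually_poly_le_two_power: "eventually (\<lambda>v. C * (real v + 1) ^ p \<le> 2 ^ v) sequentially"
  by real_asymp

text \<open>\<open>q\<close> records the cost of the blocks as 2^(qv) and enters as an error term
  only. Everything else that is polynomial in v, including the dependence on \<open>K\<close> and
  \<open>M\<close>, disappears in 2^v for large v.\<close>

lemma key_inequality:
  fixes f :: "nat \<Rightarrow> real" and \<theta> :: "nat \<Rightarrow> real" and U W :: "nat \<Rightarrow> nat \<Rightarrow> int" and L :: "nat \<Rightarrow> real"
  assumes m: "1 \<le> m" "m \<le> d" and r: "r \<ge> 4" and a: "a \<ge> 6"
    and q: "(12 * real (d * r)) ^ (4 * d * r) \<le> 2 ^ q" "2 * q + 8 * d * r \<le> a" and \<epsilon>: "\<epsilon> > 0"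
    and per: "\<And>k. k \<ge> 1 \<Longrightarrow> f (k + d) = f k" and bnd: "\<And>k. k \<ge> 1 \<Longrightarrow> \<bar>f k\<bar> \<le> M" and fm: "f m = 1"
    and L: "\<And>j. j \<in> {2..a} \<Longrightarrow> even (a + j) \<Longrightarrow> (\<lambda>N. \<Sum>k=1..N. f k / real k ^ j) \<longlonglongrightarrow> L j"
    and U: "\<And>k. k \<ge> 1 \<Longrightarrow> f k = (\<Sum>l<\<delta>. of_int (U k l) * \<theta> l)"
    and W: "\<And>j. j \<in> {2..a} \<Longrightarrow> even (a + j) \<Longrightarrow> L j = (\<Sum>l<\<delta>. of_int (W j l) * \<theta> l)"
    and U_le: "\<And>k. k \<ge> 1 \<Longrightarrow> (\<Sum>l<\<delta>. \<bar>U k l\<bar>) \<le> K"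
    and W_le: "\<And>j. j \<in> {2..a} \<Longrightarrow> even (a + j) \<Longrightarrow> (\<Sum>l<\<delta>. \<bar>W j l\<bar>) \<le> K" and K: "K \<ge> 0"
  shows "2 * real a * ln (real r / 4) \<le>
    real \<delta> * (2 * real a * real d * (1 + \<epsilon>) + 2 * real a * ln 2 + 3 * (real q + 1) * ln 2)"
proof -
  define D where "D v = lcm_upto (2 * d * v)" for v
  define k0 where "k0 v = rational_function.k0 d m r v" for v
  define R where "R v = rational_function.R d m r v a" for v
  define E where "E v = rational_function.E d m r v a" for v
  have d: "d \<ge> 1" using m by simp
  have loc: "rational_function d m r v" if "v \<ge> 1" for v using m r that by unfold_locales
  have a': "2 * d * r \<le> a" "1 \<le> a" "2 \<le> a" using q a by linarith+
  have f_k0: "f (k0 v) = 1" if "v \<ge> 1" for v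
  proof -
    interpret rf: rational_function d m r v by (rule loc[OF that])
    have fi: "f (m + d * i) = f m" for i
    proof (induction i)
      case (Suc i)
      have "f (m + d * Suc i) = f ((m + d * i) + d)" by (simp add: algebra_simps)
      also have "\<dots> = f (m + d * i)" using m by (intro per) simp
      finally show ?case using Suc by simp
    qed simp
    have "v * r \<ge> 1" using that r by simp
    then obtain i where "v * r = Suc i" by (cases "v * r") auto
    then have "v * d * r = d + d * i" by (metis mult.assoc mult.left_commute mult_Suc_right)
    then have "k0 v = m + d * i" using rf.k0_eq unfolding k0_def by linarith
    then show ?thesis using fi fm by simp
  qed
  have D_pos: "D v > 0" for v by (simp add: D_def lcm_upto_pos)
  have D_mono: "D v \<le> D w" if "v \<le> w" for v w unfolding D_def using that by (intro lcm_upto_mono) simp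
  define Bd where "Bd v = fact a * real d ^ a * 2 ^ (2 * v * a) * ((12 * real (d * r)) ^ (4 * d * r)) ^ v" for v
  define Pr :: "nat \<Rightarrow> (nat \<Rightarrow> int) \<Rightarrow> real \<Rightarrow> bool" where "Pr v X V \<longleftrightarrow>
      (\<lambda>N. \<Sum>k=1..N. f k * R v (real k)) \<longlonglongrightarrow> V \<and>
      2 * real (D v) ^ a * V = (\<Sum>l<\<delta>. of_int (X l) * \<theta> l) \<and>
      real_of_int (\<Sum>l<\<delta>. \<bar>X l\<bar>) \<le> 2 * real (D v) ^ a * Bd v * of_int K * (real (d * (2 * v)) + 1)" for v X V
  have ex: "\<exists>X V. Pr v X V" if v: "v \<ge> 1" for v
  proof -
    interpret rf: rational_function d m r v by (rule loc[OF v])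
    have dvd: "k dvd D v" if "k \<in> {1..d * (2 * v)}" for k
      unfolding D_def using that by (intro dvd_lcm_upto) (auto simp: mult_ac)
    obtain X :: "nat \<Rightarrow> int" and V where "(\<lambda>N. \<Sum>k=1..N. f k * R v (real k)) \<longlonglongrightarrow> V"
      "2 * real (D v) ^ a * V = (\<Sum>l<\<delta>. of_int (X l) * \<theta> l)"
      "real_of_int (\<Sum>l<\<delta>. \<bar>X l\<bar>) \<le> 2 * real (D v) ^ a * Bd v * of_int K * (real (d * (2 * v)) + 1)"
    proof (rule linear_form[OF _ d _ _ dvd per bnd L U W U_le W_le K])
      show "pfrac d (2 * v) (D v) a (Bd v) (R v)"
        unfolding Bd_def R_def by (rule rf.pfrac_R[OF dvd a'(2,1)])
      show "R v (- real (d * (2 * v)) - t) = (-1) ^ a * R v t" for t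
        unfolding R_def by (rule rf.R_parity)
      show "((\<lambda>t. t * R v t) \<longlongrightarrow> 0) at_top" unfolding R_def by (rule rf.R_decay[OF a'(3)])
      fix X :: "nat \<Rightarrow> int" and V
      assume "(\<lambda>N. \<Sum>k=1..N. f k * R v (real k)) \<longlonglongrightarrow> V"
        "2 * real (D v) ^ a * V = (\<Sum>l<\<delta>. of_int (X l) * \<theta> l)"
        "real_of_int (\<Sum>l<\<delta>. \<bar>X l\<bar>) \<le> 2 * real (D v) ^ a * Bd v * of_int K * (real (d * (2 * v)) + 1)"
      then show thesis by (rule that)
    qed
    then show ?thesis unfolding Pr_def by blast
  qed
  define p where "p v = (SOME p. Pr v (fst p) (snd p))" for v
  define X V where "X v = fst (p v)" and "V v = snd (p v)" for v
  have Pr: "Pr v (X v) (V v)" if "v \<ge> 1" for v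
    unfolding X_def V_def p_def by (rule someI_ex) (use ex[OF that] in auto)
  have V: "(\<lambda>N. \<Sum>k=1..N. f k * R v (real k)) \<longlonglongrightarrow> V v"
    and XV: "2 * real (D v) ^ a * V v = (\<Sum>l<\<delta>. of_int (X v l) * \<theta> l)"
    and X_le: "real_of_int (\<Sum>l<\<delta>. \<bar>X v l\<bar>) \<le> 2 * real (D v) ^ a * Bd v * of_int K * (real (d * (2 * v)) + 1)"
    if "v \<ge> 1" for v
    using Pr[OF that] unfolding Pr_def by blast+
  define T where "T v = (\<Sum>l<\<delta>. of_int (X v l) * \<theta> l)" for v
  have T: "T v = 2 * real (D v) ^ a * V v" if "v \<ge> 1" for v using XV[OF that] by (simp add: T_def)
  define P where "P v = exp 6 * ((real v + 1) * (real r + 2))\<^sup>2" for v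
  \<comment> \<open>The polynomial factors to be absorbed: the tail of the series relative to the
    term at k0, the loss between consecutive forms, and the constants in the coefficient
    bound.\<close>
  have "eventually (\<lambda>v. (4 * M * (real (d * r))\<^sup>2) * (real v + 1) ^ 2 \<le> 2 ^ v) sequentially"
    "eventually (\<lambda>v. (4 * (exp 6 * (real r + 2)\<^sup>2) ^ a) * (real v + 1) ^ (2 * a) \<le> 2 ^ v) sequentially"
    "eventually (\<lambda>v. (2 * fact a * real d ^ a * of_int K * (2 * real d + 1)) * (real v + 1) ^ 1 \<le> 2 ^ v) sequentially"
    "eventually (\<lambda>v. v \<ge> (2::nat)) sequentially"
    by (rule eventually_poly_le_two_power eventually_ge_at_top)+
  then have "eventually (\<lambda>v. (4 * M * (real (d * r))\<^sup>2) * (real v + 1) ^ 2 \<le> 2 ^ v \<and>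
     (4 * (exp 6 * (real r + 2)\<^sup>2) ^ a) * (real v + 1) ^ (2 * a) \<le> 2 ^ v \<and>
     (2 * fact a * real d ^ a * of_int K * (2 * real d + 1)) * (real v + 1) ^ 1 \<le> 2 ^ v \<and> v \<ge> 2) sequentially"
    by eventually_elim simp
  then obtain v0 where v0: "\<And>v. v \<ge> v0 \<Longrightarrow> (4 * M * (real (d * r))\<^sup>2) * (real v + 1) ^ 2 \<le> 2 ^ v \<and>
     (4 * (exp 6 * (real r + 2)\<^sup>2) ^ a) * (real v + 1) ^ (2 * a) \<le> 2 ^ v \<and>
     (2 * fact a * real d ^ a * of_int K * (2 * real d + 1)) * (real v + 1) ^ 1 \<le> 2 ^ v \<and> v \<ge> 2"
    unfolding eventually_sequentially by blast
  have M: "M \<ge> 0" using bnd[of 1] by simp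
  have E_pos: "E v > 0" if "v \<ge> v0" for v
    unfolding E_def using v0[OF that] by (intro rational_function.E_pos loc) simp
  have V_bounds: "E v / 2 \<le> \<bar>V v\<bar>" "\<bar>V v\<bar> \<le> 2 * E v * (2 ^ q) ^ v" if v: "v \<ge> v0" for v
  proof -
    have v1: "v \<ge> 1" using v0[OF v] by simp
    interpret rf: rational_function d m r v by (rule loc[OF v1])
    have "M * (1 / 2) ^ v * (2 * (real (v * d * r))\<^sup>2) = (M * 2 * (real (d * r))\<^sup>2 * real v ^ 2) / 2 ^ v"
      by (simp add: power_mult_distrib power_one_over divide_simps mult_ac)
    also have "\<dots> \<le> 1 / 2"
    proof -
      have "4 * M * (real (d * r))\<^sup>2 * real v ^ 2 \<le> 4 * M * (real (d * r))\<^sup>2 * (real v + 1) ^ 2"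
        using M by (intro mult_left_mono power_mono) auto
      then have "4 * M * (real (d * r))\<^sup>2 * real v ^ 2 \<le> 2 ^ v" using v0[OF v] by linarith
      then show ?thesis by (simp add: divide_simps)
    qed
    finally have small: "M * (1 / 2) ^ v * (2 * (real (v * d * r))\<^sup>2) \<le> 1 / 2" .
    have "\<bar>(\<Sum>k=1..N. f k * R v (real k)) - R v (real (k0 v))\<bar> \<le> E v / 2" if N: "N \<ge> k0 v" for N
    proof -
      have "\<bar>(\<Sum>k=1..N. f k * R v (real k)) - R v (real (k0 v))\<bar> \<le> E v * (M * (1 / 2) ^ v * (2 * (real (v * d * r))\<^sup>2))"
        unfolding R_def E_def k0_def
        by (rule rf.partial_sum_close[OF q(2) a q(1)]) (use f_k0[OF v1] bnd N in \<open>auto simp: k0_def\<close>)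
      also have "\<dots> \<le> E v * (1 / 2)" using small E_pos[OF v] by (intro mult_left_mono) auto
      finally show ?thesis by simp
    qed
    then have "\<bar>V v - R v (real (k0 v))\<bar> \<le> E v / 2"
      by (intro tendsto_upperbound[OF tendsto_rabs[OF tendsto_diff[OF V[OF v1] tendsto_const]]])
         (auto simp: eventually_sequentially)
    moreover have "E v \<le> \<bar>R v (real (k0 v))\<bar>" "\<bar>R v (real (k0 v))\<bar> \<le> E v * ((12 * real (d * r)) ^ (4 * d * r)) ^ v"
      unfolding R_def E_def k0_def using rf.abs_R_k0[OF a'(1)] by auto
    moreover have "E v * ((12 * real (d * r)) ^ (4 * d * r)) ^ v \<le> E v * (2 ^ q) ^ v"
      using q(1) E_pos[OF v] by (intro mult_left_mono power_mono) auto
    moreover have "E v * 1 \<le> E v * (2 ^ q) ^ v" using E_pos[OF v] by (intro mult_left_mono) auto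
    ultimately show "E v / 2 \<le> \<bar>V v\<bar>" "\<bar>V v\<bar> \<le> 2 * E v * (2 ^ q) ^ v" by linarith+
  qed
  have T_le: "\<bar>T v\<bar> \<le> 4 * real (D v) ^ a * E v * (2 ^ q) ^ v" if "v \<ge> v0" for v
  proof -
    have "\<bar>T v\<bar> = 2 * real (D v) ^ a * \<bar>V v\<bar>" using T[of v] v0[OF that] by (simp add: abs_mult)
    also have "\<dots> \<le> 2 * real (D v) ^ a * (2 * E v * (2 ^ q) ^ v)"
      using V_bounds[OF that] by (intro mult_left_mono) auto
    finally show ?thesis by simp
  qed
  have T_ge: "real (D v) ^ a * E v \<le> \<bar>T v\<bar>" if "v \<ge> v0" for v
  proof -
    have "2 * real (D v) ^ a * (E v / 2) \<le> 2 * real (D v) ^ a * \<bar>V v\<bar>"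
      using V_bounds[OF that] by (intro mult_left_mono) auto
    also have "\<dots> = \<bar>T v\<bar>" using T[of v] v0[OF that] by (simp add: abs_mult)
    finally show ?thesis by simp
  qed
  \<comment> \<open>\<open>\<eta>\<close> allows 2^q per unit of v for the gap between upper and
    lower bound of a form, and one more factor 2 for polynomial terms. In \<open>A\<close> the decay
    of \<open>E\<close> competes with the growth of \<open>D^a\<close>; in \<open>B\<close> the
    growth of \<open>D^a\<close> is joined by the binomial factor 2^(2a).\<close>
  define \<eta> where "\<eta> = (real q + 1) * ln 2"
  define A where "A = 2 * real a * ln (real r / 4) - 2 * real a * real d * (1 + \<epsilon>) - \<eta>"
  define B where "B = 2 * real a * real d * (1 + \<epsilon>) + (2 * real a + real q + 1) * ln 2"
  have exp_ln2: "exp (real n * ln 2) = 2 ^ n" for n by (simp add: exp_of_nat_mult)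
  have "A \<le> (real \<delta> - 1) * (B + 2 * \<eta>)"
  proof (rule linear_independence_criterion[where T = T and X = X and \<theta> = \<theta>])
    show "T v = (\<Sum>l<\<delta>. of_int (X v l) * \<theta> l)" for v by (simp add: T_def)
    show "T v \<noteq> 0" if "v \<ge> v0" for v
    proof -
      have "real (D v) ^ a * E v > 0" using E_pos[OF that] D_pos[of v] by simp
      then show ?thesis using T_ge[OF that] by auto
    qed
    show "exp (- \<eta> * real (Suc v)) * \<bar>T v\<bar> \<le> \<bar>T (Suc v)\<bar>" if v: "v \<ge> v0" for v
    proof -
      have v1: "v \<ge> 1" using v0[OF v] by simp
      \<comment> \<open>Only monotonicity of \<open>D\<close> enters, so the comparison holds for
        every v \<ge> v0, although \<open>D\<close> is bounded above merely along an infinite set of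
        indices.\<close>
      have DS: "real (D v) ^ a \<le> real (D (Suc v)) ^ a" using D_mono[of v "Suc v"] by (intro power_mono) auto
      have ES: "E v \<le> P v ^ a * E (Suc v)" unfolding E_def P_def by (rule E_le_E_Suc[OF m r v1])
      have P: "4 * P v ^ a \<le> 2 ^ v"
      proof -
        have "P v ^ a = (exp 6 * (real r + 2)\<^sup>2) ^ a * (real v + 1) ^ (2 * a)"
          unfolding power_mult[of "real v + 1" 2 a] by (simp only: P_def power_mult_distrib mult_ac)
        then show ?thesis using v0[OF v] by simp
      qed
      have "\<bar>T v\<bar> \<le> 4 * real (D v) ^ a * E v * (2 ^ q) ^ v" by (rule T_le[OF v])
      also have "\<dots> \<le> 4 * real (D (Suc v)) ^ a * (P v ^ a * E (Suc v)) * (2 ^ q) ^ v"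
        using DS ES E_pos[OF v] by (intro mult_mono) auto
      also have "\<dots> = (real (D (Suc v)) ^ a * E (Suc v)) * ((4 * P v ^ a) * (2 ^ q) ^ v)" by simp
      also have "\<dots> \<le> \<bar>T (Suc v)\<bar> * (2 ^ v * (2 ^ q) ^ v)"
        using T_ge[of "Suc v"] v P by (intro mult_mono) (auto simp: P_def)
      also have "2 ^ v * (2 ^ q) ^ v \<le> (2::real) ^ ((q + 1) * Suc v)"
      proof -
        have "(2::real) ^ v * (2 ^ q) ^ v = 2 ^ (v + q * v)" by (simp only: power_add power_mult)
        also have "\<dots> \<le> 2 ^ ((q + 1) * Suc v)" by (intro power_increasing) auto
        finally show ?thesis .
      qed
      finally have "\<bar>T v\<bar> \<le> \<bar>T (Suc v)\<bar> * 2 ^ ((q + 1) * Suc v)" by (simp add: mult_left_mono)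
      moreover have "exp (- \<eta> * real (Suc v)) = 1 / 2 ^ ((q + 1) * Suc v)"
      proof -
        have "- \<eta> * real (Suc v) = - (real ((q + 1) * Suc v) * ln 2)" by (simp add: \<eta>_def algebra_simps)
        then show ?thesis by (simp only: exp_minus exp_ln2) (simp add: inverse_eq_divide)
      qed
      ultimately show ?thesis by (simp only: times_divide_eq_left mult_1_left) (simp only: pos_divide_le_eq zero_less_power zero_less_numeral)
    qed
    show "\<eta> > 0" by (simp add: \<eta>_def add_nonneg_pos)
    show "B \<ge> 0" using \<epsilon> by (simp add: B_def)
    fix N
    obtain w where w: "w \<ge> max N v0" "ln (real (lcm_upto (2 * d * w))) \<le> (1 + \<epsilon>) * real (2 * d * w)"
      using lcm_upto_infinitely_often_small[of "2 * d" \<epsilon> "max N v0"] d \<epsilon> by auto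
    have wv0: "w \<ge> v0" "w \<ge> N" using w by auto
    have Dw: "real (D w) ^ a \<le> exp (2 * real a * real d * (1 + \<epsilon>) * real w)"
    proof -
      have "real (D w) = exp (ln (real (D w)))" using D_pos by simp
      also have "\<dots> \<le> exp ((1 + \<epsilon>) * real (2 * d * w))" using w(2) by (simp add: D_def)
      finally have "real (D w) ^ a \<le> exp ((1 + \<epsilon>) * real (2 * d * w)) ^ a" by (intro power_mono) auto
      also have "\<dots> = exp (2 * real a * real d * (1 + \<epsilon>) * real w)" by (simp add: exp_of_nat_mult[symmetric] mult_ac)
      finally show ?thesis .
    qed
    have w2: "(4::real) \<le> 2 ^ w"
      using v0[OF wv0(1)] power_increasing[of 2 w "2::real"] by simp
    have T_up: "\<bar>T w\<bar> \<le> exp (- A * real w)"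
    proof -
      have "\<bar>T w\<bar> \<le> 4 * real (D w) ^ a * E w * (2 ^ q) ^ w" by (rule T_le[OF wv0(1)])
      also have "\<dots> \<le> 2 ^ w * exp (2 * real a * real d * (1 + \<epsilon>) * real w) * (4 / real r) ^ (2 * w * a) * (2 ^ q) ^ w"
      proof (intro mult_mono w2 Dw order.refl)
        show "E w \<le> (4 / real r) ^ (2 * w * a)"
          unfolding E_def using v0[OF wv0(1)] by (intro rational_function.E_le loc) simp
      qed (use E_pos[OF wv0(1)] in auto)
      also have "\<dots> = exp (- A * real w)"
      proof -
        have "(4 / real r) ^ (2 * w * a) = exp (- (real (2 * w * a) * ln (real r / 4)))"
          using r by (simp only: exp_minus exp_of_nat_mult) (simp add: power_divide field_simps)
        moreover have "(2 ^ q) ^ w = exp (real (q * w) * ln 2)" "2 ^ w = exp (real w * ln 2)"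
          by (simp_all only: exp_ln2 power_mult)
        ultimately show ?thesis by (simp add: mult_exp_exp A_def \<eta>_def algebra_simps)
      qed
      finally show ?thesis .
    qed
    \<comment> \<open>The lcm bound is known at w alone; monotonicity carries it to the coefficients
      at all earlier v, as the criterion demands.\<close>
    have X_up: "real_of_int (\<Sum>l<\<delta>. \<bar>X v l\<bar>) \<le> exp (B * real w)" if v: "v0 \<le> v" "v \<le> w" for v
    proof -
      have v1: "v \<ge> 1" using v0[OF v(1)] by simp
      have "real_of_int (\<Sum>l<\<delta>. \<bar>X v l\<bar>) \<le> 2 * real (D v) ^ a * Bd v * of_int K * (real (d * (2 * v)) + 1)" by (rule X_le[OF v1])
      also have "\<dots> \<le> 2 * real (D w) ^ a * (fact a * real d ^ a * 2 ^ (2 * w * a) * (2 ^ q) ^ w) * of_int K * (real (d * (2 * w)) + 1)"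
      proof (intro mult_mono power_mono order.refl add_mono)
        show "Bd v \<le> fact a * real d ^ a * 2 ^ (2 * w * a) * (2 ^ q) ^ w"
          unfolding Bd_def
        proof (intro mult_mono order.refl)
          show "(2::real) ^ (2 * v * a) \<le> 2 ^ (2 * w * a)" using v by (intro power_increasing) auto
          have "((12 * real (d * r)) ^ (4 * d * r)) ^ v \<le> (2 ^ q) ^ v" using q(1) by (intro power_mono) auto
          also have "\<dots> \<le> (2 ^ q) ^ w" using v by (intro power_increasing) auto
          finally show "((12 * real (d * r)) ^ (4 * d * r)) ^ v \<le> (2 ^ q) ^ w" .
        qed auto
        show "real (D v) \<le> real (D w)" using D_mono[OF v(2)] by simp
        show "real (d * (2 * v)) \<le> real (d * (2 * w))" using v(2) by (simp only: of_nat_le_iff) simp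
      qed (use K in \<open>auto simp: Bd_def\<close>)
      also have "\<dots> = (2 * fact a * real d ^ a * of_int K * (real (d * (2 * w)) + 1)) * (real (D w) ^ a * 2 ^ (2 * w * a) * (2 ^ q) ^ w)"
        by simp
      also have "\<dots> \<le> 2 ^ w * (exp (2 * real a * real d * (1 + \<epsilon>) * real w) * 2 ^ (2 * w * a) * (2 ^ q) ^ w)"
      proof (intro mult_mono Dw order.refl)
        have "real (d * (2 * w)) + 1 \<le> (2 * real d + 1) * (real w + 1)" by (simp add: algebra_simps)
        then have "(2 * fact a * real d ^ a * of_int K) * (real (d * (2 * w)) + 1) \<le> (2 * fact a * real d ^ a * of_int K) * ((2 * real d + 1) * (real w + 1))"
          using K by (intro mult_left_mono) auto
        also have "\<dots> \<le> 2 ^ w" using v0[OF wv0(1)] by (simp add: mult.assoc)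
        finally show "2 * fact a * real d ^ a * of_int K * (real (d * (2 * w)) + 1) \<le> 2 ^ w" by simp
      qed auto
      also have "\<dots> = exp (B * real w)"
      proof -
        have "(2 ^ q) ^ w = exp (real (q * w) * ln 2)" "2 ^ w = exp (real w * ln 2)" "2 ^ (2 * w * a) = exp (real (2 * w * a) * ln 2)"
          by (simp_all only: exp_ln2 power_mult)
        then show ?thesis by (simp add: mult_exp_exp B_def algebra_simps)
      qed
      finally show ?thesis .
    qed
    show "\<exists>w\<ge>N. \<bar>T w\<bar> \<le> exp (- A * real w) \<and> (\<forall>v. v0 \<le> v \<and> v \<le> w \<longrightarrow> (\<Sum>l<\<delta>. \<bar>X v l\<bar>) \<le> exp (B * real w))"
      using wv0(2) T_up X_up by (intro exI[of _ w]) simp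
  qed
  \<comment> \<open>The 1 subtracted from \<delta> pays for the growth of \<open>D^a\<close> inside
    \<open>A\<close>: 2ad(1 + \<epsilon>) + \<eta> is at most B + 2\<eta>.\<close>
  moreover have "(real \<delta> - 1) * (B + 2 * \<eta>) = real \<delta> * (B + 2 * \<eta>) - (B + 2 * \<eta>)" by (simp add: algebra_simps)
  moreover have B: "B + 2 * \<eta> = 2 * real a * real d * (1 + \<epsilon>) + 2 * real a * ln 2 + 3 * (real q + 1) * ln 2"
    by (simp add: B_def \<eta>_def algebra_simps)
  moreover have "B = 2 * real a * real d * (1 + \<epsilon>) + (2 * real a) * ln 2 + \<eta>"
    by (simp add: B_def \<eta>_def algebra_simps)
  moreover have "0 \<le> (2 * real a) * ln 2 + 2 * \<eta>" by (simp add: \<eta>_def)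
  ultimately have "2 * real a * ln (real r / 4) \<le> real \<delta> * (B + 2 * \<eta>)" unfolding A_def by linarith
  then show ?thesis unfolding B .
qed

section \<open>The dimension bound\<close>

interpretation rat_vs: vector_space qscale
  by unfold_locales (simp_all add: qscale_def algebra_simps of_rat_add of_rat_mult)

lemma common_denominator:
  assumes "finite (A :: rat set)"
  shows "\<exists>N::int. N > 0 \<and> (\<forall>x\<in>A. of_int N * x \<in> \<int>)"
  using assms
proof (induction A rule: finite_induct)
  case empty
  then show ?case by (intro exI[of _ 1]) simp
next
  case (insert x A)
  then obtain N :: int where N: "N > 0" "\<And>y. y \<in> A \<Longrightarrow> of_int N * y \<in> \<int>" by blast
  obtain u w where uw: "quotient_of x = (u, w)" by (cases "quotient_of x")
  then have w: "w > 0" "x = of_int u / of_int w" using quotient_of_denom_pos quotient_of_div by auto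
  have "of_int (N * w) * y \<in> \<int>" if "y \<in> insert x A" for y
  proof (cases "y = x")
    case True
    have "of_int (N * w) * x = of_int (N * u)" using w by simp
    then show ?thesis using True by (metis Ints_of_int)
  next
    case False
    then have "of_int N * y \<in> \<int>" using that N(2) by blast
    then have "of_int w * (of_int N * y) \<in> \<int>" by (rule Ints_mult[OF Ints_of_int])
    then show ?thesis by (simp add: mult_ac)
  qed
  then show ?case using N(1) w(1) by (intro exI[of _ "N * w"]) auto
qed

text \<open>Coordinates in a basis taken from \<open>S\<close>, with denominators cleared. The map
  sending s to Re(s/c0) is Q-linear, so the images of the basis vectors serve as \<theta>; they may
  be dependent, as only their number enters the criterion.\<close>

lemma integer_coordinates:
  assumes fin: "finite S" and m: "c0 \<noteq> (0::complex)"
  obtains \<theta> :: "nat \<Rightarrow> real" and z :: "complex \<Rightarrow> nat \<Rightarrow> int"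
  where "\<And>s. s \<in> S \<Longrightarrow> Re (s / c0) = (\<Sum>l<qdim S. of_int (z s l) * \<theta> l)"
proof -
  obtain B where B: "B \<subseteq> S" "rat_vs.independent B" "S \<subseteq> rat_vs.span B" "card B = rat_vs.dim S"
    by (rule rat_vs.basis_exists)
  define \<delta> where "\<delta> = qdim S"
  have finB: "finite B" using B(1) fin by (rule finite_subset)
  have cardB: "card B = \<delta>" using B(4) by (simp add: \<delta>_def qdim_def)
  obtain g where g: "bij_betw g {..<\<delta>} B"
    using ex_bij_betw_nat_finite[OF finB] by (auto simp: cardB atLeast0LessThan)
  have "\<exists>u. s = (\<Sum>b\<in>B. qscale (u b) b)" if "s \<in> S" for s
    using B(3) that unfolding rat_vs.span_finite[OF finB] by auto
  then obtain u where u: "\<And>s. s \<in> S \<Longrightarrow> s = (\<Sum>b\<in>B. qscale (u s b) b)" by metis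
  have "finite ((\<lambda>(s, b). u s b) ` (S \<times> B))" using fin finB by auto
  from common_denominator[OF this] obtain N :: int where N: "N > 0" "\<And>s b. s \<in> S \<Longrightarrow> b \<in> B \<Longrightarrow> of_int N * u s b \<in> \<int>"
    by auto
  define z where "z s l = \<lfloor>of_int N * u s (g l)\<rfloor>" for s l
  define \<theta> where "\<theta> l = Re (g l / c0) / of_int N" for l
  have "Re (s / c0) = (\<Sum>l<\<delta>. of_int (z s l) * \<theta> l)" if s: "s \<in> S" for s
  proof -
    have "s / c0 = (\<Sum>b\<in>B. qscale (u s b) b / c0)"
      by (subst u[OF s]) (rule sum_divide_distrib)
    also have "\<dots> = (\<Sum>l<\<delta>. qscale (u s (g l)) (g l) / c0)" by (rule sum.reindex_bij_betw[OF g, symmetric])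
    finally have "Re (s / c0) = (\<Sum>l<\<delta>. Re (qscale (u s (g l)) (g l) / c0))" by simp
    also have "\<dots> = (\<Sum>l<\<delta>. of_int (z s l) * \<theta> l)"
    proof (intro sum.cong refl)
      fix l assume "l \<in> {..<\<delta>}"
      then have "g l \<in> B" using g by (auto simp: bij_betw_def)
      then have "of_int (z s l) = of_int N * u s (g l)"
        using N(2)[OF s] unfolding z_def by (simp add: of_int_floor_cancel)
      then have "of_rat (of_int (z s l)) = (of_rat (of_int N * u s (g l)) :: real)" by simp
      then have 1: "real_of_int (z s l) = of_int N * of_rat (u s (g l))" by (simp add: of_rat_mult)
      have "(of_rat x :: complex) = complex_of_real (of_rat x)" for x by (cases x) (simp add: of_rat_rat)
      then have "Re (qscale (u s (g l)) (g l) / c0) = of_rat (u s (g l)) * Re (g l / c0)"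
        unfolding qscale_def by (simp flip: times_divide_eq_right)
      then show "Re (qscale (u s (g l)) (g l) / c0) = of_int (z s l) * \<theta> l"
        unfolding 1 \<theta>_def using N(1) by simp
    qed
    finally show ?thesis .
  qed
  then show ?thesis using that unfolding \<delta>_def by blast
qed

definition generators :: "nat \<Rightarrow> (nat \<Rightarrow> complex) \<Rightarrow> nat \<Rightarrow> complex set" where
  "generators d c a = {c m | m. 1 \<le> m \<and> m \<le> d} \<union> {dir_L c j | j. 2 \<le> j \<and> j \<le> a \<and> j mod 2 = a mod 2}"

lemma finite_generators: "finite (generators d c a)"
proof -
  have "generators d c a \<subseteq> c ` {..d} \<union> dir_L c ` {..a}" unfolding generators_def by auto
  then show ?thesis by (rule finite_subset) auto
qed

lemma periodic_in_range:
  fixes c :: "nat \<Rightarrow> 'a"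
  assumes "d \<ge> 1" "\<And>k. k \<ge> 1 \<Longrightarrow> c (k + d) = c k" "k \<ge> 1"
  shows "\<exists>m. 1 \<le> m \<and> m \<le> d \<and> c k = c m"
  using assms(3)
proof (induction k rule: less_induct)
  case (less k)
  show ?case
  proof (cases "k \<le> d")
    case False
    then have "c k = c (k - d)" using assms(2)[of "k - d"] by simp
    then show ?thesis using less.IH[of "k - d"] False assms(1) by auto
  qed (use less.prems in auto)
qed

lemma dir_L_sums:
  assumes "\<And>k. k \<ge> 1 \<Longrightarrow> norm (c k) \<le> M" "j \<ge> 2"
  shows "(\<lambda>k. c (Suc k) / of_nat (Suc k) ^ j) sums dir_L c j"
proof -
  have "summable (\<lambda>k. M * inverse (real k ^ 2))" by (intro summable_mult inverse_power_summable) simp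
  then have "summable (\<lambda>k. M * inverse (real (Suc k) ^ 2))" by (subst summable_Suc_iff)
  then have "summable (\<lambda>k. c (Suc k) / of_nat (Suc k) ^ j)"
  proof (rule summable_comparison_test[rotated], intro exI allI impI)
    fix k
    have "real (Suc k) ^ 2 \<le> real (Suc k) ^ j" using assms(2) by (intro power_increasing) auto
    then have "norm (c (Suc k)) / real (Suc k) ^ j \<le> M / real (Suc k) ^ 2"
      using assms(1)[of "Suc k"] order_trans[OF norm_ge_zero assms(1)[of "Suc k"]] by (intro frac_le) auto
    moreover have "norm (c (Suc k) / of_nat (Suc k) ^ j) = norm (c (Suc k)) / real (Suc k) ^ j"
      by (simp add: norm_divide norm_power del: of_nat_Suc)
    ultimately show "norm (c (Suc k) / of_nat (Suc k) ^ j) \<le> M * inverse (real (Suc k) ^ 2)"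
      by (simp only: divide_inverse)
  qed
  then show ?thesis unfolding dir_L_def by (rule summable_sums)
qed

lemma delta_key_inequality:
  assumes d: "d \<ge> 1" and per: "\<And>k. k \<ge> 1 \<Longrightarrow> c (k + d) = c k" and nz: "\<exists>k\<ge>1. c k \<noteq> (0::complex)"
    and r: "r \<ge> 4" and a: "a \<ge> 6"
    and q: "(12 * real (d * r)) ^ (4 * d * r) \<le> 2 ^ q" "2 * q + 8 * d * r \<le> a" and \<epsilon>: "\<epsilon> > 0"
  shows "2 * real a * ln (real r / 4) \<le>
    real (delta d c a) * (2 * real a * real d * (1 + \<epsilon>) + 2 * real a * ln 2 + 3 * (real q + 1) * ln 2)"
proof -
  have range: "\<exists>m. 1 \<le> m \<and> m \<le> d \<and> c k = c m" if "k \<ge> 1" for k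
    by (rule periodic_in_range[of d c k]) (use d per that in auto)
  obtain m where m: "1 \<le> m" "m \<le> d" "c m \<noteq> 0" using nz range by metis
  define S where "S = generators d c a"
  have fin: "finite S" unfolding S_def by (rule finite_generators)
  have delta: "delta d c a = qdim S" by (simp add: delta_def S_def generators_def)
  obtain \<theta> :: "nat \<Rightarrow> real" and z :: "complex \<Rightarrow> nat \<Rightarrow> int"
    where z: "\<And>s. s \<in> S \<Longrightarrow> Re (s / c m) = (\<Sum>l<delta d c a. of_int (z s l) * \<theta> l)"
    unfolding delta using integer_coordinates[OF fin m(3)] by metis
  have cS: "c k \<in> S" if "k \<ge> 1" for k
    using range[OF that] by (auto simp: S_def generators_def)
  have LS: "dir_L c j \<in> S" if "j \<in> {2..a}" "even (a + j)" for j
    unfolding S_def generators_def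
    by (rule UnI2, rule CollectI, rule exI[of _ j]) (use that in \<open>auto, presburger\<close>)
  \<comment> \<open>A crude bound, but it does not depend on v, which is all that the asymptotics
    require.\<close>
  define K where "K = (\<Sum>s\<in>S. \<Sum>l<delta d c a. \<bar>z s l\<bar>)"
  have K_le: "(\<Sum>l<delta d c a. \<bar>z s l\<bar>) \<le> K" if "s \<in> S" for s
    unfolding K_def using fin that by (intro member_le_sum) (auto intro: sum_nonneg)
  have bnd: "norm x \<le> (\<Sum>s\<in>S. norm s)" if "x \<in> S" for x
    using fin that by (intro member_le_sum) auto
  show ?thesis
  proof (rule key_inequality[OF m(1,2) r a q \<epsilon>, where f = "\<lambda>k. Re (c k / c m)" and L = "\<lambda>j. Re (dir_L c j / c m)"
        and \<theta> = \<theta> and U = "\<lambda>k. z (c k)" and W = "\<lambda>j. z (dir_L c j)" and K = K and M = "(\<Sum>s\<in>S. norm s) / norm (c m)"])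
    show "Re (c (k + d) / c m) = Re (c k / c m)" if "k \<ge> 1" for k using per[OF that] by simp
    show "\<bar>Re (c k / c m)\<bar> \<le> (\<Sum>s\<in>S. norm s) / norm (c m)" if "k \<ge> 1" for k
    proof -
      have "\<bar>Re (c k / c m)\<bar> \<le> norm (c k / c m)" by (rule abs_Re_le_cmod)
      also have "\<dots> \<le> (\<Sum>s\<in>S. norm s) / norm (c m)"
        unfolding norm_divide using bnd[OF cS[OF that]] by (intro divide_right_mono) auto
      finally show ?thesis .
    qed
    show "Re (c m / c m) = 1" using m by simp
    show "(\<lambda>N. \<Sum>k=1..N. Re (c k / c m) / real k ^ j) \<longlonglongrightarrow> Re (dir_L c j / c m)"
      if "j \<in> {2..a}" "even (a + j)" for j
    proof -
      have "(\<lambda>k. c (Suc k) / of_nat (Suc k) ^ j) sums dir_L c j"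
        using bnd cS that by (intro dir_L_sums[of _ "\<Sum>s\<in>S. norm s"]) auto
      then have "(\<lambda>N. Re ((\<Sum>k<N. c (Suc k) / of_nat (Suc k) ^ j) / c m)) \<longlonglongrightarrow> Re (dir_L c j / c m)"
        unfolding sums_def by (intro tendsto_Re tendsto_divide tendsto_const) (use m in auto)
      moreover have "Re ((\<Sum>k<N. c (Suc k) / of_nat (Suc k) ^ j) / c m) = (\<Sum>k=1..N. Re (c k / c m) / real k ^ j)" for N
      proof -
        have "Re (x / of_nat k ^ j / c m) = Re (x / c m) / real k ^ j" for x k
        proof -
          have "x / of_nat k ^ j / c m = (x / c m) / complex_of_real (real k ^ j)" by simp
          then show ?thesis by (simp only: Re_divide_of_real)
        qed
        then have "Re ((\<Sum>k<N. c (Suc k) / of_nat (Suc k) ^ j) / c m) = (\<Sum>k<N. Re (c (Suc k) / c m) / real (Suc k) ^ j)"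
          by (simp only: sum_divide_distrib Re_sum)
        also have "\<dots> = (\<Sum>k=1..N. Re (c k / c m) / real k ^ j)"
          by (rule sum.reindex_bij_witness[of _ "\<lambda>k. k - 1" Suc]) auto
        finally show ?thesis .
      qed
      ultimately show ?thesis by simp
    qed
    show "Re (c k / c m) = (\<Sum>l<delta d c a. of_int (z (c k) l) * \<theta> l)" if "k \<ge> 1" for k
      by (rule z[OF cS[OF that]])
    show "Re (dir_L c j / c m) = (\<Sum>l<delta d c a. of_int (z (dir_L c j) l) * \<theta> l)"
      if "j \<in> {2..a}" "even (a + j)" for j
      by (rule z[OF LS[OF that]])
    show "(\<Sum>l<delta d c a. \<bar>z (c k) l\<bar>) \<le> K" if "k \<ge> 1" for k by (rule K_le[OF cS[OF that]])
    show "(\<Sum>l<delta d c a. \<bar>z (dir_L c j) l\<bar>) \<le> K" if "j \<in> {2..a}" "even (a + j)" for j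
      by (rule K_le[OF LS[OF that]])
    show "K \<ge> 0" unfolding K_def by (intro sum_nonneg) auto
  qed
qed

lemma delta_ge_log:
  fixes C :: real
  assumes d: "d \<ge> 1" and per: "\<And>k. k \<ge> 1 \<Longrightarrow> c (k + d) = c k" and nz: "\<exists>k\<ge>1. c k \<noteq> (0::complex)"
    and C: "C > real d + ln 2"
  shows "\<exists>A. \<forall>a\<ge>A. ln (real a) / C \<le> real (delta d c a)"
proof -
  \<comment> \<open>The slack g is shared out: a quarter for the \<epsilon> in the lcm bound, a
    quarter for the term with q, and the remaining half, encoded in \<beta> < 1, for replacing
    ln(r/4) by ln a.\<close>
  define g where "g = C - (real d + ln 2)"
  define \<epsilon> where "\<epsilon> = g / (4 * real d)"
  define \<beta> where "\<beta> = (real d + ln 2 + g / 2) / C"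
  have g: "g > 0" using C by (simp add: g_def)
  have \<epsilon>: "\<epsilon> > 0" "real d * \<epsilon> = g / 4" using g d by (simp_all add: \<epsilon>_def)
  have Cpos: "C > 0" using C ln_gt_zero[of "2::real"] of_nat_0_le_iff[of d, where 'a = real] by linarith
  have \<beta>: "\<beta> < 1" using Cpos g by (simp add: \<beta>_def g_def field_simps)
  define \<delta> where "\<delta> = real d"
  have \<delta>: "\<delta> > 0" using d by (simp add: \<delta>_def)
  \<comment> \<open>In terms of x = a/ln^2 a, which bounds r from above, the facts are: r is at
    least 4, the side condition 2q + 8dr \<le> a, smallness of the term with q compared to a, and
    ln(r/4) \<ge> \<beta> ln a.\<close>
  have "eventually (\<lambda>a::nat. real a / ln (real a) ^ 2 - 1 \<ge> 4) sequentially" by real_asymp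
  moreover have "eventually (\<lambda>a::nat. 2 * (4 * \<delta> * (real a / ln (real a) ^ 2) * (ln (12 * \<delta> * (real a / ln (real a) ^ 2)) / ln 2) + 1)
      + 8 * \<delta> * (real a / ln (real a) ^ 2) \<le> real a) sequentially"
    using \<delta> by real_asymp
  moreover have "eventually (\<lambda>a::nat. 3 * (4 * \<delta> * (real a / ln (real a) ^ 2) * (ln (12 * \<delta> * (real a / ln (real a) ^ 2)) / ln 2) + 2) * ln 2
      \<le> g / 2 * real a) sequentially"
    using \<delta> g by real_asymp
  moreover have "eventually (\<lambda>a::nat. \<beta> * ln (real a) \<le> ln ((real a / ln (real a) ^ 2 - 1) / 4)) sequentially"
    using \<beta> by real_asymp
  moreover have "eventually (\<lambda>a::nat. a \<ge> 6) sequentially" by (rule eventually_ge_at_top)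
  ultimately have "eventually (\<lambda>a::nat. ln (real a) / C \<le> real (delta d c a)) sequentially"
  proof eventually_elim
    case (elim a)
    define x where "x = real a / ln (real a) ^ 2"
    note elim = elim[folded x_def]
    define r where "r = nat \<lfloor>x\<rfloor>"
    have r: "real r \<le> x" "x - 1 \<le> real r" using elim(1) unfolding r_def by linarith+
    then have r4: "r \<ge> 4" using elim(1) by linarith
    \<comment> \<open>The binary logarithm of the block cost (12dr)^(4dr); q is this number rounded
      up.\<close>
    define y where "y = 4 * real d * real r * (ln (12 * real (d * r)) / ln 2)"
    define q where "q = nat \<lceil>y\<rceil>"
    have dr: "real (d * r) \<ge> 1" using d r4 by (metis One_nat_def Suc_leI mult_pos_pos of_nat_1 of_nat_mono zero_less_numeral less_le_trans zero_less_one)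
    have ypos: "y \<ge> 0" unfolding y_def using dr by (intro mult_nonneg_nonneg divide_nonneg_pos ln_ge_zero) auto
    have q: "y \<le> real q" "real q \<le> y + 1" using ypos unfolding q_def by linarith+
    have y_le: "y \<le> 4 * \<delta> * x * (ln (12 * \<delta> * x) / ln 2)"
      unfolding y_def \<delta>_def
    proof (intro mult_mono divide_right_mono)
      have "real (d * r) \<le> real d * x" using r(1) by (simp add: mult_left_mono)
      then show "ln (12 * real (d * r)) \<le> ln (12 * real d * x)"
        unfolding mult.assoc[of 12 "real d"] using dr by (subst ln_le_cancel_iff) linarith+
    qed (use r dr in \<open>auto intro!: divide_nonneg_pos ln_ge_zero\<close>)
    have pow: "(12 * real (d * r)) ^ (4 * d * r) \<le> 2 ^ q"
    proof -
      have "(12 * real (d * r)) ^ (4 * d * r) = exp (real (4 * d * r) * ln (12 * real (d * r)))"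
        using dr by (subst exp_of_nat_mult) simp
      also have "real (4 * d * r) * ln (12 * real (d * r)) = y * ln 2" by (simp add: y_def)
      also have "exp (y * ln 2) \<le> exp (real q * ln 2)" using q(1) by simp
      also have "\<dots> = 2 ^ q" by (simp add: exp_of_nat_mult)
      finally show ?thesis .
    qed
    have "2 * real q + 8 * real d * real r \<le> 2 * (4 * \<delta> * x * (ln (12 * \<delta> * x) / ln 2) + 1) + 8 * \<delta> * x"
      using q y_le r(1) by (intro add_mono mult_mono) (auto simp: \<delta>_def)
    also have "\<dots> \<le> real a" by (rule elim)
    finally have "real (2 * q + 8 * d * r) \<le> real a" by simp
    then have qa: "2 * q + 8 * d * r \<le> a" by (simp only: of_nat_le_iff)
    have "2 * real a * ln (real r / 4) \<le>
      real (delta d c a) * (2 * real a * real d * (1 + \<epsilon>) + 2 * real a * ln 2 + 3 * (real q + 1) * ln 2)"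
      by (rule delta_key_inequality[OF d per nz r4 elim(5) pow qa \<epsilon>(1)])
    also have "\<dots> \<le> real (delta d c a) * (2 * real a * (real d + ln 2 + g / 2))"
    proof (rule mult_left_mono)
      have "3 * (real q + 1) * ln 2 \<le> 3 * (4 * \<delta> * x * (ln (12 * \<delta> * x) / ln 2) + 2) * ln 2"
        using q y_le by (intro mult_right_mono) auto
      also have "\<dots> \<le> g / 2 * real a" by (rule elim)
      finally have "3 * (real q + 1) * ln 2 \<le> g / 2 * real a" .
      moreover have "2 * real a * real d * (1 + \<epsilon>) = 2 * real a * real d + 2 * real a * (real d * \<epsilon>)"
        by (simp add: algebra_simps)
      moreover have "2 * real a * (real d + ln 2 + g / 2) = 2 * real a * real d + 2 * real a * ln 2 + g * real a"
        by (simp add: algebra_simps)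
      moreover have "2 * real a * (g / 4) = g / 2 * real a" "g / 2 * real a + g / 2 * real a = g * real a"
        by (simp_all add: field_simps)
      ultimately show "2 * real a * real d * (1 + \<epsilon>) + 2 * real a * ln 2 + 3 * (real q + 1) * ln 2
          \<le> 2 * real a * (real d + ln 2 + g / 2)"
        unfolding \<epsilon>(2) by linarith
    qed simp
    finally have "2 * real a * ln (real r / 4) \<le> 2 * real a * (real (delta d c a) * (C * \<beta>))"
      using Cpos by (simp add: \<beta>_def mult_ac)
    then have "ln (real r / 4) \<le> real (delta d c a) * (C * \<beta>)" using elim(5) by simp
    moreover have "ln ((x - 1) / 4) \<le> ln (real r / 4)" using elim(1) r by (subst ln_le_cancel_iff) auto
    ultimately have "\<beta> * ln (real a) \<le> \<beta> * (real (delta d c a) * C)" using elim(4) by (simp add: mult_ac)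
    moreover have "\<beta> > 0" unfolding \<beta>_def using Cpos g by (auto intro!: divide_pos_pos add_nonneg_pos)
    ultimately have "ln (real a) \<le> real (delta d c a) * C" by simp
    then show ?case using Cpos by (simp add: pos_divide_le_eq)
  qed
  then show ?thesis unfolding eventually_sequentially .
qed

text \<open>The coefficients add at most d to the dimension, so a finite spanning set for the
  L-values of one parity would bound \<open>delta\<close> uniformly in a, against its logarithmic
  growth.\<close>

lemma delta_le_if_spanned:
  assumes "finite B" and "\<And>j. 2 \<le> j \<Longrightarrow> j \<le> a \<Longrightarrow> j mod 2 = a mod 2 \<Longrightarrow> dir_L c j \<in> module.span qscale B"
  shows "delta d c a \<le> card B + d"
proof -
  let ?W = "c ` {1..d} \<union> B"
  have "generators d c a \<subseteq> rat_vs.span ?W"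
  proof
    fix s assume "s \<in> generators d c a"
    then consider "s \<in> c ` {1..d}" | "s \<in> rat_vs.span B" using assms(2) by (auto simp: generators_def)
    then show "s \<in> rat_vs.span ?W"
    proof cases
      case 1
      then show ?thesis by (intro rat_vs.span_base) simp
    next
      case 2
      then show ?thesis using rat_vs.span_mono[of B ?W] by blast
    qed
  qed
  then have "delta d c a \<le> card ?W"
    unfolding delta_def qdim_def generators_def[symmetric] using assms(1) by (intro rat_vs.dim_le_card) auto
  also have "\<dots> \<le> card (c ` {1..d}) + card B" by (rule card_Un_le)
  also have "\<dots> \<le> d + card B" using card_image_le[of "{1..d}" c] by simp
  finally show ?thesis by simp
qed

theorem theorem1p1:
  fixes d :: nat and c :: "nat \<Rightarrow> complex" and C :: real
  assumes "d \<ge> 1"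
    and "\<And>k. k \<ge> 1 \<Longrightarrow> c (k + d) = c k"
    and "\<exists>k\<ge>1. c k \<noteq> 0"
    and "C > real d + ln 2"
  shows "(\<exists>A. \<forall>a::nat. a \<ge> A \<longrightarrow> real (delta d c a) \<ge> ln (real a) / C)
       \<and> q_infinite_dim {dir_L c (2 * n) | n. n \<ge> 1}
       \<and> q_infinite_dim {dir_L c (2 * n + 1) | n. n \<ge> 1}"
proof -
  obtain A where A: "\<And>a. a \<ge> A \<Longrightarrow> ln (real a) / C \<le> real (delta d c a)"
    using delta_ge_log[OF assms] by blast
  have Cpos: "C > 0" using assms(4) ln_gt_zero[of "2::real"] of_nat_0_le_iff[of d, where 'a = real] by linarith
  \<comment> \<open>The offset e fixes the parity of the argument of \<open>delta\<close>: 0 serves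
    the even L-values and 1 the odd ones.\<close>
  have unbounded: "\<exists>n\<ge>1. D < delta d c (2 * n + e)" for D e
  proof -
    have "filterlim (\<lambda>n. ln (real (2 * n + e)) / C) at_top sequentially" using Cpos by real_asymp
    then have "eventually (\<lambda>n. ln (real (2 * n + e)) / C > real D) sequentially"
      by (simp add: filterlim_at_top_dense)
    moreover have "eventually (\<lambda>n. n \<ge> max 1 A) sequentially" by (rule eventually_ge_at_top)
    ultimately have "eventually (\<lambda>n. n \<ge> 1 \<and> D < delta d c (2 * n + e)) sequentially"
    proof eventually_elim
      case (elim n)
      then have "real D < real (delta d c (2 * n + e))" using A[of "2 * n + e"] by linarith
      then show ?case using elim by simp
    qed
    then show ?thesis using eventually_happens'[OF sequentially_bot] by blast
  qed
  have even: "q_infinite_dim {dir_L c (2 * n) | n. n \<ge> 1}"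
    unfolding q_infinite_dim_def
  proof (intro allI impI notI)
    fix B assume B: "finite B" "{dir_L c (2 * n) | n. n \<ge> 1} \<subseteq> module.span qscale B"
    obtain n where n: "card B + d < delta d c (2 * n + 0)" using unbounded by blast
    have "dir_L c j \<in> module.span qscale B" if "2 \<le> j" "j mod 2 = (2 * n + 0) mod 2" for j
    proof -
      from that(2) have "2 dvd j" by auto
      then obtain k where k: "j = 2 * k" by (elim dvdE)
      then have "dir_L c j \<in> {dir_L c (2 * n) | n. n \<ge> 1}" using that(1) by auto
      then show ?thesis using B(2) by (rule subsetD[rotated])
    qed
    then have "delta d c (2 * n + 0) \<le> card B + d" by (intro delta_le_if_spanned B(1))
    then show False using n by simp
  qed
  have odd: "q_infinite_dim {dir_L c (2 * n + 1) | n. n \<ge> 1}"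
    unfolding q_infinite_dim_def
  proof (intro allI impI notI)
    fix B assume B: "finite B" "{dir_L c (2 * n + 1) | n. n \<ge> 1} \<subseteq> module.span qscale B"
    obtain n where n: "card B + d < delta d c (2 * n + 1)" using unbounded by blast
    have "dir_L c j \<in> module.span qscale B" if "2 \<le> j" "j mod 2 = (2 * n + 1) mod 2" for j
    proof -
      from that(2) have "odd j" by (auto simp: odd_iff_mod_2_eq_one)
      then obtain k where k: "j = 2 * k + 1" by (elim oddE)
      then have "k \<ge> 1" using that(1) by simp
      then have "dir_L c j \<in> {dir_L c (2 * n + 1) | n. n \<ge> 1}" unfolding k by blast
      then show ?thesis using B(2) by (rule subsetD[rotated])
    qed
    then have "delta d c (2 * n + 1) \<le> card B + d" by (intro delta_le_if_spanned B(1))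
    then show False using n by simp
  qed
  show ?thesis using A even odd by blast
qed

end
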